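(* Let $\zeta\in\mathbb Z$, $i\in\{1,2\}$, $a,b,c\in\mathbb Z_{\ge0}$. (1) If $(-1)^{i}\zeta+b-2c+\varsigma_i\le 0$, $(-1)^{\tau i}\zeta+a-2b+3c+\varsigma_{\tau i}\le 0$ and $b\ge a+c$, then $B^{(a)}_{\tau i}B^{(b)}_{i}B^{(c)}_{\tau i}1_{\zeta}=\mathfrak{B}^{(a,b,c)}_{i,\zeta}$ in $\dot{\mathbf U}^\imath1_\zeta$. (2) Let $m,n\in\mathbb Z_{\ge0}$ with $m-n=\zeta$. If $(-1)^{i}(m-n)+b-2c+\varsigma_{i}\leq 0$ and $(-1)^{\tau i}(m-n)+a-2b+3c+\varsigma_{\tau i}\leq 0$, then $\mathfrak{B}^{(a,b,c)}_{i,\zeta}\eta=B^{(a)}_{\tau i}B^{(b)}_{i}B^{(c)}_{\tau i}\eta$ in $L(m,n)$.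
   Context: For $r\in\mathbb Z$: $[r]=\frac{q^r-q^{-r}}{q-q^{-1}}$; $[r]!=[1]\cdots[r]$, $[0]!=1$; $X^{(r)}=X^r/[r]!$ for $r\ge0$ and $X^{(r)}=0$ for $r<0$. $\mathbf U=U_q(\mathfrak{sl}_3)$ is the $\mathbb Q(q)$-algebra generated by $E_i,F_i,K_i^{\pm1}$, $i\in\{1,2\}$, with $K_1K_2=K_2K_1$, $K_iE_jK_i^{-1}=q^{a_{ij}}E_j$, $K_iF_jK_i^{-1}=q^{-a_{ij}}F_j$ ($a_{ii}=2$, $a_{12}=a_{21}=-1$), $E_iF_j-F_jE_i=\delta_{ij}\frac{K_i-K_i^{-1}}{q-q^{-1}}$, and for $i\ne j$ the Serre relations $E_jE_i^{(2)}-E_iE_jE_i+E_i^{(2)}E_j=0$, $F_jF_i^{(2)}-F_iF_jF_i+F_i^{(2)}F_j=0$. $\tau$ swaps $1$ and $2$. The parameter is $\varsigma=(\varsigma_1,\varsigma_2)\in\{(1,0),(0,1)\}$. $\mathbf U^\imath$ is the subalgebra of $\mathbf U$ generated by $B_i=F_i+q^{\varsigma_i}E_{\tau i}K_i^{-1}$, $k_i=K_iK_{\tau i}^{-1}$. $\psi^\imath$ is the $\mathbb Q$-algebra automorphism of $\mathbf U^\imath$ with $q\mapsto q^{-1}$, $B_i\mapsto B_i$, $k_i\mapsto k_i^{-1}$. For $m,n\ge0$, $L(m,n)$ is the simple $\mathbf U$-module of highest weight $m\omega_1+n\omega_2$ with highest weight vector $\eta$; $\psi^\imath$ also denotes the anti-linear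 involution of $L(m,n)=\mathbf U^\imath\eta$ with $\psi^\imath(u\eta)=\psi^\imath(u)\eta$. iCanonical basis of $L(m,n)$: put $m_1=m$, $m_2=n$. For $a,b,c\ge0$, $b\ge a+c$ with $F_{\tau i}^{(a)}F_i^{(b)}F_{\tau i}^{(c)}\eta\neq0$ (equivalently $c\le m_{\tau i}$, $b-c\le m_i$), $\mathfrak B_i^{(a,b,c)}\eta\in L(m,n)$ is the unique $\psi^\imath$-invariant element of $F_{\tau i}^{(a)}F_i^{(b)}F_{\tau i}^{(c)}\eta+\sum_{x,y\ge0,(x,y)\ne(0,0)}q^{-1}\mathbb Z[q^{-1}]F_{\tau i}^{(a-x)}F_i^{(b-x-y)}F_{\tau i}^{(c-y)}\eta$. Modified iquantum group: $X^\imath\cong\mathbb Z$ via $m\omega_1+n\omega_2\mapsto m-n$. $\dot{\mathbf U}^\imath$ is spanned by $x1_\lambda$ ($x\in\mathbf U^\imath,\lambda\in X^\imath$), is a $\mathbf U^\imath$-bimodule, with $1_\lambda1_\mu=\delta_{\lambda\mu}1_\lambda$, $B_i1_\lambda=1_{\lambda-\alpha_i}B_i$, $k_i1_\lambda=q^{\langle h_i-h_{\tau i},\lambda\rangle}1_\lambda=1_\lambda k_i$ ($\alpha_1\mapsto3$, $\alpha_2\mapsto-3$ in $\mathbb Z$). If $m-n=\zeta$, $(x1_\zeta)\eta=x\eta$ in $L(m,n)$. The elements $B_{\tau i}^{(a)}B_i^{(b)}B_{\tau i}^{(c)}1_\zeta$, $b\ge a+c$, form the monomial basis of $\dot{\mathbf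 U}^\imath1_\zeta$ (identifying $B_1^{(a)}B_2^{(b)}B_1^{(c)}1_\zeta=B_2^{(c)}B_1^{(b)}B_2^{(a)}1_\zeta$ when $b=a+c$). iCanonical basis of $\dot{\mathbf U}^\imath1_\zeta$: for $b\ge a+c$, $\mathfrak B_{i,\zeta}^{(a,b,c)}\in\dot{\mathbf U}^\imath1_\zeta$ is the inverse limit of the elements $\mathfrak B_i^{(a,b,c)}\eta$ along $\{L(m,n)\}_{m-n=\zeta}$, i.e. the unique element whose action on $\eta\in L(m,n)$ gives the icanonical basis element $\mathfrak B_i^{(a,b,c)}\eta$ for all sufficiently large $m,n$ with $m-n=\zeta$. *)

theory Defs
  imports
    "HOL-Computational_Algebra.Polynomial"
    "HOL-Computational_Algebra.Fraction_Field"
    "HOL-Library.FuncSet"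
begin

section \<open>Quantum integers\<close>

type_synonym Qq = "rat poly fract"

definition qq :: Qq where
  "qq = Fract [:0, 1:] 1"

definition qnum :: "int \<Rightarrow> Qq" where
  "qnum r = (qq powi r - qq powi (- r)) / (qq - inverse qq)"

definition qfact :: "nat \<Rightarrow> Qq" where
  "qfact r = (\<Prod>s = 1..r. qnum (int s))"

text \<open>The ideal \<open>q\<^sup>-\<^sup>1\<int>[q\<^sup>-\<^sup>1]\<close> of \<open>\<int>[q\<^sup>-\<^sup>1]\<close>.\<close>

definition qinv_lattice :: "Qq set" where
  "qinv_lattice = {inverse qq * poly (map_poly of_int p) (inverse qq) | p :: int poly. True}"


section \<open>The Dynkin diagram of \<open>\<ss>\<ll>\<^sub>3\<close>\<close>

datatype node = N1 | N2

fun node_num :: "node \<Rightarrow> nat" where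
  "node_num N1 = 1"
| "node_num N2 = 2"

fun tau :: "node \<Rightarrow> node" where
  "tau N1 = N2"
| "tau N2 = N1"

definition cartan :: "node \<Rightarrow> node \<Rightarrow> int" where
  "cartan i j = (if i = j then 2 else - 1)"


section \<open>The quantum group\<close>

text \<open>
  The algebra is presented as the quotient of the terms over its generators by the least congruence
  \<open>ueq\<close> that contains the axioms of an associative unital \<open>\<rat>(q)\<close>-algebra and the defining
  relations.
\<close>

datatype gen = gE node | gF node | gK node | gKinv node

datatype trm =
    Gen gen
  | Scal Qq
  | Plus trm trm (infixl \<open>\<boxplus>\<close> 65)
  | Times trm trm (infixl \<open>\<boxtimes>\<close> 70)

abbreviation tE :: "node \<Rightarrow> trm" where "tE i \<equiv> Gen (gE i)"
abbreviation tF :: "node \<Rightarrow> trm" where "tF i \<equiv> Gen (gF i)"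
abbreviation tK :: "node \<Rightarrow> trm" where "tK i \<equiv> Gen (gK i)"
abbreviation tKinv :: "node \<Rightarrow> trm" where "tKinv i \<equiv> Gen (gKinv i)"

abbreviation tminus :: "trm \<Rightarrow> trm \<Rightarrow> trm" (infixl \<open>\<boxminus>\<close> 65) where
  "x \<boxminus> y \<equiv> x \<boxplus> (Scal (- 1) \<boxtimes> y)"

abbreviation tdp2 :: "trm \<Rightarrow> trm" where
  "tdp2 x \<equiv> Scal (inverse (qfact 2)) \<boxtimes> (x \<boxtimes> x)"

inductive ueq :: "trm \<Rightarrow> trm \<Rightarrow> bool" where
  refl: "ueq x x"
| sym: "ueq x y \<Longrightarrow> ueq y x"
| trans: "ueq x y \<Longrightarrow> ueq y z \<Longrightarrow> ueq x z"
| plus_cong: "ueq x x' \<Longrightarrow> ueq y y' \<Longrightarrow> ueq (x \<boxplus> y) (x' \<boxplus> y')"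
| times_cong: "ueq x x' \<Longrightarrow> ueq y y' \<Longrightarrow> ueq (x \<boxtimes> y) (x' \<boxtimes> y')"
| plus_assoc: "ueq (x \<boxplus> y \<boxplus> z) (x \<boxplus> (y \<boxplus> z))"
| plus_comm: "ueq (x \<boxplus> y) (y \<boxplus> x)"
| plus_zero: "ueq (Scal 0 \<boxplus> x) x"
| plus_inverse: "ueq ((Scal (- 1) \<boxtimes> x) \<boxplus> x) (Scal 0)"
| times_assoc: "ueq (x \<boxtimes> y \<boxtimes> z) (x \<boxtimes> (y \<boxtimes> z))"
| times_one: "ueq (Scal 1 \<boxtimes> x) x"
| distrib_right: "ueq ((x \<boxplus> y) \<boxtimes> z) ((x \<boxtimes> z) \<boxplus> (y \<boxtimes> z))"
| distrib_left: "ueq (x \<boxtimes> (y \<boxplus> z)) ((x \<boxtimes> y) \<boxplus> (x \<boxtimes> z))"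
| scal_plus: "ueq (Scal (c + d)) (Scal c \<boxplus> Scal d)"
| scal_times: "ueq (Scal (c * d)) (Scal c \<boxtimes> Scal d)"
| scal_central: "ueq (Scal c \<boxtimes> x) (x \<boxtimes> Scal c)"
| K_Kinv: "ueq (tK i \<boxtimes> tKinv i) (Scal 1)"
| Kinv_K: "ueq (tKinv i \<boxtimes> tK i) (Scal 1)"
| K_K: "ueq (tK i \<boxtimes> tK j) (tK j \<boxtimes> tK i)"
| K_E: "ueq (tK i \<boxtimes> tE j \<boxtimes> tKinv i) (Scal (qq powi cartan i j) \<boxtimes> tE j)"
| K_F: "ueq (tK i \<boxtimes> tF j \<boxtimes> tKinv i) (Scal (qq powi (- cartan i j)) \<boxtimes> tF j)"
| E_F_same: "ueq ((tE i \<boxtimes> tF i) \<boxminus> (tF i \<boxtimes> tE i))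
    (Scal (inverse (qq - inverse qq)) \<boxtimes> (tK i \<boxminus> tKinv i))"
| E_F_diff: "i \<noteq> j \<Longrightarrow> ueq ((tE i \<boxtimes> tF j) \<boxminus> (tF j \<boxtimes> tE i)) (Scal 0)"
| Serre_E: "i \<noteq> j \<Longrightarrow>
    ueq (((tE j \<boxtimes> tdp2 (tE i)) \<boxminus> (tE i \<boxtimes> tE j \<boxtimes> tE i)) \<boxplus> (tdp2 (tE i) \<boxtimes> tE j)) (Scal 0)"
| Serre_F: "i \<noteq> j \<Longrightarrow>
    ueq (((tF j \<boxtimes> tdp2 (tF i)) \<boxminus> (tF i \<boxtimes> tF j \<boxtimes> tF i)) \<boxplus> (tdp2 (tF i) \<boxtimes> tF j)) (Scal 0)"

lemma equivp_ueq: "equivp ueq"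
  by (rule equivpI) (auto simp: reflp_def symp_def transp_def intro: ueq.refl ueq.sym ueq.trans)

quotient_type Uq = trm / ueq
  by (rule equivp_ueq)

text \<open>The counit, which shows that the algebra is not zero.\<close>

primrec counit :: "trm \<Rightarrow> Qq" where
  "counit (Gen g) = (case g of gE i \<Rightarrow> 0 | gF i \<Rightarrow> 0 | gK i \<Rightarrow> 1 | gKinv i \<Rightarrow> 1)"
| "counit (Scal c) = c"
| "counit (x \<boxplus> y) = counit x + counit y"
| "counit (x \<boxtimes> y) = counit x * counit y"

lemma counit_cong: "ueq x y \<Longrightarrow> counit x = counit y"
  by (induction rule: ueq.induct) (simp_all add: algebra_simps)

instantiation Uq :: ring_1
begin

lift_definition zero_Uq :: Uq is "Scal 0" .
lift_definition one_Uq :: Uq is "Scal 1" .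
lift_definition plus_Uq :: "Uq \<Rightarrow> Uq \<Rightarrow> Uq" is Plus by (rule ueq.plus_cong)
lift_definition times_Uq :: "Uq \<Rightarrow> Uq \<Rightarrow> Uq" is Times by (rule ueq.times_cong)
lift_definition uminus_Uq :: "Uq \<Rightarrow> Uq" is "\<lambda>x. Scal (- 1) \<boxtimes> x"
  by (rule ueq.times_cong[OF ueq.refl])
lift_definition minus_Uq :: "Uq \<Rightarrow> Uq \<Rightarrow> Uq" is tminus
  by (intro ueq.plus_cong ueq.times_cong ueq.refl)

instance
proof
  fix x y z :: Uq
  show "x * y * z = x * (y * z)" by transfer (rule ueq.times_assoc)
  show "1 * x = x" by transfer (rule ueq.times_one)
  show "x * 1 = x" by transfer (blast intro: ueq.trans ueq.sym ueq.scal_central ueq.times_one)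
  show "x + y + z = x + (y + z)" by transfer (rule ueq.plus_assoc)
  show "x + y = y + x" by transfer (rule ueq.plus_comm)
  show "0 + x = x" by transfer (rule ueq.plus_zero)
  show "- x + x = 0" by transfer (rule ueq.plus_inverse)
  show "x - y = x + - y" by transfer (rule ueq.refl)
  show "(x + y) * z = x * z + y * z" by transfer (rule ueq.distrib_right)
  show "x * (y + z) = x * y + x * z" by transfer (rule ueq.distrib_left)
  show "(0 :: Uq) \<noteq> 1"
  proof transfer
    show "\<not> ueq (Scal 0) (Scal 1)" using counit_cong[of "Scal 0" "Scal 1"] by auto
  qed
qed

end

lift_definition scal :: "Qq \<Rightarrow> Uq" is Scal .
lift_definition EE :: "node \<Rightarrow> Uq" is tE .
lift_definition FF :: "node \<Rightarrow> Uq" is tF .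
lift_definition KK :: "node \<Rightarrow> Uq" is tK .
lift_definition KKinv :: "node \<Rightarrow> Uq" is tKinv .

definition dpow :: "Uq \<Rightarrow> int \<Rightarrow> Uq" where
  "dpow x r = (if r < 0 then 0 else scal (inverse (qfact (nat r))) * x ^ nat r)"

lemma scal_0: "scal 0 = 0" by transfer (rule ueq.refl)
lemma scal_1: "scal 1 = 1" by transfer (rule ueq.refl)
lemma scal_add: "scal (c + d) = scal c + scal d" by transfer (rule ueq.scal_plus)
lemma scal_mult: "scal (c * d) = scal c * scal d" by transfer (rule ueq.scal_times)
lemma scal_comm: "scal c * x = x * scal c" by transfer (rule ueq.scal_central)

lemma KK_KKinv: "KK i * KKinv i = 1" by transfer (rule ueq.K_Kinv)
lemma KKinv_KK: "KKinv i * KK i = 1" by transfer (rule ueq.Kinv_K)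
lemma KK_KK: "KK i * KK j = KK j * KK i" by transfer (rule ueq.K_K)
lemma KK_EE: "KK i * EE j * KKinv i = scal (qq powi cartan i j) * EE j"
  by transfer (rule ueq.K_E)
lemma KK_FF: "KK i * FF j * KKinv i = scal (qq powi (- cartan i j)) * FF j"
  by transfer (rule ueq.K_F)

lemma EE_FF: "EE i * FF j - FF j * EE i =
    (if i = j then scal (inverse (qq - inverse qq)) * (KK i - KKinv i) else 0)"
proof (cases "i = j")
  case True
  have "EE i * FF i - FF i * EE i = scal (inverse (qq - inverse qq)) * (KK i - KKinv i)"
    by transfer (rule ueq.E_F_same)
  with True show ?thesis by simp
next
  case False
  then have "EE i * FF j - FF j * EE i = 0" by transfer (rule ueq.E_F_diff)
  with False show ?thesis by simp
qed

lemma dpow_2: "dpow x 2 = scal (inverse (qfact 2)) * (x * x)"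
  by (simp add: dpow_def power2_eq_square)

lemma Serre_EE: "i \<noteq> j \<Longrightarrow>
    EE j * dpow (EE i) 2 - EE i * EE j * EE i + dpow (EE i) 2 * EE j = 0"
  unfolding dpow_2 by transfer (rule ueq.Serre_E)

lemma Serre_FF: "i \<noteq> j \<Longrightarrow>
    FF j * dpow (FF i) 2 - FF i * FF j * FF i + dpow (FF i) 2 * FF j = 0"
  unfolding dpow_2 by transfer (rule ueq.Serre_F)


section \<open>The simple modules \<open>L(m,n)\<close>\<close>

text \<open>
  A module generated by one vector is a quotient \<open>\<^bold>U/I\<close> by a left ideal, the generator
  being the class of 1.  The class of \<open>u\<close> is \<open>cls I u\<close>; in \<open>mplus\<close> and \<open>mact\<close> the sets united
  all coincide when the arguments are classes modulo a left ideal.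
\<close>

definition left_ideal :: "Uq set \<Rightarrow> bool" where
  "left_ideal I \<longleftrightarrow> 0 \<in> I \<and> (\<forall>x\<in>I. \<forall>y\<in>I. x + y \<in> I) \<and> (\<forall>u. \<forall>x\<in>I. u * x \<in> I)"

definition cls :: "Uq set \<Rightarrow> Uq \<Rightarrow> Uq set" where
  "cls I u = {y. y - u \<in> I}"

definition quot :: "Uq set \<Rightarrow> Uq set set" where
  "quot I = range (cls I)"

definition mplus :: "Uq set \<Rightarrow> Uq set \<Rightarrow> Uq set \<Rightarrow> Uq set" where
  "mplus I X Y = (\<Union>x\<in>X. \<Union>y\<in>Y. cls I (x + y))"

definition mact :: "Uq set \<Rightarrow> Uq \<Rightarrow> Uq set \<Rightarrow> Uq set" where
  "mact I u X = (\<Union>x\<in>X. cls I (u * x))"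

definition submodule :: "Uq set \<Rightarrow> Uq set set \<Rightarrow> bool" where
  "submodule I M \<longleftrightarrow> M \<subseteq> quot I \<and> cls I 0 \<in> M \<and>
     (\<forall>X\<in>M. \<forall>Y\<in>M. mplus I X Y \<in> M) \<and> (\<forall>u. \<forall>X\<in>M. mact I u X \<in> M)"

definition simple_module :: "Uq set \<Rightarrow> bool" where
  "simple_module I \<longleftrightarrow> quot I \<noteq> {cls I 0} \<and>
     (\<forall>M. submodule I M \<longrightarrow> M = {cls I 0} \<or> M = quot I)"

fun hw :: "nat \<Rightarrow> nat \<Rightarrow> node \<Rightarrow> nat" where
  "hw m n N1 = m"
| "hw m n N2 = n"

definition highest_weight_vector :: "Uq set \<Rightarrow> nat \<Rightarrow> nat \<Rightarrow> Uq set \<Rightarrow> bool" where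
  "highest_weight_vector I m n v \<longleftrightarrow> v \<in> quot I \<and> v \<noteq> cls I 0 \<and>
     (\<forall>i. mact I (EE i) v = cls I 0 \<and> mact I (KK i) v = mact I (scal (qq ^ hw m n i)) v)"

text \<open>The annihilator of the highest weight vector of \<open>L(m,n)\<close>.\<close>

definition ann :: "nat \<Rightarrow> nat \<Rightarrow> Uq set" where
  "ann m n = (THE I. left_ideal I \<and> simple_module I \<and> highest_weight_vector I m n (cls I 1))"

definition Lmod :: "nat \<Rightarrow> nat \<Rightarrow> Uq set set" where
  "Lmod m n = quot (ann m n)"

definition eta :: "nat \<Rightarrow> nat \<Rightarrow> Uq set" where
  "eta m n = cls (ann m n) 1"

definition act :: "nat \<Rightarrow> nat \<Rightarrow> Uq \<Rightarrow> Uq set \<Rightarrow> Uq set" where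
  "act m n = mact (ann m n)"

lemma act_eta:
  assumes "left_ideal (ann m n)"
  shows "act m n u (eta m n) = cls (ann m n) u"
proof -
  let ?I = "ann m n"
  have add: "x + y \<in> ?I" if "x \<in> ?I" "y \<in> ?I" for x y
    using assms that by (auto simp: left_ideal_def)
  have mul: "v * x \<in> ?I" if "x \<in> ?I" for v x
    using assms that by (auto simp: left_ideal_def)
  have "cls ?I (u * x) = cls ?I u" if "x - 1 \<in> ?I" for x
  proof -
    have 1: "u * x - u \<in> ?I"
      using mul[OF that, of u] by (simp add: algebra_simps)
    have 2: "u - u * x \<in> ?I"
      using mul[OF 1, of "- 1"] by simp
    have "y - u * x \<in> ?I \<longleftrightarrow> y - u \<in> ?I" for y
      using add[OF _ 1, of "y - u * x"] add[OF _ 2, of "y - u"] by auto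
    then show ?thesis by (simp add: cls_def)
  qed
  moreover have "1 \<in> cls ?I 1"
    using assms by (simp add: left_ideal_def cls_def)
  ultimately have "(\<Union>x\<in>cls ?I 1. cls ?I (u * x)) = cls ?I u"
    unfolding cls_def[of ?I 1] by blast
  then show ?thesis
    by (simp add: act_def eta_def mact_def)
qed


section \<open>The iquantum group and its bar involution\<close>

definition BB :: "(node \<Rightarrow> int) \<Rightarrow> node \<Rightarrow> Uq" where
  "BB vs i = FF i + scal (qq powi vs i) * EE (tau i) * KKinv i"

definition kk :: "node \<Rightarrow> Uq" where
  "kk i = KK i * KKinv (tau i)"

text \<open>The inverse of \<open>kk i\<close> is \<open>kk (tau i)\<close>, so it need not be listed among the generators.\<close>

inductive_set Ui :: "(node \<Rightarrow> int) \<Rightarrow> Uq set" for vs where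
  scal: "scal c \<in> Ui vs"
| BB: "BB vs i \<in> Ui vs"
| kk: "kk i \<in> Ui vs"
| plus: "x \<in> Ui vs \<Longrightarrow> y \<in> Ui vs \<Longrightarrow> x + y \<in> Ui vs"
| times: "x \<in> Ui vs \<Longrightarrow> y \<in> Ui vs \<Longrightarrow> x * y \<in> Ui vs"

definition bar_automorphism :: "(node \<Rightarrow> int) \<Rightarrow> (Uq \<Rightarrow> Uq) \<Rightarrow> bool" where
  "bar_automorphism vs f \<longleftrightarrow>
     bij_betw f (Ui vs) (Ui vs) \<and> f 1 = 1 \<and>
     (\<forall>x\<in>Ui vs. \<forall>y\<in>Ui vs. f (x + y) = f x + f y \<and> f (x * y) = f x * f y) \<and>
     (\<forall>r :: rat. \<forall>x\<in>Ui vs. f (scal (of_rat r) * x) = scal (of_rat r) * f x) \<and>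
     f (scal qq) = scal (inverse qq) \<and>
     (\<forall>i. f (BB vs i) = BB vs i \<and> f (kk i) = KK (tau i) * KKinv i)"

definition psi :: "(node \<Rightarrow> int) \<Rightarrow> Uq \<Rightarrow> Uq" where
  "psi vs = (THE f. f \<in> extensional (Ui vs) \<and> bar_automorphism vs f)"

definition psiL :: "(node \<Rightarrow> int) \<Rightarrow> nat \<Rightarrow> nat \<Rightarrow> Uq set \<Rightarrow> Uq set" where
  "psiL vs m n = (THE f. f \<in> extensional (Lmod m n) \<and>
     (\<forall>u\<in>Ui vs. f (act m n u (eta m n)) = act m n (psi vs u) (eta m n)))"


section \<open>The icanonical basis of \<open>L(m,n)\<close>\<close>

definition Fmon :: "node \<Rightarrow> int \<Rightarrow> int \<Rightarrow> int \<Rightarrow> Uq" where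
  "Fmon i a b c = dpow (FF (tau i)) a * dpow (FF i) b * dpow (FF (tau i)) c"

definition Bmon :: "(node \<Rightarrow> int) \<Rightarrow> node \<Rightarrow> int \<Rightarrow> int \<Rightarrow> int \<Rightarrow> Uq" where
  "Bmon vs i a b c = dpow (BB vs (tau i)) a * dpow (BB vs i) b * dpow (BB vs (tau i)) c"

definition icb_coset :: "nat \<Rightarrow> nat \<Rightarrow> node \<Rightarrow> nat \<Rightarrow> nat \<Rightarrow> nat \<Rightarrow> Uq set set" where
  "icb_coset m n i a b c =
     {act m n (Fmon i a b c +
         (\<Sum>(x, y)\<in>S. scal (h (x, y)) * Fmon i (int a - int x) (int b - int x - int y) (int c - int y)))
       (eta m n)
     | (S :: (nat \<times> nat) set) h.
       finite S \<and> (0, 0) \<notin> S \<and> (\<forall>p\<in>S. h p \<in> qinv_lattice)}"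

text \<open>
  This describes an element of the icanonical basis only if \<open>a + c \<le> b\<close> and \<open>Fmon i a b c\<close> does
  not kill \<open>eta m n\<close>.
\<close>

definition icbL :: "(node \<Rightarrow> int) \<Rightarrow> nat \<Rightarrow> nat \<Rightarrow> node \<Rightarrow> nat \<Rightarrow> nat \<Rightarrow> nat \<Rightarrow> Uq set" where
  "icbL vs m n i a b c = (THE v. v \<in> icb_coset m n i a b c \<and> psiL vs m n v = v)"


section \<open>The modified iquantum group and its icanonical basis\<close>

text \<open>The pairing of \<open>h\<^sub>i - h\<^bsub>\<tau> i\<^esub>\<close> with the image in \<open>\<int>\<close> of a weight.\<close>

fun ipair :: "node \<Rightarrow> int \<Rightarrow> int" where
  "ipair N1 l = l"
| "ipair N2 l = - l"

text \<open>
  The summand of the modified iquantum group cut out by the idempotent \<open>1\<^sub>\<zeta>\<close> is, as a left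
  module, the quotient of the iquantum group by the left ideal generated by the elements
  \<open>kk i - q\<^bsup>ipair i \<zeta>\<^esup>\<close>; the class of \<open>x\<close> is \<open>x1\<^sub>\<zeta>\<close>.
\<close>

definition dot_ideal :: "(node \<Rightarrow> int) \<Rightarrow> int \<Rightarrow> Uq set" where
  "dot_ideal vs \<zeta> =
     {(\<Sum>i\<in>{N1, N2}. u i * (kk i - scal (qq powi ipair i \<zeta>))) | u. \<forall>i. u i \<in> Ui vs}"

definition dot :: "(node \<Rightarrow> int) \<Rightarrow> int \<Rightarrow> Uq \<Rightarrow> Uq set" where
  "dot vs \<zeta> x = cls (dot_ideal vs \<zeta>) x"

definition Udot :: "(node \<Rightarrow> int) \<Rightarrow> int \<Rightarrow> Uq set set" where
  "Udot vs \<zeta> = dot vs \<zeta> ` Ui vs"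

text \<open>
  The action on \<open>eta m n\<close>, that is \<open>(x1\<^sub>\<zeta>)\<eta> = x\<eta>\<close>, for \<open>m - n = \<zeta>\<close>: the sets united coincide,
  as \<open>dot_ideal vs \<zeta>\<close> annihilates \<open>eta m n\<close>.
\<close>

definition dot_act_eta :: "nat \<Rightarrow> nat \<Rightarrow> Uq set \<Rightarrow> Uq set" where
  "dot_act_eta m n X = (\<Union>x\<in>X. act m n x (eta m n))"

definition icb :: "(node \<Rightarrow> int) \<Rightarrow> int \<Rightarrow> node \<Rightarrow> nat \<Rightarrow> nat \<Rightarrow> nat \<Rightarrow> Uq set" where
  "icb vs \<zeta> i a b c = (THE X. X \<in> Udot vs \<zeta> \<and>
     (\<exists>N. \<forall>m\<ge>N. \<forall>n\<ge>N. int m - int n = \<zeta> \<longrightarrow> dot_act_eta m n X = icbL vs m n i a b c))"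

end

theory Submission
imports Defs "HOL-Library.Product_Plus"
begin

text \<open>
  The hypotheses add up to \<open>b > a + c\<close>.  The two summands of \<open>B\<^sub>i\<close> commute up to \<open>q\<^sup>2\<close> on weight vectors,
  so the quantum binomial theorem expands \<open>B\<^bsub>\<tau> i\<^esub>\<^sup>(\<^sup>a\<^sup>) B\<^sub>i\<^sup>(\<^sup>b\<^sup>) B\<^bsub>\<tau> i\<^esub>\<^sup>(\<^sup>c\<^sup>) \<eta>\<close> in the monomials in \<open>F\<^sub>1\<close>, \<open>F\<^sub>2\<close>, and the
  hypotheses are what puts all coefficients but the leading one into \<open>q\<^sup>-\<^sup>1\<int>[q\<^sup>-\<^sup>1]\<close>.  As the monomial is
  bar-invariant, it is the icanonical basis element.

  The bar involutions are obtained from the subring of \<open>\<^bold>U \<times> \<^bold>U\<close> generated by the pairs of a generator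
  and its image.  By the Serre relation of the iquantum group, the monomials
  \<open>B\<^bsub>\<tau> i\<^esub>\<^sup>(\<^sup>a\<^sup>) B\<^sub>i\<^sup>(\<^sup>b\<^sup>) B\<^bsub>\<tau> i\<^esub>\<^sup>(\<^sup>c\<^sup>)\<close> with \<open>b \<ge> a + c\<close> span it over the Cartan part.  Those not killing \<open>\<eta>\<close> to
  leading order are independent on \<open>\<eta>\<close>, so the subring is the graph of a function, both on the
  algebra and on \<open>L(m,n)\<close>.
\<close>

section \<open>The field of rational functions\<close>

text \<open>The annihilator of \<open>eta\<close>, the involutions \<open>psi\<close> and
  \<open>psiL\<close>, and the elements \<open>icbL\<close> and \<open>icb\<close> are definite
  descriptions, so each needs existence and uniqueness; this, rather than the expansion, takes up
  most of the proof. Nonvanishing comes from an explicit model of the Verma module: its vacuum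
  coefficient, read as a functional on the algebra, generates L(m,n), and relations between
  monomials are ruled out by applying the \<open>EE i\<close>, as for sl2. The other main device is
  comparison of leading terms: for the filtration by word length in the \<open>FF i\<close>, the
  elements \<open>BB vs i\<close> and \<open>FF i\<close> have the same leading term, and the bar
  involution preserves the filtration. Reductions between monomials must leave remainders that are
  their own bar images, since only those act alike on both components of a pair; this is why a ring
  over the bar-fixed scalars is filtered and spanned first. Finally, varying m and n recovers the
  Cartan part, because a Laurent polynomial is determined by its values at the powers of q.\<close>

lemma qq_gt_1: "qq > 1"
proof -
  have "[:0, 1:] - (1 :: rat poly) = [:-1, 1:]" by (simp add: one_pCons)
  then show ?thesis
    unfolding qq_def One_fract_def by (simp add: less_poly_def pos_poly_def)
qed

lemma qq_nonzero [simp]: "qq \<noteq> 0"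
  using qq_gt_1 by auto

text \<open>The order of the fraction field makes \<open>qq\<close> exceed every constant. It serves
  to tell powers of q apart, so that quantum integers do not vanish and different weights have
  different eigenvalues.\<close>

lemma qq_powi_less: "m < n \<Longrightarrow> qq powi m < qq powi n"
  by (rule power_int_strict_increasing[OF _ qq_gt_1])

lemma qq_powi_eq_iff [simp]: "qq powi m = qq powi n \<longleftrightarrow> m = n"
  by (metis linorder_neqE less_irrefl qq_powi_less)

lemma qq_neq_inverse [simp]: "qq \<noteq> inverse qq" "inverse qq \<noteq> qq"
  using qq_powi_eq_iff[of 1 "-1"] qq_powi_eq_iff[of "-1" 1] by (simp_all add: power_int_minus)

lemma qdiff_nonzero: "qq - inverse qq \<noteq> 0"
  by simp

lemma qnum_0 [simp]: "qnum 0 = 0"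
  by (simp add: qnum_def)

lemma qnum_1 [simp]: "qnum 1 = 1"
  using qdiff_nonzero by (simp add: qnum_def power_int_minus)

lemma qnum_minus: "qnum (- r) = - qnum r"
  unfolding qnum_def by (simp add: minus_divide_left)

lemma qnum_eq_0_iff [simp]: "qnum r = 0 \<longleftrightarrow> r = 0"
  by (simp add: qnum_def)

text \<open>Every identity between quantum integers below is an identity of Laurent polynomials in
  powers of \<open>qq\<close>; clearing \<open>qq - inverse qq\<close> reduces it to one.\<close>

lemma qq_powi_split:
  "qq powi (a + b) = qq powi a * qq powi b" "qq powi (a - b) = qq powi a / qq powi b"
  "qq powi (- a) = 1 / qq powi a"
  by (simp_all add: power_int_add power_int_diff power_int_minus divide_inverse)

lemma qnum_add_right: "qnum (a + b) = qq powi b * qnum a + qq powi (- a) * qnum b"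
  unfolding qnum_def by (simp add: qq_powi_split divide_simps) (simp add: algebra_simps)

text \<open>A deformation of (a+1)(b+1) - ab = a+b+1. Its variant \<open>qnum_cross\<close>, with
  one argument negated, gives the coefficients that arise when E passes a divided power of
  F.\<close>

lemma qnum_mult_diff: "qnum (a + 1) * qnum (b + 1) - qnum a * qnum b = qnum (a + b + 1)"
proof -
  define D where "D = qq - inverse qq"
  have D: "D \<noteq> 0" by (simp add: D_def)
  define A B where "A = qq powi a" and "B = qq powi b"
  have [simp]: "A \<noteq> 0" "B \<noteq> 0" by (simp_all add: A_def B_def)
  have "(A * qq - 1 / (A * qq)) * (B * qq - 1 / (B * qq)) - (A - 1 / A) * (B - 1 / B)
      = (A * B * qq - 1 / (A * B * qq)) * D"
    unfolding D_def by (simp add: field_simps)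
  then have "((A * qq - 1 / (A * qq)) / D) * ((B * qq - 1 / (B * qq)) / D) - ((A - 1 / A) / D) * ((B - 1 / B) / D)
      = (A * B * qq - 1 / (A * B * qq)) / D"
    using D by (simp add: divide_simps)
  then show ?thesis
    unfolding qnum_def D_def[symmetric] by (simp add: qq_powi_split A_def B_def mult_ac)
qed

lemma qnum_cross: "qnum (b + 1) * qnum a - qnum (a + 1) * qnum b = qnum (a - b)"
proof -
  have "qnum (- b) = - qnum b" "qnum (- b - 1) = - qnum (b + 1)"
    using qnum_minus[of b] qnum_minus[of "b + 1"] by simp_all
  then show ?thesis using qnum_mult_diff[of a "- b - 1"] by (simp add: mult.commute)
qed

lemma qnum_2: "qnum 2 = qq + inverse qq"
proof -
  have "qnum 2 = qq powi 1 * qnum 1 + qq powi (- 1) * qnum 1"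
    using qnum_add_right[of 1 1] by simp
  then show ?thesis by (simp add: power_int_minus)
qed

lemma qnum_2_mult: "qnum 2 * qnum a = qnum (a + 1) + qnum (a - 1)"
  using qnum_mult_diff[of 1 "a - 1"] by (simp add: algebra_simps)

lemma qfact_0 [simp]: "qfact 0 = 1"
  by (simp add: qfact_def)

lemma qfact_Suc: "qfact (Suc r) = qnum (int r + 1) * qfact r"
  by (simp add: qfact_def prod.nat_ivl_Suc' add.commute mult.commute)

lemma qfact_nonzero [simp]: "qfact r \<noteq> 0"
  by (simp add: qfact_def)

subsection \<open>The bar involution of the field\<close>

definition ev :: "Qq \<Rightarrow> rat poly \<Rightarrow> Qq" where
  "ev x p = poly (map_poly of_rat p) x"

lemma ev_pCons [simp]: "ev x (pCons a p) = of_rat a + x * ev x p"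
  by (simp add: ev_def map_poly_pCons)

lemma ev_0 [simp]: "ev x 0 = 0"
  by (simp add: ev_def)

lemma ev_add: "ev x (p + r) = ev x p + ev x r"
  by (induction p r rule: poly_induct2) (simp_all add: of_rat_add algebra_simps)

lemma ev_smult: "ev x (smult a p) = of_rat a * ev x p"
  by (induction p) (simp_all add: of_rat_mult algebra_simps)

lemma ev_mult: "ev x (p * r) = ev x p * ev x r"
  by (induction p) (simp_all add: ev_add ev_smult algebra_simps)

lemma ev_1 [simp]: "ev x 1 = 1"
  by (simp add: one_pCons)

lemma ev_monom: "ev x (monom a k) = of_rat a * x ^ k"
  by (induction k) (simp_all add: monom_Suc monom_0 algebra_simps)

lemma Fract_const: "Fract [:r:] 1 = of_rat r"
proof -
  obtain a b where r: "r = of_int a / of_int b" "b \<noteq> 0"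
    by (metis Fract_of_int_quotient Rat_cases less_irrefl)
  have 1: "Fract [:rat_of_nat k:] 1 = of_nat k" for k
    by (simp add: Fract_of_nat_eq[symmetric] of_nat_poly)
  have 2: "Fract [:rat_of_int k:] 1 = of_int k" for k
  proof (cases k)
    case (nonneg n) then show ?thesis using 1 by simp
  next
    case (neg n)
    have "Fract [:rat_of_int k:] 1 = - Fract [:rat_of_nat (Suc n):] 1"
      unfolding minus_fract neg by simp
    then show ?thesis unfolding 1 using neg by simp
  qed
  have "Fract [:r:] 1 * of_int b = of_int a"
    using r by (simp add: 2[symmetric])
  then have "Fract [:r:] 1 = of_int a / of_int b"
    using r(2) by (metis eq_divide_eq of_int_eq_0_iff)
  then show ?thesis using r by (simp add: of_rat_divide)
qed

lemma ev_qq: "ev qq p = Fract p 1"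
proof (induction p)
  case (pCons a p)
  have "Fract (pCons a p) 1 = Fract [:a:] 1 + qq * Fract p 1"
    by (simp add: qq_def)
  then show ?case using pCons by (simp add: Fract_const)
qed (simp add: Zero_fract_def)

lemma ev_qq_eq_0_iff: "ev qq p = 0 \<longleftrightarrow> p = 0"
  by (simp add: ev_qq Zero_fract_def eq_fract)

lemma map_poly_of_rat_reflect:
  "map_poly (of_rat :: rat \<Rightarrow> Qq) (reflect_poly p) = reflect_poly (map_poly of_rat p)"
  by (intro poly_eqI) (simp add: coeff_map_poly coeff_reflect_poly degree_map_poly)

text \<open>Reversing the coefficients clears the denominators of an evaluation at q^-1. Hence q^-1
  is no root of a nonzero polynomial either, which makes \<open>bar\<close> well defined on
  fractions.\<close>

lemma ev_reflect: "ev qq (reflect_poly p) = qq ^ degree p * ev (inverse qq) p"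
  by (simp add: ev_def map_poly_of_rat_reflect poly_reflect_poly_nz degree_map_poly)

definition evi :: "rat poly \<Rightarrow> Qq" where
  "evi = ev (inverse qq)"

lemma evi_eq_0_iff [simp]: "evi p = 0 \<longleftrightarrow> p = 0"
  using ev_reflect[of p] ev_qq_eq_0_iff[of "reflect_poly p"] by (auto simp: evi_def)

lemma evi_add: "evi (p + r) = evi p + evi r" and evi_mult: "evi (p * r) = evi p * evi r"
  and evi_const [simp]: "evi [:a:] = of_rat a" and evi_1 [simp]: "evi 1 = 1"
  by (simp_all add: evi_def ev_add ev_mult)

text \<open>The substitution of q^-1 for q, through an arbitrarily chosen representing fraction;
  \<open>bar_Fract\<close> shows that the choice does not matter.\<close>

definition bar :: "Qq \<Rightarrow> Qq" where
  "bar z = (SOME w. \<exists>a b. b \<noteq> 0 \<and> z = Fract a b \<and> w = evi a / evi b)"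

lemma bar_Fract:
  assumes "b \<noteq> 0"
  shows "bar (Fract a b) = evi a / evi b"
proof -
  let ?P = "\<lambda>w. \<exists>a' b'. b' \<noteq> 0 \<and> Fract a b = Fract a' b' \<and> w = evi a' / evi b'"
  have "?P (bar (Fract a b))"
    unfolding bar_def by (rule someI[of ?P]) (use assms in blast)
  then obtain a' b' where *: "b' \<noteq> 0" "Fract a b = Fract a' b'"
      "bar (Fract a b) = evi a' / evi b'" by blast
  have "a * b' = a' * b" using * assms by (simp add: eq_fract)
  then have "evi a * evi b' = evi a' * evi b"
    by (metis evi_mult)
  then show ?thesis unfolding *(3) using * assms by (simp add: frac_eq_eq)
qed

lemma bar_add [simp]: "bar (x + y) = bar x + bar y"
proof -
  obtain a b where x: "x = Fract a b" "b \<noteq> 0" by (cases x) auto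
  obtain c d where y: "y = Fract c d" "d \<noteq> 0" by (cases y) auto
  show ?thesis using x(2) y(2) unfolding x(1) y(1)
    by (simp add: bar_Fract evi_add evi_mult add_frac_eq)
qed

lemma bar_mult [simp]: "bar (x * y) = bar x * bar y"
proof -
  obtain a b where x: "x = Fract a b" "b \<noteq> 0" by (cases x) auto
  obtain c d where y: "y = Fract c d" "d \<noteq> 0" by (cases y) auto
  show ?thesis using x(2) y(2) unfolding x(1) y(1)
    by (simp add: bar_Fract evi_mult)
qed

lemma bar_of_rat [simp]: "bar (of_rat r) = of_rat r"
proof -
  have "bar (Fract [:r:] 1) = of_rat r" by (subst bar_Fract) simp_all
  then show ?thesis by (simp add: Fract_const)
qed

lemma bar_0 [simp]: "bar 0 = 0"
  using bar_of_rat[of 0] by simp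

lemma bar_1 [simp]: "bar 1 = 1"
  using bar_of_rat[of 1] by simp

lemma bar_minus [simp]: "bar (- x) = - bar x"
proof -
  have "bar x + bar (- x) = 0" by (simp flip: bar_add)
  then show ?thesis by (metis minus_unique)
qed

lemma bar_diff [simp]: "bar (x - y) = bar x - bar y"
  using bar_add[of x "- y"] by simp

lemma bar_qq [simp]: "bar qq = inverse qq"
proof -
  have "bar (Fract [:0, 1:] 1) = inverse qq" by (subst bar_Fract) (simp_all add: evi_def)
  then show ?thesis by (simp add: qq_def)
qed

lemma bar_eq_0_iff [simp]: "bar x = 0 \<longleftrightarrow> x = 0"
proof
  assume "bar x = 0"
  show "x = 0"
  proof (rule ccontr)
    assume "x \<noteq> 0"
    then have "bar x * bar (inverse x) = 1" by (simp flip: bar_mult)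
    with \<open>bar x = 0\<close> show False by simp
  qed
qed simp

lemma bar_inverse [simp]: "bar (inverse x) = inverse (bar x)"
proof (cases "x = 0")
  case False
  then have "bar x * bar (inverse x) = 1" by (simp flip: bar_mult)
  then show ?thesis by (simp add: inverse_unique)
qed simp

lemma bar_divide [simp]: "bar (x / y) = bar x / bar y"
  by (simp add: divide_inverse)

lemma bar_power [simp]: "bar (x ^ k) = bar x ^ k"
  by (induction k) simp_all

lemma bar_powi_qq [simp]: "bar (qq powi k) = qq powi (- k)"
  by (simp add: power_int_def power_inverse)

lemma bar_ev: "bar (ev x p) = ev (bar x) p"
  by (induction p) simp_all

lemma bar_bar [simp]: "bar (bar x) = x"
proof -
  obtain a b where x: "x = Fract a b" "b \<noteq> 0" by (cases x) auto
  have "x = ev qq a / ev qq b" using x by (simp add: ev_qq)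
  then show ?thesis by (simp add: bar_ev)
qed

lemma bar_qnum [simp]: "bar (qnum r) = qnum r"
proof -
  have "bar (qnum r) = (- (qq powi r - qq powi (- r))) / (- (qq - inverse qq))"
    unfolding qnum_def by simp
  then show ?thesis unfolding qnum_def by (simp only: minus_divide_left[symmetric] divide_minus_right minus_minus)
qed

lemma bar_qfact [simp]: "bar (qfact r) = qfact r"
  by (induction r) (simp_all add: qfact_Suc)

subsection \<open>Lattices\<close>

text \<open>The module q^e Z[q^-1]. Exponents add under products, so bounds for the factors of a
  coefficient add up to a bound for the coefficient.\<close>

definition qlat :: "int \<Rightarrow> Qq set" where
  "qlat e = {qq powi e * poly (map_poly of_int p) (inverse qq) | p :: int poly. True}"

lemma qlatI: "x = qq powi e * poly (map_poly of_int p) (inverse qq) \<Longrightarrow> x \<in> qlat e"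
  by (auto simp: qlat_def)

lemma qinv_lattice_eq: "qinv_lattice = qlat (- 1)"
  by (simp add: qinv_lattice_def qlat_def power_int_minus)

lemma map_poly_of_int_add:
  "map_poly (of_int :: int \<Rightarrow> 'a :: ring_1) (p + r) = map_poly of_int p + map_poly of_int r"
  by (intro poly_eqI) (simp add: coeff_map_poly)

lemma map_poly_of_int_minus:
  "map_poly (of_int :: int \<Rightarrow> 'a :: ring_1) (- p) = - map_poly of_int p"
  by (intro poly_eqI) (simp add: coeff_map_poly)

lemma poly_map_of_int_mult:
  "poly (map_poly (of_int :: int \<Rightarrow> 'a :: comm_ring_1) (p * r)) x = poly (map_poly of_int p) x * poly (map_poly of_int r) x"
proof (induction p)
  case (pCons a p)
  have "map_poly (of_int :: int \<Rightarrow> 'a) (smult a r) = smult (of_int a) (map_poly of_int r)"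
    by (intro poly_eqI) (simp add: coeff_map_poly)
  then show ?case using pCons by (simp add: map_poly_of_int_add map_poly_pCons algebra_simps)
qed simp

lemma qlat_add: "x \<in> qlat e \<Longrightarrow> y \<in> qlat e \<Longrightarrow> x + y \<in> qlat e"
proof -
  assume "x \<in> qlat e" "y \<in> qlat e"
  then obtain p r where "x = qq powi e * poly (map_poly of_int p) (inverse qq)"
    "y = qq powi e * poly (map_poly of_int r) (inverse qq)"
    by (auto simp: qlat_def)
  then show ?thesis
    by (intro qlatI[of _ _ "p + r"]) (simp add: map_poly_of_int_add ring_distribs)
qed

lemma qlat_minus: "x \<in> qlat e \<Longrightarrow> - x \<in> qlat e"
proof -
  assume "x \<in> qlat e"
  then obtain p where "x = qq powi e * poly (map_poly of_int p) (inverse qq)"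
    by (auto simp: qlat_def)
  then show ?thesis
    by (intro qlatI[of _ _ "- p"]) (simp add: map_poly_of_int_minus)
qed

lemma qlat_0: "0 \<in> qlat e"
  by (rule qlatI[of _ _ 0]) simp

lemma qlat_diff: "x \<in> qlat e \<Longrightarrow> y \<in> qlat e \<Longrightarrow> x - y \<in> qlat e"
  using qlat_add[of x e "- y"] qlat_minus by simp

lemma qlat_mult:
  assumes "x \<in> qlat e" "y \<in> qlat e'"
  shows "x * y \<in> qlat (e + e')"
proof -
  obtain p r where "x = qq powi e * poly (map_poly of_int p) (inverse qq)"
    "y = qq powi e' * poly (map_poly of_int r) (inverse qq)"
    using assms by (auto simp: qlat_def)
  then show ?thesis
    by (intro qlatI[of _ _ "p * r"]) (simp add: poly_map_of_int_mult power_int_add)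
qed

lemma qq_powi_qlat:
  assumes "k \<le> e"
  shows "qq powi k \<in> qlat e"
proof (rule qlatI)
  have "poly (map_poly of_int (monom (1 :: int) (nat (e - k)))) (inverse qq) = inverse qq ^ nat (e - k)"
    by (simp add: map_poly_monom poly_monom)
  also have "\<dots> = qq powi (k - e)"
    using assms by (cases "k = e") (simp_all add: power_int_def power_inverse)
  finally show "qq powi k = qq powi e * poly (map_poly of_int (monom (1 :: int) (nat (e - k)))) (inverse qq)"
    by (simp flip: power_int_add)
qed

lemma qlat_mono:
  assumes "x \<in> qlat e" "e \<le> e'"
  shows "x \<in> qlat e'"
proof -
  have "1 \<in> qlat (e' - e)" using qq_powi_qlat[of 0 "e' - e"] assms by simp
  from qlat_mult[OF this assms(1)] show ?thesis by simp
qed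

text \<open>Such an element would lie in both q^-1 Z[q^-1] and q Z[q]. After clearing denominators
  one side has degree at least deg f + 2 unless f = 0, the other at most deg f.\<close>

lemma bar_fixed_qinv_lattice:
  assumes "c \<in> qinv_lattice" "bar c = c"
  shows "c = 0"
proof -
  obtain p :: "int poly" where p: "c = inverse qq * poly (map_poly of_int p) (inverse qq)"
    using assms by (auto simp: qinv_lattice_def)
  define f :: "rat poly" where "f = map_poly of_int p"
  have "map_poly of_int p = map_poly (of_rat :: rat \<Rightarrow> Qq) f"
    unfolding f_def by (intro poly_eqI) (simp add: coeff_map_poly)
  then have c: "c = inverse qq * ev (inverse qq) f" using p by (simp add: ev_def)
  have "qq * ev qq f = inverse qq * ev (inverse qq) f"
    using assms(2) unfolding c by (simp add: bar_ev)
  then have "qq ^ Suc (degree f) * (qq * ev qq f) = qq ^ Suc (degree f) * (inverse qq * ev (inverse qq) f)"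
    by simp
  then have "qq ^ (degree f + 2) * ev qq f = qq ^ degree f * ev (inverse qq) f"
    by (simp add: mult_ac)
  then have "ev qq (monom 1 (degree f + 2) * f) = ev qq (reflect_poly f)"
    by (simp add: ev_mult ev_monom ev_reflect)
  then have "monom 1 (degree f + 2) * f = reflect_poly f"
    by (simp add: ev_qq eq_fract)
  then have "degree (monom 1 (degree f + 2) * f) \<le> degree f"
    by (metis degree_reflect_poly_le)
  then have "f = 0"
    by (cases "f = 0") (auto simp: degree_mult_eq degree_monom_eq monom_eq_0_iff)
  then show ?thesis using c by simp
qed

subsection \<open>Quantum binomial coefficients\<close>

text \<open>The quantum binomial coefficient of M + y over y. The shifted upper index is the form in
  which it arises from E^(y) acting on a string of divided powers of F.\<close>

definition qbin :: "int \<Rightarrow> nat \<Rightarrow> Qq" where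
  "qbin M y = (\<Prod>t = 1..y. qnum (M + int t) / qnum (int t))"

lemma qbin_0 [simp]: "qbin M 0 = 1"
  by (simp add: qbin_def)

lemma qbin_Suc: "qbin M (Suc y) = qbin M y * qnum (M + int y + 1) / qnum (int y + 1)"
  by (simp add: qbin_def prod.nat_ivl_Suc' algebra_simps)

lemma qbin_zero [simp]: "qbin 0 y = 1"
  by (simp add: qbin_def)

lemma qbin_pred: "qnum (int y + 1) * qbin (M - 1) (Suc y) = qnum M * qbin M y"
proof (induction y)
  case (Suc y)
  have "qnum (int (Suc y) + 1) * qbin (M - 1) (Suc (Suc y)) = qbin (M - 1) (Suc y) * qnum (M + int y + 1)"
    by (simp add: qbin_Suc[of "M - 1" "Suc y"])
  also have "\<dots> = (qnum (int y + 1) * qbin (M - 1) (Suc y)) * qnum (M + int y + 1) / qnum (int y + 1)"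
    by simp
  also have "\<dots> = qnum M * qbin M (Suc y)"
    unfolding Suc.IH by (simp add: qbin_Suc)
  finally show ?case .
qed (simp add: qbin_Suc)

lemma qbin_pascal: "qbin M (Suc y) = qq powi (int y + 1) * qbin (M - 1) (Suc y) + qq powi (- M) * qbin M y"
proof -
  have "qnum (int y + 1) * qbin M (Suc y) = qbin M y * qnum (M + (int y + 1))"
    by (simp add: qbin_Suc algebra_simps)
  also have "\<dots> = qq powi (int y + 1) * (qnum M * qbin M y) + qnum (int y + 1) * (qq powi (- M) * qbin M y)"
    unfolding qnum_add_right[of M "int y + 1"] by (simp add: algebra_simps)
  also have "\<dots> = qnum (int y + 1) * (qq powi (int y + 1) * qbin (M - 1) (Suc y) + qq powi (- M) * qbin M y)"
    unfolding qbin_pred[symmetric] by (simp add: algebra_simps)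
  finally show ?thesis by simp
qed

text \<open>The top power of q in the binomial coefficient is q^(M y); the Pascal rule propagates
  this bound, by induction on M + y.\<close>

lemma qbin_qlat: "qbin (int M) y \<in> qlat (int M * int y)"
proof (induction "M + y" arbitrary: M y rule: less_induct)
  case less
  show ?case
  proof (cases "M = 0 \<or> y = 0")
    case True
    then show ?thesis using qq_powi_qlat[of 0 0] by auto
  next
    case False
    then obtain M' y' where My: "M = Suc M'" "y = Suc y'" by (meson not0_implies_Suc)
    have "qq powi (int y' + 1) * qbin (int M') (Suc y') \<in> qlat ((int y' + 1) + int M' * int y)"
      using less[of M' y] My by (intro qlat_mult qq_powi_qlat) auto
    moreover have "(int y' + 1) + int M' * int y = int M * int y"
      by (simp add: My algebra_simps)
    moreover have "qq powi (- int M) * qbin (int M) y' \<in> qlat (- int M + int M * int y')"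
      using less[of M y'] My by (intro qlat_mult qq_powi_qlat) auto
    then have "qq powi (- int M) * qbin (int M) y' \<in> qlat (int M * int y)"
      by (rule qlat_mono) (simp add: My algebra_simps)
    ultimately show ?thesis
      using qbin_pascal[of "int M" y'] My by (auto intro: qlat_add)
  qed
qed

section \<open>Scalars and divided powers\<close>

definition sm :: "Qq \<Rightarrow> Uq \<Rightarrow> Uq" (infixr \<open>\<odot>\<close> 75) where
  "c \<odot> x = scal c * x"

lemma sm_simps [simp]:
  "c \<odot> (d \<odot> x) = (c * d) \<odot> x" "1 \<odot> x = x" "0 \<odot> x = 0" "c \<odot> 0 = 0"
  "(c \<odot> x) * y = c \<odot> (x * y)" "x * (c \<odot> y) = c \<odot> (x * y)"
  "c \<odot> (- x) = - (c \<odot> x)" "(- c) \<odot> x = - (c \<odot> x)"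
proof -
  have "scal (- c) + scal c = 0" by (simp add: scal_0 flip: scal_add)
  then have "scal (- c) = - scal c" by (simp add: eq_neg_iff_add_eq_0)
  then show "(- c) \<odot> x = - (c \<odot> x)" by (simp add: sm_def)
  have "x * (scal c * y) = scal c * (x * y)"
    by (metis mult.assoc scal_comm)
  then show "x * (c \<odot> y) = c \<odot> (x * y)" by (simp add: sm_def)
qed (simp_all add: sm_def scal_mult scal_0 scal_1 mult.assoc)

lemma sm_distrib:
  "c \<odot> (x + y) = c \<odot> x + c \<odot> y" "(c + d) \<odot> x = c \<odot> x + d \<odot> x"
  "c \<odot> (x - y) = c \<odot> x - c \<odot> y" "(c - d) \<odot> x = c \<odot> x - d \<odot> x"
proof -
  have "(c + - d) \<odot> x = c \<odot> x + (- d) \<odot> x"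
    by (simp only: sm_def scal_add ring_distribs)
  then show "(c - d) \<odot> x = c \<odot> x - d \<odot> x" by simp
qed (simp_all add: sm_def scal_add algebra_simps)

lemma scal_eq_sm: "scal c = c \<odot> 1"
  by (simp add: sm_def)

lemma dpow_neg: "r < 0 \<Longrightarrow> dpow x r = 0"
  by (simp add: dpow_def)

lemma dpow_nat: "dpow x (int k) = inverse (qfact k) \<odot> x ^ k"
  by (simp add: dpow_def sm_def)

lemma dpow_0 [simp]: "dpow x 0 = 1"
  using dpow_nat[of x 0] by simp

lemma dpow_1 [simp]: "dpow x 1 = x"
  using dpow_nat[of x 1] qfact_Suc[of 0] by simp

lemma mult_dpow: "x * dpow x r = qnum (r + 1) \<odot> dpow x (r + 1)"
proof (cases "r < 0")
  case True
  then show ?thesis by (cases "r = - 1") (simp_all add: dpow_neg)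
next
  case False
  then obtain k where r: "r = int k" by (metis nonneg_int_cases not_less)
  have "qnum (int k + 1) \<odot> dpow x (int (Suc k)) = inverse (qfact k) \<odot> x ^ Suc k"
    unfolding dpow_nat by (simp add: qfact_Suc) (simp flip: mult.assoc)
  then show ?thesis by (simp add: r dpow_nat add.commute)
qed

lemma dpow_commutes: "dpow x r * x = x * dpow x r"
  by (simp add: dpow_def power_commutes mult.assoc) (metis mult.assoc scal_comm)

lemma dpow_mult: "dpow x r * x = qnum (r + 1) \<odot> dpow x (r + 1)"
  by (simp add: dpow_commutes mult_dpow)

lemma commute_dpow: "y * x = x * y \<Longrightarrow> y * dpow x r = dpow x r * y"
  by (simp add: dpow_def power_commuting_commutes mult.assoc)
     (metis mult.assoc scal_comm power_commuting_commutes)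

section \<open>Relations of the quantum group in rewriting form\<close>

lemma KK_cancel: "KKinv i * (KK i * x) = x" "KK i * (KKinv i * x) = x"
  by (simp_all add: KK_KKinv KKinv_KK flip: mult.assoc)

lemma KK_FF': "KK i * FF j = qq powi (- cartan i j) \<odot> (FF j * KK i)"
  using arg_cong[OF KK_FF[of i j], of "\<lambda>x. x * KK i"]
  by (simp add: mult.assoc KKinv_KK sm_def)

lemma KK_EE': "KK i * EE j = qq powi (cartan i j) \<odot> (EE j * KK i)"
  using arg_cong[OF KK_EE[of i j], of "\<lambda>x. x * KK i"]
  by (simp add: mult.assoc KKinv_KK sm_def)

lemma KKinv_FF': "KKinv i * FF j = qq powi (cartan i j) \<odot> (FF j * KKinv i)"
proof -
  have "KKinv i * (KK i * FF j) * KKinv i = qq powi (- cartan i j) \<odot> (KKinv i * FF j)"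
    unfolding KK_FF' by (simp add: mult.assoc KK_KKinv)
  then have "qq powi (cartan i j) \<odot> (FF j * KKinv i) = KKinv i * FF j"
    by (simp add: KK_cancel power_int_minus)
  then show ?thesis by simp
qed

lemma KKinv_EE': "KKinv i * EE j = qq powi (- cartan i j) \<odot> (EE j * KKinv i)"
proof -
  have "KKinv i * (KK i * EE j) * KKinv i = qq powi (cartan i j) \<odot> (KKinv i * EE j)"
    unfolding KK_EE' by (simp add: mult.assoc KK_KKinv)
  then have "qq powi (- cartan i j) \<odot> (EE j * KKinv i) = KKinv i * EE j"
    by (simp add: KK_cancel power_int_minus)
  then show ?thesis by simp
qed

lemma KKinv_KK_comm: "KKinv i * KK j = KK j * KKinv i"
proof -
  have "KKinv i * (KK j * KK i) * KKinv i = KKinv i * (KK i * KK j) * KKinv i"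
    by (simp add: KK_KK)
  then show ?thesis by (simp add: mult.assoc KK_cancel KK_KKinv)
qed

lemma KKinv_KKinv: "KKinv i * KKinv j = KKinv j * KKinv i"
proof -
  have "KKinv i * (KKinv j * KK i) * KKinv i = KKinv i * (KK i * KKinv j) * KKinv i"
    by (simp add: KKinv_KK_comm)
  then show ?thesis by (simp add: mult.assoc KK_cancel KK_KKinv)
qed

lemma EE_FF_same: "EE i * FF i = FF i * EE i + inverse (qq - inverse qq) \<odot> (KK i - KKinv i)"
  using EE_FF[of i i] by (simp add: sm_def algebra_simps)

lemma EE_FF_other: "i \<noteq> j \<Longrightarrow> EE i * FF j = FF j * EE i"
  using EE_FF[of i j] by simp

lemma tau_tau [simp]: "tau (tau i) = i"
  by (cases i) simp_all

lemma tau_neq [simp]: "tau i \<noteq> i" "i \<noteq> tau i"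
  by (cases i; simp)+

lemma cartan_simps [simp]: "cartan i i = 2" "cartan i (tau i) = - 1" "cartan (tau i) i = - 1"
  by (simp_all add: cartan_def)

lemma node_cases: obtains "j = i" | "j = tau i"
  by (cases i; cases j) auto

lemma Uq_induct [case_names scal EE FF KK KKinv plus times]:
  assumes "\<And>c. Q (scal c)" "\<And>i. Q (EE i)" "\<And>i. Q (FF i)" "\<And>i. Q (KK i)" "\<And>i. Q (KKinv i)"
    "\<And>x y. Q x \<Longrightarrow> Q y \<Longrightarrow> Q (x + y)" "\<And>x y. Q x \<Longrightarrow> Q y \<Longrightarrow> Q (x * y)"
  shows "Q u"
proof -
  have "Q (abs_Uq t)" for t
  proof (induction t)
    case (Gen g)
    show ?case using assms(2-5) by (cases g) (simp_all add: EE.abs_eq FF.abs_eq KK.abs_eq KKinv.abs_eq)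
  next
    case (Scal c)
    show ?case using assms(1)[of c] by (simp add: scal.abs_eq)
  next
    case (Plus t1 t2)
    then show ?case using assms(6) by (simp flip: plus_Uq.abs_eq)
  next
    case (Times t1 t2)
    then show ?case using assms(7) by (simp flip: times_Uq.abs_eq)
  qed
  then show ?thesis by (induction u rule: Uq.abs_induct)
qed

section \<open>Modules\<close>

locale uq_mod =
  fixes act :: "Uq \<Rightarrow> 'v :: ab_group_add \<Rightarrow> 'v" (infixr \<open>\<cdot>\<close> 68)
  assumes act_add: "(x + y) \<cdot> v = x \<cdot> v + y \<cdot> v"
    and act_plus: "x \<cdot> (v + w) = x \<cdot> v + x \<cdot> w"
    and act_mult: "(x * y) \<cdot> v = x \<cdot> y \<cdot> v"
    and act_1 [simp]: "1 \<cdot> v = v"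
begin

lemma act_0 [simp]: "0 \<cdot> v = 0" "x \<cdot> 0 = 0"
  using act_add[of 0 0 v] act_plus[of x 0 0] by simp_all

lemma act_minus: "(- x) \<cdot> v = - (x \<cdot> v)" "x \<cdot> (- v) = - (x \<cdot> v)"
  using act_add[of x "- x" v] act_plus[of x v "- v"] by (simp_all add: eq_neg_iff_add_eq_0 add.commute)

lemma act_diff: "(x - y) \<cdot> v = x \<cdot> v - y \<cdot> v" "x \<cdot> (v - w) = x \<cdot> v - x \<cdot> w"
  using act_add[of x "- y" v] act_plus[of x v "- w"] by (simp_all add: act_minus)

lemma act_sum: "x \<cdot> (\<Sum>k\<in>I. f k) = (\<Sum>k\<in>I. x \<cdot> f k)"
  by (induction I rule: infinite_finite_induct) (simp_all add: act_plus)

lemma sum_act: "(\<Sum>k\<in>I. f k) \<cdot> v = (\<Sum>k\<in>I. f k \<cdot> v)"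
  by (induction I rule: infinite_finite_induct) (simp_all add: act_add)

definition sc :: "Qq \<Rightarrow> 'v \<Rightarrow> 'v" (infixr \<open>\<star>\<close> 75) where
  "c \<star> v = scal c \<cdot> v"

sublocale V: vector_space sc
  by unfold_locales (simp_all add: sc_def act_plus act_add act_mult scal_add scal_mult scal_1)

lemmas sc_distrib = V.scale_right_distrib V.scale_left_distrib V.scale_right_diff_distrib
  V.scale_left_diff_distrib

lemma act_sc [simp]: "x \<cdot> (c \<star> v) = c \<star> (x \<cdot> v)"
  unfolding sc_def act_mult[symmetric] by (simp add: scal_comm)

lemma sm_act [simp]: "(c \<odot> x) \<cdot> v = c \<star> (x \<cdot> v)"
  by (simp add: sm_def sc_def act_mult)

lemma scal_act [simp]: "scal c \<cdot> v = c \<star> v"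
  by (simp add: sc_def)

section \<open>Eigenvectors whose eigenvalues are powers of q\<close>

lemma eigenvectors_independent:
  assumes "finite I" "inj_on g I" "\<And>k. k \<in> I \<Longrightarrow> Z \<cdot> v k = qq powi g k \<star> v k" "(\<Sum>k\<in>I. v k) = 0" "k \<in> I"
  shows "v k = 0"
  using assms
proof (induction I arbitrary: v k rule: finite_induct)
  case (insert t I)
  define w where "w k = (qq powi g k - qq powi g t) \<star> v k" for k
  have "(\<Sum>k\<in>insert t I. w k) = Z \<cdot> (\<Sum>k\<in>insert t I. v k) - qq powi g t \<star> (\<Sum>k\<in>insert t I. v k)"
    unfolding act_sum V.scale_sum_right sum_subtractf[symmetric]
    by (intro sum.cong) (simp_all add: w_def sc_distrib insert.prems(2))
  then have "(\<Sum>k\<in>I. w k) = 0"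
    using insert.hyps insert.prems(3) by (simp add: w_def)
  then have "w k = 0" if "k \<in> I" for k
    using insert.IH[of w k] insert.prems that by (auto simp: w_def V.scale_left_commute)
  then have *: "v k = 0" if "k \<in> I" for k
    using that insert.prems(1) insert.hyps(2) unfolding w_def by (auto simp: inj_on_def)
  then have "v t = 0" using insert.prems(3) insert.hyps by simp
  with * show ?case using insert.prems(4) by auto
qed simp

lemma eigenvectors_separate:
  assumes "finite I" "\<And>k. k \<in> I \<Longrightarrow> Z \<cdot> v k = qq powi g k \<star> v k" "(\<Sum>k\<in>I. v k) = 0"
  shows "(\<Sum>k\<in>{k\<in>I. g k = t}. v k) = 0"
proof (cases "t \<in> g ` I")
  case True
  show ?thesis
  proof (rule eigenvectors_independent[where I = "g ` I" and g = id and Z = Z])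
    show "(\<Sum>t\<in>g ` I. \<Sum>k\<in>{k\<in>I. g k = t}. v k) = 0"
      using assms sum.image_gen[of I v g] by simp
  qed (use assms True in \<open>auto simp: act_sum V.scale_sum_right\<close>)
next
  case False
  then have "{k\<in>I. g k = t} = {}" by auto
  then show ?thesis by (metis sum.empty)
qed

text \<open>Lagrange interpolation in Z: the projection to one eigenvector is the action of an
  element of the algebra, so it can be carried out simultaneously in several modules.\<close>

lemma eigenvector_projection:
  assumes "finite I" "k0 \<notin> I" "inj_on g (insert k0 I)" "\<And>k. k \<in> insert k0 I \<Longrightarrow> Z \<cdot> v k = qq powi g k \<star> v k"
  shows "\<exists>p. p \<cdot> (\<Sum>k\<in>insert k0 I. v k) = v k0"
  using assms
proof (induction I arbitrary: v rule: finite_induct)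
  case empty
  then show ?case by (auto intro: exI[of _ 1])
next
  case (insert t I)
  define w where "w k = (qq powi g k - qq powi g t) \<star> v k" for k
  have g: "g k0 \<noteq> g t" using insert by (auto simp: inj_on_def)
  have "(Z - scal (qq powi g t)) \<cdot> (\<Sum>k\<in>insert k0 (insert t I). v k) = (\<Sum>k\<in>insert k0 (insert t I). w k)"
    unfolding act_sum
    by (intro sum.cong) (simp_all add: w_def act_diff sc_distrib insert.prems(3))
  also have "\<dots> = (\<Sum>k\<in>insert k0 I. w k)"
    using insert.hyps insert.prems(1) by (simp add: w_def)
  finally have 1: "(Z - scal (qq powi g t)) \<cdot> (\<Sum>k\<in>insert k0 (insert t I). v k) = (\<Sum>k\<in>insert k0 I. w k)" .
  have "\<exists>p. p \<cdot> (\<Sum>k\<in>insert k0 I. w k) = w k0"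
    using insert.prems by (intro insert.IH) (auto simp: w_def V.scale_left_commute inj_on_def)
  then obtain p where "p \<cdot> (\<Sum>k\<in>insert k0 I. w k) = w k0" by blast
  then have "(inverse (qq powi g k0 - qq powi g t) \<odot> (p * (Z - scal (qq powi g t)))) \<cdot> (\<Sum>k\<in>insert k0 (insert t I). v k) = v k0"
    using g by (simp add: act_mult 1 w_def)
  then show ?case by blast
qed

section \<open>Weight vectors and the commutation of E with divided powers of F\<close>

definition wtv :: "(node \<Rightarrow> int) \<Rightarrow> 'v \<Rightarrow> bool" where
  "wtv h v \<longleftrightarrow> (\<forall>i. KK i \<cdot> v = qq powi h i \<star> v)"

lemma wtv_KK: "wtv h v \<Longrightarrow> KK i \<cdot> v = qq powi h i \<star> v"
  by (simp add: wtv_def)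

lemma wtv_KKinv:
  assumes "wtv h v"
  shows "KKinv i \<cdot> v = qq powi (- h i) \<star> v"
proof -
  have "qq powi (h i) \<star> (KKinv i \<cdot> v) = KKinv i \<cdot> KK i \<cdot> v"
    using assms by (simp add: wtv_KK)
  also have "\<dots> = v" by (simp add: KKinv_KK flip: act_mult)
  finally have "qq powi (- h i) \<star> qq powi (h i) \<star> (KKinv i \<cdot> v) = qq powi (- h i) \<star> v" by simp
  then show ?thesis by (simp add: power_int_minus)
qed

lemma wtv_0 [simp]: "wtv h 0"
  by (simp add: wtv_def)

lemma wtv_sc: "wtv h v \<Longrightarrow> wtv h (c \<star> v)"
  by (simp add: wtv_def mult.commute)

lemma wtv_FF: "wtv h v \<Longrightarrow> wtv (\<lambda>i. h i - cartan i j) (FF j \<cdot> v)"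
  unfolding wtv_def by (simp add: KK_FF' power_int_add[symmetric] flip: act_mult) (simp add: act_mult flip: power_int_add)

lemma wtv_EE: "wtv h v \<Longrightarrow> wtv (\<lambda>i. h i + cartan i j) (EE j \<cdot> v)"
  unfolding wtv_def by (simp add: KK_EE' flip: act_mult) (simp add: act_mult add.commute flip: power_int_add)

lemma wtv_dpow_FF:
  assumes "wtv h v"
  shows "wtv (\<lambda>i. h i - r * cartan i j) (dpow (FF j) r \<cdot> v)"
proof -
  have *: "wtv (\<lambda>i. h i - int k * cartan i j) ((FF j ^ k) \<cdot> v)" for k
  proof (induction k)
    case (Suc k)
    from wtv_FF[OF Suc, of j] show ?case by (simp add: act_mult algebra_simps)
  qed (use assms in simp)
  show ?thesis
  proof (cases "r < 0")
    case False
    then obtain k where r: "r = int k" by (metis nonneg_int_cases not_less)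
    show ?thesis using wtv_sc[OF *[of k]] by (simp add: r dpow_nat)
  qed (simp add: dpow_neg)
qed

lemma EE_FF_act:
  assumes "wtv h v"
  shows "EE j \<cdot> FF j \<cdot> v = FF j \<cdot> EE j \<cdot> v + qnum (h j) \<star> v"
proof -
  have "EE j \<cdot> FF j \<cdot> v = FF j \<cdot> EE j \<cdot> v + inverse (qq - inverse qq) \<star> (qq powi (h j) - qq powi (- h j)) \<star> v"
    using assms by (simp add: EE_FF_same act_add act_diff wtv_KK wtv_KKinv sc_distrib flip: act_mult)
  then show ?thesis by (simp add: qnum_def divide_inverse mult.commute)
qed

text \<open>The usual sl2 formula, but without assuming that E kills v: it is applied to the outer
  power of a monomial, whose inner part is not a highest weight vector.\<close>

lemma EE_dpow_FF_act:
  assumes "wtv h v"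
  shows "EE j \<cdot> dpow (FF j) r \<cdot> v = dpow (FF j) r \<cdot> EE j \<cdot> v + qnum (h j - r + 1) \<star> (dpow (FF j) (r - 1) \<cdot> v)"
proof (cases "r < 0")
  case True
  then show ?thesis by (simp add: dpow_neg)
next
  case False
  then obtain k where r: "r = int k" by (metis nonneg_int_cases not_less)
  show ?thesis unfolding r
  proof (induction k)
    case 0
    show ?case by (simp add: dpow_neg)
  next
    case (Suc k)
    let ?F = "\<lambda>r. dpow (FF j) r"
    have S: "int (Suc k) = int k + 1" by simp
    have F: "FF j \<cdot> ?F r \<cdot> w = qnum (r + 1) \<star> (?F (r + 1) \<cdot> w)" for r w
      by (simp add: mult_dpow flip: act_mult)
    have "qnum (int k + 1) \<star> (EE j \<cdot> ?F (int (Suc k)) \<cdot> v) = EE j \<cdot> FF j \<cdot> ?F (int k) \<cdot> v"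
      unfolding S F by simp
    also have "\<dots> = FF j \<cdot> EE j \<cdot> ?F (int k) \<cdot> v + qnum (h j - int k * 2) \<star> (?F (int k) \<cdot> v)"
      using EE_FF_act[OF wtv_dpow_FF[OF assms, of "int k" j], of j] by simp
    also have "FF j \<cdot> EE j \<cdot> ?F (int k) \<cdot> v = qnum (int k + 1) \<star> (?F (int k + 1) \<cdot> EE j \<cdot> v) + (qnum (h j - int k + 1) * qnum (int k)) \<star> (?F (int k) \<cdot> v)"
      unfolding Suc.IH by (simp add: act_plus F)
    also have "\<dots> + qnum (h j - int k * 2) \<star> (?F (int k) \<cdot> v) =
      qnum (int k + 1) \<star> (?F (int k + 1) \<cdot> EE j \<cdot> v) +
      (qnum (h j - int k + 1) * qnum (int k) + qnum (h j - int k * 2)) \<star> (?F (int k) \<cdot> v)"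
      by (simp add: sc_distrib)
    also have "qnum (h j - int k + 1) * qnum (int k) + qnum (h j - int k * 2) = qnum (int k + 1) * qnum (h j - int k)"
      using qnum_cross[of "int k" "h j - int k"] by (simp add: algebra_simps)
    finally have "qnum (int k + 1) \<star> (EE j \<cdot> ?F (int (Suc k)) \<cdot> v) =
      qnum (int k + 1) \<star> (?F (int k + 1) \<cdot> EE j \<cdot> v + qnum (h j - int k) \<star> (?F (int k) \<cdot> v))"
      by (simp add: sc_distrib)
    then show ?case by (simp add: S add.commute)
  qed
qed

lemma EE_dpow_FF_other: "i \<noteq> j \<Longrightarrow> EE i \<cdot> dpow (FF j) r \<cdot> v = dpow (FF j) r \<cdot> EE i \<cdot> v"
  by (simp add: EE_FF_other commute_dpow flip: act_mult)

end

section \<open>Singular vectors and the filtration by word length\<close>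

text \<open>A grading element: conjugation by it multiplies every \<open>FF j\<close> by q^-1, so
  its eigenvalues count the letters of a word in the F.\<close>

definition KK12 :: Uq where
  "KK12 = KK N1 * KK N2"

locale singular_vector = uq_mod act for act :: "Uq \<Rightarrow> 'v :: ab_group_add \<Rightarrow> 'v" (infixr \<open>\<cdot>\<close> 68) +
  fixes \<eta> :: 'v and M :: "node \<Rightarrow> int"
  assumes eta_nonzero: "\<eta> \<noteq> 0"
    and EE_eta: "EE i \<cdot> \<eta> = 0"
    and wtv_eta: "wtv M \<eta>"
begin

text \<open>The span of the words of length strictly less than e applied to \<open>\<eta>\<close>;
  thus \<open>Fl 0\<close> is zero and \<open>Fl 1\<close> is the line through
  \<open>\<eta>\<close>.\<close>

primrec Fl :: "nat \<Rightarrow> 'v set" where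
  "Fl 0 = {0}"
| "Fl (Suc e) = {c \<star> \<eta> + FF N1 \<cdot> y + FF N2 \<cdot> z | c y z. y \<in> Fl e \<and> z \<in> Fl e}"

lemma Fl_SucI: "y \<in> Fl e \<Longrightarrow> z \<in> Fl e \<Longrightarrow> c \<star> \<eta> + FF N1 \<cdot> y + FF N2 \<cdot> z \<in> Fl (Suc e)"
  by auto

lemma Fl_SucE:
  assumes "v \<in> Fl (Suc e)"
  obtains c y z where "v = c \<star> \<eta> + FF N1 \<cdot> y + FF N2 \<cdot> z" "y \<in> Fl e" "z \<in> Fl e"
  using assms by auto

lemma Fl_0: "0 \<in> Fl e"
proof (induction e)
  case (Suc e)
  from Fl_SucI[OF Suc Suc, of 0] show ?case by simp
qed simp

lemma Fl_add: "v \<in> Fl e \<Longrightarrow> w \<in> Fl e \<Longrightarrow> v + w \<in> Fl e"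
proof (induction e arbitrary: v w)
  case (Suc e)
  obtain c y z where v: "v = c \<star> \<eta> + FF N1 \<cdot> y + FF N2 \<cdot> z" "y \<in> Fl e" "z \<in> Fl e"
    using Suc.prems(1) by (rule Fl_SucE)
  obtain c' y' z' where w: "w = c' \<star> \<eta> + FF N1 \<cdot> y' + FF N2 \<cdot> z'" "y' \<in> Fl e" "z' \<in> Fl e"
    using Suc.prems(2) by (rule Fl_SucE)
  have "v + w = (c + c') \<star> \<eta> + FF N1 \<cdot> (y + y') + FF N2 \<cdot> (z + z')"
    unfolding v(1) w(1) by (simp add: sc_distrib act_plus)
  then show ?case using Fl_SucI[OF Suc.IH[OF v(2) w(2)] Suc.IH[OF v(3) w(3)]] by simp
qed simp

lemma Fl_sc: "v \<in> Fl e \<Longrightarrow> d \<star> v \<in> Fl e"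
proof (induction e arbitrary: v)
  case (Suc e)
  obtain c y z where v: "v = c \<star> \<eta> + FF N1 \<cdot> y + FF N2 \<cdot> z" "y \<in> Fl e" "z \<in> Fl e"
    using Suc.prems(1) by (rule Fl_SucE)
  have "d \<star> v = (d * c) \<star> \<eta> + FF N1 \<cdot> (d \<star> y) + FF N2 \<cdot> (d \<star> z)"
    unfolding v(1) by (simp add: sc_distrib)
  then show ?case using Fl_SucI[OF Suc.IH[OF v(2)] Suc.IH[OF v(3)]] by simp
qed simp

lemma Fl_minus: "v \<in> Fl e \<Longrightarrow> - v \<in> Fl e"
  using Fl_sc[of v e "- 1"] by simp

lemma Fl_diff: "v \<in> Fl e \<Longrightarrow> w \<in> Fl e \<Longrightarrow> v - w \<in> Fl e"
  using Fl_add[of v e "- w"] Fl_minus by simp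

lemma Fl_sum: "(\<And>k. k \<in> I \<Longrightarrow> f k \<in> Fl e) \<Longrightarrow> (\<Sum>k\<in>I. f k) \<in> Fl e"
  by (induction I rule: infinite_finite_induct) (simp_all add: Fl_0 Fl_add)

lemma Fl_FF: "v \<in> Fl e \<Longrightarrow> FF i \<cdot> v \<in> Fl (Suc e)"
  using Fl_SucI[of v e 0 0] Fl_SucI[of 0 e v 0] by (cases i) (simp_all add: Fl_0)

lemma Fl_eta: "\<eta> \<in> Fl (Suc e)"
  using Fl_SucI[of 0 e 0 1] by (simp add: Fl_0)

lemma Fl_mono: "v \<in> Fl e \<Longrightarrow> e \<le> e' \<Longrightarrow> v \<in> Fl e'"
proof (induction e arbitrary: v e')
  case (Suc e)
  then obtain d where d: "e' = Suc d" "e \<le> d" by (metis Suc_le_D Suc_le_mono)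
  obtain c y z where v: "v = c \<star> \<eta> + FF N1 \<cdot> y + FF N2 \<cdot> z" "y \<in> Fl e" "z \<in> Fl e"
    using Suc.prems(1) by (rule Fl_SucE)
  then show ?case unfolding d v(1) by (intro Fl_SucI Suc.IH[OF _ d(2)])
qed (simp add: Fl_0)

lemma Fl_stable:
  assumes "v \<in> Fl e"
    and eta: "x \<cdot> \<eta> = a \<star> \<eta>" and FF: "\<And>j y. x \<cdot> FF j \<cdot> y = b j \<star> (FF j \<cdot> x \<cdot> y)"
  shows "x \<cdot> v \<in> Fl e"
  using assms(1)
proof (induction e arbitrary: v)
  case (Suc e)
  obtain c y z where v: "v = c \<star> \<eta> + FF N1 \<cdot> y + FF N2 \<cdot> z" "y \<in> Fl e" "z \<in> Fl e"
    using Suc.prems(1) by (rule Fl_SucE)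
  show ?case unfolding v act_plus act_sc eta FF
    by (intro Fl_add Fl_sc Fl_eta Fl_FF Suc.IH v)
qed simp

lemma Fl_KK: "v \<in> Fl e \<Longrightarrow> KK i \<cdot> v \<in> Fl e"
  by (rule Fl_stable[where a = "qq powi M i" and b = "\<lambda>j. qq powi (- cartan i j)"])
     (simp_all add: wtv_KK[OF wtv_eta] KK_FF' flip: act_mult)

lemma Fl_KKinv: "v \<in> Fl e \<Longrightarrow> KKinv i \<cdot> v \<in> Fl e"
  by (rule Fl_stable[where a = "qq powi (- M i)" and b = "\<lambda>j. qq powi (cartan i j)"])
     (simp_all add: wtv_KKinv[OF wtv_eta] KKinv_FF' flip: act_mult)

lemma Fl_EE: "v \<in> Fl e \<Longrightarrow> EE i \<cdot> v \<in> Fl e"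
proof (induction e arbitrary: v)
  case (Suc e)
  obtain c y z where v: "v = c \<star> \<eta> + FF N1 \<cdot> y + FF N2 \<cdot> z" "y \<in> Fl e" "z \<in> Fl e"
    using Suc.prems(1) by (rule Fl_SucE)
  have "EE i \<cdot> FF j \<cdot> w \<in> Fl (Suc e)" if "w \<in> Fl e" for j w
  proof (cases "i = j")
    case True
    have "EE i \<cdot> FF i \<cdot> w = FF i \<cdot> EE i \<cdot> w + inverse (qq - inverse qq) \<star> (KK i \<cdot> w - KKinv i \<cdot> w)"
      by (simp add: EE_FF_same act_add act_diff flip: act_mult)
    also have "\<dots> \<in> Fl (Suc e)"
      using that by (intro Fl_add Fl_FF Fl_sc Fl_diff Suc.IH Fl_mono[of _ e "Suc e"] Fl_KK Fl_KKinv) auto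
    finally show ?thesis using True by simp
  next
    case False
    then have "EE i \<cdot> FF j \<cdot> w = FF j \<cdot> EE i \<cdot> w" by (simp add: EE_FF_other flip: act_mult)
    then show ?thesis using that by (simp only: Fl_FF Suc.IH)
  qed
  then show ?case unfolding v(1) using v(2,3) by (simp only: act_plus act_sc EE_eta V.scale_zero_right Fl_add Fl_0)
qed simp

text \<open>Takes the place of a triangular decomposition: each generator raises word length by at
  most one, hence each element by a bounded amount, and the cyclic module is exhausted by the
  \<open>Fl e\<close>.\<close>

lemma Fl_uq: "\<exists>d. \<forall>e v. v \<in> Fl e \<longrightarrow> u \<cdot> v \<in> Fl (e + d)"
proof (induction u rule: Uq_induct)
  case (scal c)
  then show ?case by (intro exI[of _ 0]) (simp add: Fl_sc)
next
  case (EE i)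
  then show ?case by (intro exI[of _ 0]) (simp add: Fl_EE)
next
  case (FF i)
  then show ?case by (intro exI[of _ 1]) (simp add: Fl_FF del: Fl.simps)
next
  case (KK i)
  then show ?case by (intro exI[of _ 0]) (simp add: Fl_KK)
next
  case (KKinv i)
  then show ?case by (intro exI[of _ 0]) (simp add: Fl_KKinv)
next
  case (plus x y)
  then obtain d d' where "\<forall>e v. v \<in> Fl e \<longrightarrow> x \<cdot> v \<in> Fl (e + d)" "\<forall>e v. v \<in> Fl e \<longrightarrow> y \<cdot> v \<in> Fl (e + d')"
    by blast
  then have "\<forall>e v. v \<in> Fl e \<longrightarrow> (x + y) \<cdot> v \<in> Fl (e + (d + d'))"
    unfolding act_add by (intro allI impI Fl_add; meson Fl_mono add_le_mono le_add1 le_add2 order_refl)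
  then show ?case by blast
next
  case (times x y)
  then obtain d d' where "\<forall>e v. v \<in> Fl e \<longrightarrow> x \<cdot> v \<in> Fl (e + d)" "\<forall>e v. v \<in> Fl e \<longrightarrow> y \<cdot> v \<in> Fl (e + d')"
    by blast
  then have "\<forall>e v. v \<in> Fl e \<longrightarrow> (x * y) \<cdot> v \<in> Fl (e + (d' + d))"
    unfolding act_mult by (metis add.assoc)
  then show ?case by blast
qed

lemma Fl_cyclic: "\<exists>e. u \<cdot> \<eta> \<in> Fl e"
  using Fl_uq[of u] Fl_eta by blast

abbreviation M12 :: int where
  "M12 \<equiv> M N1 + M N2"

lemma KK12_FF: "KK12 * FF j = qq powi (- 1) \<odot> (FF j * KK12)"
proof -
  have "KK12 * FF j = qq powi (- cartan N2 j) \<odot> ((KK N1 * FF j) * KK N2)"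
    by (simp add: KK12_def mult.assoc KK_FF'[of N2])
  also have "\<dots> = (qq powi (- cartan N2 j) * qq powi (- cartan N1 j)) \<odot> (FF j * KK12)"
    by (simp add: KK12_def mult.assoc KK_FF'[of N1])
  also have "qq powi (- cartan N2 j) * qq powi (- cartan N1 j) = qq powi (- 1)"
    by (simp only: power_int_add[OF disjI1[OF qq_nonzero], symmetric]) (cases j; simp add: cartan_def)
  finally show ?thesis .
qed

lemma wtv_KK12: "wtv h v \<Longrightarrow> KK12 \<cdot> v = qq powi (h N1 + h N2) \<star> v"
  by (simp add: KK12_def act_mult wtv_KK power_int_add mult.commute)

text \<open>Besides the grading, two facts are recorded for the later projection to degree 0: the
  components stay in the cyclic module, and the one of degree 0 is a multiple of
  \<open>\<eta>\<close>.\<close>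

lemma Fl_decompose:
  "v \<in> Fl e \<Longrightarrow> \<exists>w. v = (\<Sum>k<e. w k) \<and> (\<forall>k. KK12 \<cdot> w k = qq powi (M12 - int k) \<star> w k \<and> (\<exists>u. w k = u \<cdot> \<eta>))
    \<and> (\<exists>c. w 0 = c \<star> \<eta>)"
proof (induction e arbitrary: v)
  case 0
  then show ?case by (intro exI[of _ "\<lambda>_. 0"]) (auto intro: exI[of _ 0] exI[of _ "0 :: Uq"])
next
  case (Suc e)
  obtain c y z where v: "v = c \<star> \<eta> + FF N1 \<cdot> y + FF N2 \<cdot> z" "y \<in> Fl e" "z \<in> Fl e"
    using Suc.prems(1) by (rule Fl_SucE)
  obtain y' where y': "y = (\<Sum>k<e. y' k)" "\<And>k. KK12 \<cdot> y' k = qq powi (M12 - int k) \<star> y' k" "\<And>k. \<exists>u. y' k = u \<cdot> \<eta>"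
    using Suc.IH[OF v(2)] by blast
  obtain z' where z': "z = (\<Sum>k<e. z' k)" "\<And>k. KK12 \<cdot> z' k = qq powi (M12 - int k) \<star> z' k" "\<And>k. \<exists>u. z' k = u \<cdot> \<eta>"
    using Suc.IH[OF v(3)] by blast
  define w where "w k = (case k of 0 \<Rightarrow> c \<star> \<eta> | Suc k \<Rightarrow> FF N1 \<cdot> y' k + FF N2 \<cdot> z' k)" for k
  have "v = (\<Sum>k<Suc e. w k)"
    unfolding sum.lessThan_Suc_shift by (simp add: w_def v(1) y'(1) z'(1) act_sum sum.distrib)
  moreover have "KK12 \<cdot> FF j \<cdot> u = qq powi (M12 - int (Suc k)) \<star> (FF j \<cdot> u)"
    if "KK12 \<cdot> u = qq powi (M12 - int k) \<star> u" for j k u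
  proof -
    have "KK12 \<cdot> FF j \<cdot> u = qq powi (- 1) \<star> (FF j \<cdot> KK12 \<cdot> u)"
      by (simp add: KK12_FF flip: act_mult)
    also have "\<dots> = qq powi (M12 - int (Suc k)) \<star> (FF j \<cdot> u)"
      unfolding that act_sc V.scale_scale power_int_add[OF disjI1[OF qq_nonzero], symmetric] by (simp add: algebra_simps)
    finally show ?thesis .
  qed
  from this[OF y'(2)] this[OF z'(2)] have "KK12 \<cdot> w k = qq powi (M12 - int k) \<star> w k" for k
    by (cases k) (simp_all add: w_def act_plus sc_distrib wtv_KK12[OF wtv_eta] mult.commute)
  moreover have "\<exists>u. w k = u \<cdot> \<eta>" for k
  proof (cases k)
    case 0
    then show ?thesis by (intro exI[of _ "scal c"]) (simp add: w_def)
  next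
    case (Suc k')
    obtain u u' where "y' k' = u \<cdot> \<eta>" "z' k' = u' \<cdot> \<eta>" using y'(3) z'(3) by blast
    then show ?thesis using Suc by (intro exI[of _ "FF N1 * u + FF N2 * u'"]) (simp add: w_def act_mult act_add)
  qed
  ultimately show ?case by (intro exI[of _ w]) (auto simp: w_def)
qed

lemma Fl_high_degree:
  assumes "v \<in> Fl e" "KK12 \<cdot> v = qq powi (M12 - int e') \<star> v" "e \<le> e'"
  shows "v = 0"
proof -
  obtain w where w: "v = (\<Sum>k<e. w k)" "\<And>k. KK12 \<cdot> w k = qq powi (M12 - int k) \<star> w k"
    using Fl_decompose[OF assms(1)] by blast
  \<comment> \<open>Adjoining - v in degree e', which the words of length below e do not reach,
    gives a vanishing sum of eigenvectors with distinct eigenvalues.\<close>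
  define w' where "w' k = (if k = e' then - v else w k)" for k
  have "w' e' = 0"
  proof (rule eigenvectors_independent[where I = "insert e' {..<e}" and v = w' and Z = KK12 and g = "\<lambda>k. M12 - int k"])
    have "(\<Sum>k<e. w' k) = v"
      unfolding w(1) by (intro sum.cong) (use assms in \<open>auto simp: w'_def\<close>)
    then show "(\<Sum>k\<in>insert e' {..<e}. w' k) = 0" using assms(3) by (simp add: w'_def)
  qed (auto simp: w'_def w(2) assms(2) act_minus inj_on_def)
  then show ?thesis by (simp add: w'_def)
qed

lemma BB_diff_FF: "v \<in> Fl e \<Longrightarrow> (BB vs i - FF i) \<cdot> v \<in> Fl e"
  by (simp add: BB_def act_mult Fl_sc Fl_EE Fl_KKinv)

text \<open>Equality of leading terms in word length e. Requiring both vectors to lie in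
  \<open>Fl (Suc e)\<close> makes the relation persist when B acts on one side and F on the
  other.\<close>

definition close :: "nat \<Rightarrow> 'v \<Rightarrow> 'v \<Rightarrow> bool" where
  "close e v w \<longleftrightarrow> v \<in> Fl (Suc e) \<and> w \<in> Fl (Suc e) \<and> v - w \<in> Fl e"

lemma close_step:
  assumes "close e v w"
  shows "close (Suc e) (BB vs i \<cdot> v) (FF i \<cdot> w)"
proof -
  have vw: "v \<in> Fl (Suc e)" "w \<in> Fl (Suc e)" "v - w \<in> Fl e" using assms by (simp_all add: close_def)
  have "BB vs i \<cdot> v - FF i \<cdot> w = (BB vs i - FF i) \<cdot> v + FF i \<cdot> (v - w)"
    by (simp add: act_diff)
  also have "\<dots> \<in> Fl (Suc e)"
    by (intro Fl_add BB_diff_FF Fl_FF vw)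
  finally have *: "BB vs i \<cdot> v - FF i \<cdot> w \<in> Fl (Suc e)" .
  moreover have "(BB vs i \<cdot> v - FF i \<cdot> w) + FF i \<cdot> w \<in> Fl (Suc (Suc e))"
    by (intro Fl_add Fl_FF vw Fl_mono[OF *]) simp
  ultimately show ?thesis using vw Fl_FF[OF vw(2)] by (simp add: close_def del: Fl.simps)
qed

lemma close_sc: "close e v w \<Longrightarrow> close e (c \<star> v) (c \<star> w)"
  unfolding close_def by (metis Fl_sc sc_distrib(3))

lemma close_dpow:
  assumes "close e v w"
  shows "close (e + k) (dpow (BB vs i) (int k) \<cdot> v) (dpow (FF i) (int k) \<cdot> w)"
proof -
  have "close (e + k) ((BB vs i ^ k) \<cdot> v) ((FF i ^ k) \<cdot> w)"
    by (induction k) (simp_all add: assms act_mult close_step)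
  then show ?thesis by (simp add: dpow_nat close_sc)
qed

end

section \<open>Dominant highest weights\<close>

locale hw_mod = singular_vector act \<eta> "\<lambda>i. int (M i)"
  for act :: "Uq \<Rightarrow> 'v :: ab_group_add \<Rightarrow> 'v" (infixr \<open>\<cdot>\<close> 68) and \<eta> :: 'v and M :: "node \<Rightarrow> nat"
begin

section \<open>The action of E on the monomials in F\<close>

abbreviation T :: "node \<Rightarrow> int \<Rightarrow> int \<Rightarrow> int \<Rightarrow> 'v" where
  "T i a b c \<equiv> Fmon i a b c \<cdot> \<eta>"

lemma T_neg: "a < 0 \<or> b < 0 \<or> c < 0 \<Longrightarrow> T i a b c = 0"
  by (auto simp: Fmon_def dpow_neg)

lemma T_eq: "T i a b c = dpow (FF (tau i)) a \<cdot> dpow (FF i) b \<cdot> dpow (FF (tau i)) c \<cdot> \<eta>"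
  by (simp add: Fmon_def act_mult)

lemma wtv_T:
  "wtv (\<lambda>k. int (M k) - (a + c) * cartan k (tau i) - b * cartan k i) (T i a b c)"
proof -
  have "wtv (\<lambda>k. int (M k) - c * cartan k (tau i) - b * cartan k i - a * cartan k (tau i)) (T i a b c)"
    unfolding T_eq by (intro wtv_dpow_FF wtv_eta)
  then show ?thesis by (simp add: algebra_simps)
qed

lemma EE_dpow_FF_eta: "EE j \<cdot> dpow (FF j) r \<cdot> \<eta> = qnum (int (M j) - r + 1) \<star> (dpow (FF j) (r - 1) \<cdot> \<eta>)"
  using EE_dpow_FF_act[OF wtv_eta] by (simp add: EE_eta)

lemma EE_outer:
  "EE (tau i) \<cdot> T i a b c = qnum (int (M (tau i)) - 2 * c + b - a + 1) \<star> T i (a - 1) b c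
     + qnum (int (M (tau i)) - c + 1) \<star> T i a b (c - 1)"
proof -
  have "wtv (\<lambda>k. int (M k) - c * cartan k (tau i) - b * cartan k i) (dpow (FF i) b \<cdot> dpow (FF (tau i)) c \<cdot> \<eta>)"
    by (intro wtv_dpow_FF wtv_eta)
  from EE_dpow_FF_act[OF this, of "tau i" a] show ?thesis
    unfolding T_eq by (simp add: EE_dpow_FF_other EE_dpow_FF_eta algebra_simps)
qed

lemma EE_inner:
  "EE i \<cdot> T i a b c = qnum (int (M i) + c - b + 1) \<star> T i a (b - 1) c"
proof -
  have "wtv (\<lambda>k. int (M k) - c * cartan k (tau i)) (dpow (FF (tau i)) c \<cdot> \<eta>)"
    by (intro wtv_dpow_FF wtv_eta)
  from EE_dpow_FF_act[OF this, of i b] show ?thesis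
    unfolding T_eq by (simp add: EE_dpow_FF_other EE_eta)
qed

lemma EE_outer_sum:
  "EE (tau i) \<cdot> (\<Sum>c\<le>Suc s. x c \<star> T i (int (Suc s) - int c) b (int c)) =
   (\<Sum>c\<le>s. (x c * qnum (int (M (tau i)) - int c + b - int s) + x (Suc c) * qnum (int (M (tau i)) - int c))
      \<star> T i (int s - int c) b (int c))"
proof -
  let ?m = "int (M (tau i))"
  have "EE (tau i) \<cdot> (\<Sum>c\<le>Suc s. x c \<star> T i (int (Suc s) - int c) b (int c)) =
      (\<Sum>c\<le>Suc s. (x c * qnum (?m - int c + b - int s)) \<star> T i (int s - int c) b (int c)) +
      (\<Sum>c\<le>Suc s. (x c * qnum (?m - int c + 1)) \<star> T i (int (Suc s) - int c) b (int c - 1))"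
    unfolding act_sum sum.distrib[symmetric]
    by (intro sum.cong) (simp_all add: EE_outer sc_distrib algebra_simps)
  also have "(\<Sum>c\<le>Suc s. (x c * qnum (?m - int c + b - int s)) \<star> T i (int s - int c) b (int c)) =
      (\<Sum>c\<le>s. (x c * qnum (?m - int c + b - int s)) \<star> T i (int s - int c) b (int c))"
    by (simp add: T_neg)
  also have "(\<Sum>c\<le>Suc s. (x c * qnum (?m - int c + 1)) \<star> T i (int (Suc s) - int c) b (int c - 1)) =
      (\<Sum>c\<le>s. (x (Suc c) * qnum (?m - int c)) \<star> T i (int s - int c) b (int c))"
    unfolding sum.atMost_Suc_shift by (simp add: T_neg)
  finally show ?thesis by (simp add: sum.distrib sc_distrib)
qed

lemma EE_inner_sum:
  "EE i \<cdot> (\<Sum>c\<le>s. x c \<star> T i (int s - int c) b (int c)) =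
   (\<Sum>c\<le>s. (x c * qnum (int (M i) + int c - b + 1)) \<star> T i (int s - int c) (b - 1) (int c))"
  unfolding act_sum by (simp add: EE_inner)

text \<open>The operators \<open>EE\<close> map a relation in one weight to relations in smaller ones; only in the
  balanced weights \<open>s = b\<close> neither operator suffices alone.\<close>

lemma T_independent:
  assumes "s \<le> b" "(\<Sum>c\<le>s. x c \<star> T i (int s - int c) (int b) (int c)) = 0"
    and "c \<le> s" "c \<le> M (tau i)" "b \<le> M i + c"
  shows "x c = 0"
  using assms
proof (induction "s + b" arbitrary: s b x c rule: less_induct)
  case less
  define m where "m = M (tau i)"
  note sb = less.prems(1) and rel = less.prems(2)
  \<comment> \<open>Applying \<open>EE (tau i)\<close> yields a relation with s lowered by one,
    whose coefficients vanish by induction.\<close>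
  have outer: "x c * qnum (int m - int c + int b - int s') + x (Suc c) * qnum (int m - int c) = 0"
    if s: "s = Suc s'" and c: "c \<le> s'" "c \<le> m" "b \<le> M i + c" for c s'
  proof (rule less.hyps[of s' b "\<lambda>c. x c * qnum (int m - int c + int b - int s') + x (Suc c) * qnum (int m - int c)"])
    show "(\<Sum>c\<le>s'. (x c * qnum (int m - int c + int b - int s') + x (Suc c) * qnum (int m - int c))
       \<star> T i (int s' - int c) (int b) (int c)) = 0"
      using EE_outer_sum[where i = i and s = s' and x = x and b = "int b"] rel s by (simp add: m_def)
  qed (use s c sb in \<open>auto simp: m_def\<close>)
  consider (big) "m < s" | (inner) "s \<le> m" "s < b" | (zero) "s = 0" "b = 0" | (balanced) "0 < s" "s \<le> m" "s = b"
    using sb by linarith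
  then show ?case
  proof cases
    case big
    then obtain s' where s: "s = Suc s'" by (cases s) auto
    \<comment> \<open>At c = m the second coefficient of \<open>outer\<close> vanishes and isolates
      x m; the other coefficients follow by descending from there.\<close>
    have "c \<le> m \<Longrightarrow> b \<le> M i + c \<Longrightarrow> x c = 0" for c
    proof (induction "m - c" arbitrary: c)
      case 0
      then show ?case using outer[OF s, of c] big s sb by simp
    next
      case (Suc d)
      then have "x (Suc c) = 0" by simp
      then show ?case using outer[OF s, of c] Suc big s sb by simp
    qed
    then show ?thesis using less.prems by (simp add: m_def)
  next
    case inner
    have "(\<Sum>c\<le>s. (x c * qnum (int (M i) + int c - int b + 1)) \<star> T i (int s - int c) (int (b - 1)) (int c)) = 0"
      using EE_inner_sum[where i = i and s = s and x = x and b = "int b"] rel inner by (simp add: of_nat_diff)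
    from less.hyps[OF _ _ this, of c] have "x c * qnum (int (M i) + int c - int b + 1) = 0"
      using inner less.prems by auto
    then show ?thesis using less.prems by simp
  next
    case zero
    then show ?thesis using rel eta_nonzero less.prems by (simp add: T_eq)
  next
    case balanced
    then obtain s' where s: "s = Suc s'" "b = Suc s'" by (cases s) auto
    \<comment> \<open>These are the coefficients after \<open>EE i\<close>, which leads to b = s',
      outside the range s \<le> b. A further application of \<open>EE (tau i)\<close> returns to the
      balanced weight with s', where the induction hypothesis applies.\<close>
    define y where "y c = x c * qnum (int (M i) + int c - int s')" for c
    have inner: "y c + y (Suc c) = 0" if c: "c \<le> s'" "s' \<le> M i + c" for c
    proof -
      have "(\<Sum>c\<le>Suc s'. y c \<star> T i (int (Suc s') - int c) (int s') (int c)) = 0"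
        using EE_inner_sum[where i = i and s = s and x = x and b = "int b"] rel s by (simp add: y_def add_diff_eq)
      then have "(\<Sum>c\<le>s'. (y c * qnum (int m - int c) + y (Suc c) * qnum (int m - int c))
          \<star> T i (int s' - int c) (int s') (int c)) = 0"
        using EE_outer_sum[where i = i and s = s' and x = y and b = "int s'"] by (simp add: m_def)
      from less.hyps[OF _ _ this, of c] have "(y c + y (Suc c)) * qnum (int m - int c) = 0"
        using c s balanced by (simp add: m_def ring_distribs)
      then show ?thesis using c s balanced by simp
    qed
    have step: "x (Suc c) = 0" if "x c = 0" "c \<le> s'" "b \<le> M i + c" for c
      using outer[OF s(1), of c] that balanced s by auto
    define c0 where "c0 = b - M i"
    have "x c0 = 0"
    proof (cases "b \<le> M i")
      case True
      then have "x 0 * qnum (int m + 1) + x 1 * qnum (int m) = 0"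
        using outer[OF s(1), of 0] s by simp
      moreover have "x 0 * qnum (int (M i) - int s') + x 1 * qnum (int (M i) - int s' + 1) = 0"
        using inner[of 0] True s by (simp add: y_def algebra_simps)
      \<comment> \<open>Two linear equations in x 0 and x 1 are available; their determinant is a
        single quantum integer of positive argument.\<close>
      moreover have "x 0 * (qnum (int m + 1) * qnum (int (M i) - int s' + 1) - qnum (int m) * qnum (int (M i) - int s')) =
          (x 0 * qnum (int m + 1) + x 1 * qnum (int m)) * qnum (int (M i) - int s' + 1) -
          (x 0 * qnum (int (M i) - int s') + x 1 * qnum (int (M i) - int s' + 1)) * qnum (int m)"
        by (simp only: ring_distribs mult_ac)
      ultimately have "x 0 * (qnum (int m + 1) * qnum (int (M i) - int s' + 1)
          - qnum (int m) * qnum (int (M i) - int s')) = 0"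
        by simp
      then have "x 0 * qnum (int m + (int (M i) - int s') + 1) = 0"
        by (simp only: qnum_mult_diff)
      then show ?thesis using True s by (simp add: c0_def)
    next
      case False
      then obtain d where d: "c0 = Suc d" "s' = M i + d" using s by (metis c0_def Suc_diff_le add_diff_inverse_nat diff_Suc_1 less_Suc_eq_le not_le nat_le_linear)
      \<comment> \<open>The index d lies just below the admissible range, where the quantum integer
        in y is [0]; this starts the recursion.\<close>
      then have "y d = 0" by (simp add: y_def)
      then have "y (Suc d) = 0" using inner[of d] d by simp
      then show ?thesis using d by (simp add: y_def)
    qed
    have "c0 \<le> c \<Longrightarrow> c \<le> s \<Longrightarrow> x c = 0" for c
    proof (induction c rule: dec_induct)
      case (step c)
      then show ?case using \<open>\<And>c. _ \<Longrightarrow> _ \<Longrightarrow> _ \<Longrightarrow> x (Suc c) = 0\<close>[of c] s by (simp add: c0_def)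
    qed (use \<open>x c0 = 0\<close> in simp)
    then show ?thesis using less.prems by (simp add: c0_def)
  qed
qed

lemma close_Bmon:
  "close (a + b + c) (Bmon vs i (int a) (int b) (int c) \<cdot> \<eta>) (T i (int a) (int b) (int c))"
proof -
  have "close 0 \<eta> \<eta>"
    using Fl_eta[of 0] by (simp add: close_def del: Fl.simps(2))
  from close_dpow[OF close_dpow[OF close_dpow[OF this, of c vs "tau i"], of b vs i], of a vs "tau i"]
  show ?thesis by (simp add: Bmon_def T_eq act_mult algebra_simps)
qed

end

text \<open>In each weight there is one family of monomials; the outer node is the one with the smaller
  multiplicity.\<close>

definition mon :: "(node \<Rightarrow> int \<Rightarrow> int \<Rightarrow> int \<Rightarrow> Uq) \<Rightarrow> nat \<times> nat \<times> nat \<Rightarrow> Uq" where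
  "mon G = (\<lambda>(p, r, c). if p \<le> r then G N2 (int p - int c) (int r) (int c)
                        else G N1 (int r - int c) (int p) (int c))"

text \<open>For inner node i and larger multiplicity b these are the conditions c \<le> M (tau i)
  and b - c \<le> M i under which the monomial in the F does not kill the highest weight vector,
  together with the bound of c by the smaller multiplicity.\<close>

definition allowed :: "(node \<Rightarrow> nat) \<Rightarrow> nat \<times> nat \<times> nat \<Rightarrow> bool" where
  "allowed M = (\<lambda>(p, r, c). if p \<le> r then c \<le> p \<and> c \<le> M N1 \<and> r \<le> M N2 + c
                        else c \<le> r \<and> c \<le> M N2 \<and> p \<le> M N1 + c)"

definition mdeg :: "nat \<times> nat \<times> nat \<Rightarrow> nat" where
  "mdeg = (\<lambda>(p, r, c). p + r)"

context hw_mod begin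

section \<open>Linear independence of the monomials in F and in B\<close>

lemma close_mon:
  assumes "allowed M t"
  shows "close (mdeg t) (mon (Bmon vs) t \<cdot> \<eta>) (mon Fmon t \<cdot> \<eta>)"
proof -
  obtain p r c where t: "t = (p, r, c)" by (cases t) auto
  show ?thesis
  proof (cases "p \<le> r")
    case True
    then have "c \<le> p" using assms by (simp add: t allowed_def)
    then show ?thesis using True close_Bmon[of "p - c" r c vs N2]
      by (simp add: t mon_def mdeg_def of_nat_diff add.commute)
  next
    case False
    then have "c \<le> r" using assms by (simp add: t allowed_def)
    then show ?thesis using False close_Bmon[of "r - c" p c vs N1]
      by (simp add: t mon_def mdeg_def of_nat_diff add.commute)
  qed
qed

lemma wtv_mon: "wtv (\<lambda>k. int (M k) - int p * cartan k N1 - int r * cartan k N2) (mon Fmon (p, r, c) \<cdot> \<eta>)"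
  using wtv_T[where i = N2 and a = "int p - int c" and b = "int r" and c = "int c"]
    wtv_T[where i = N1 and a = "int r - int c" and b = "int p" and c = "int c"]
  by (auto simp: mon_def algebra_simps)

lemma mon_Fmon_independent_weight:
  assumes "finite C" "(\<Sum>c\<in>C. x c \<star> (mon Fmon (p, r, c) \<cdot> \<eta>)) = 0"
    and "\<And>c. c \<in> C \<Longrightarrow> allowed M (p, r, c)" "c \<in> C"
  shows "x c = 0"
proof -
  define i s b where "i = (if p \<le> r then N2 else N1)" and "s = min p r" and "b = max p r"
  have mon: "mon Fmon (p, r, c) = Fmon i (int s - int c) (int b) (int c)" for c
    by (auto simp: mon_def i_def s_def b_def)
  have al: "allowed M (p, r, c) \<longleftrightarrow> c \<le> s \<and> c \<le> M (tau i) \<and> b \<le> M i + c" for c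
    by (auto simp: allowed_def i_def s_def b_def)
  have "(\<Sum>c\<le>s. (if c \<in> C then x c else 0) \<star> T i (int s - int c) (int b) (int c)) =
      (\<Sum>c\<in>C. x c \<star> T i (int s - int c) (int b) (int c))"
    using assms(1,3) al by (intro sum.mono_neutral_cong_right) auto
  also have "\<dots> = 0" using assms(2) by (simp add: mon)
  finally have "(if c \<in> C then x c else 0) = 0"
    using assms(3)[OF assms(4)] al by (intro T_independent[of s b _ i]) (auto simp: s_def b_def)
  then show ?thesis using assms(4) by simp
qed

lemma mon_Fmon_independent_degree:
  assumes "finite I" "(\<Sum>t\<in>I. x t \<star> (mon Fmon t \<cdot> \<eta>)) \<in> Fl e"
    and "\<And>t. t \<in> I \<Longrightarrow> allowed M t \<and> mdeg t = e" "t \<in> I"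
  shows "x t = 0"
proof -
  obtain p0 r0 c0 where t: "t = (p0, r0, c0)" by (cases t) auto
  let ?w = "\<lambda>t. x t \<star> (mon Fmon t \<cdot> \<eta>)"
  have deg: "p + r = e" if "(p, r, c) \<in> I" for p r c
    using assms(3)[OF that] by (simp add: mdeg_def)
  have "KK12 \<cdot> ?w t = qq powi (M12 - int e) \<star> ?w t" if "t \<in> I" for t
  proof -
    obtain p r c where "t = (p, r, c)" by (cases t) auto
    then show ?thesis
      using deg[of p r c] that wtv_KK12[OF wtv_mon, of p r c] by (auto simp: cartan_def algebra_simps)
  qed
  then have "KK12 \<cdot> (\<Sum>t\<in>I. ?w t) = qq powi (M12 - int e) \<star> (\<Sum>t\<in>I. ?w t)"
    unfolding act_sum V.scale_sum_right by (intro sum.cong) auto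
  then have 0: "(\<Sum>t\<in>I. ?w t) = 0"
    by (rule Fl_high_degree[OF assms(2) _ order_refl])
  \<comment> \<open>The exponent of the eigenvalue of \<open>KK N1\<close>. Together with p + r = e
    it determines p and r, so a single weight can be split off.\<close>
  define g :: "nat \<times> nat \<times> nat \<Rightarrow> int" where "g = (\<lambda>(p, r, c). int (M N1) - 2 * int p + int r)"
  define I0 where "I0 = {k \<in> I. g k = g t}"
  have "(\<Sum>k\<in>I0. ?w k) = 0"
    unfolding I0_def
  proof (rule eigenvectors_separate[OF assms(1) _ 0, where Z = "KK N1"])
    fix k assume "k \<in> I"
    obtain p r c where "k = (p, r, c)" by (cases k) auto
    then show "KK N1 \<cdot> ?w k = qq powi g k \<star> ?w k"
      using wtv_KK[OF wtv_mon, of N1 p r c] by (auto simp: cartan_def g_def algebra_simps)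
  qed
  moreover define C where "C = {c. (p0, r0, c) \<in> I}"
  have I0: "I0 = (\<lambda>c. (p0, r0, c)) ` C"
  proof (intro equalityI subsetI)
    fix k assume k: "k \<in> I0"
    obtain p r c where kp: "k = (p, r, c)" by (cases k) auto
    have "p + r = p0 + r0" using deg[of p r c] deg[of p0 r0 c0] k assms(4) by (simp add: I0_def kp t)
    moreover have "r + 2 * p0 = r0 + 2 * p" using k by (simp add: I0_def kp t g_def)
    ultimately have "p = p0" "r = r0" by linarith+
    then show "k \<in> (\<lambda>c. (p0, r0, c)) ` C" using k by (auto simp: kp C_def I0_def)
  qed (auto simp: I0_def C_def t g_def)
  have "finite C"
    using assms(1) finite_vimageI[of I "\<lambda>c. (p0, r0, c)"] by (simp add: C_def inj_def vimage_def)
  moreover have "(\<Sum>k\<in>I0. ?w k) = (\<Sum>c\<in>C. x (p0, r0, c) \<star> (mon Fmon (p0, r0, c) \<cdot> \<eta>))"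
    unfolding I0 by (subst sum.reindex) (auto simp: inj_on_def)
  ultimately have "x (p0, r0, c0) = 0"
    using assms(3,4) mon_Fmon_independent_weight[of C "\<lambda>c. x (p0, r0, c)" p0 r0 c0] by (auto simp: C_def t)
  then show ?thesis by (simp add: t)
qed

text \<open>In a relation, the terms of maximal word length e may be replaced by monomials in the F,
  since all errors and all shorter terms fall into \<open>Fl e\<close>. Independence in that one
  length then contradicts maximality.\<close>

lemma mon_Bmon_independent:
  assumes "finite I" "(\<Sum>t\<in>I. x t \<star> (mon (Bmon vs) t \<cdot> \<eta>)) = 0"
    and "\<And>t. t \<in> I \<Longrightarrow> allowed M t" "t \<in> I"
  shows "x t = 0"
proof (rule ccontr)
  assume "x t \<noteq> 0"
  define J where "J = {t\<in>I. x t \<noteq> 0}"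
  have J: "finite J" "t \<in> J" using assms(1,4) \<open>x t \<noteq> 0\<close> by (simp_all add: J_def)
  define e where "e = Max (mdeg ` J)"
  define J1 where "J1 = {t\<in>J. mdeg t = e}"
  have "e \<in> mdeg ` J" unfolding e_def using J by (intro Max_in) auto
  then obtain u where u: "u \<in> J1" by (auto simp: J1_def)
  let ?B = "\<lambda>t. x t \<star> (mon (Bmon vs) t \<cdot> \<eta>)" and ?F = "\<lambda>t. x t \<star> (mon Fmon t \<cdot> \<eta>)"
  have "sum ?B I = sum ?B J"
    by (rule sum.mono_neutral_right) (auto simp: J_def assms(1))
  then have "sum ?B (J - J1) + sum ?B J1 = 0"
    using assms(2) sum.subset_diff[of J1 J ?B] J by (auto simp: J1_def)
  then have 1: "sum ?B J1 = - sum ?B (J - J1)"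
    by (rule minus_unique[symmetric])
  have "sum ?B (J - J1) \<in> Fl e"
  proof (intro Fl_sum Fl_sc)
    fix k assume k: "k \<in> J - J1"
    then have "mdeg k \<noteq> e" "mdeg k \<le> e" using J by (auto simp: J1_def e_def)
    moreover have "mon (Bmon vs) k \<cdot> \<eta> \<in> Fl (Suc (mdeg k))"
      using close_mon[of k vs] assms(3) k by (auto simp: close_def J_def)
    ultimately show "mon (Bmon vs) k \<cdot> \<eta> \<in> Fl e" by (metis Fl_mono Suc_leI le_neq_implies_less)
  qed
  moreover have "sum (\<lambda>t. ?B t - ?F t) J1 \<in> Fl e"
  proof (intro Fl_sum)
    fix k assume k: "k \<in> J1"
    then have "mon (Bmon vs) k \<cdot> \<eta> - mon Fmon k \<cdot> \<eta> \<in> Fl e"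
      using close_mon[of k vs] assms(3) by (auto simp: close_def J1_def J_def)
    then show "?B k - ?F k \<in> Fl e" by (simp only: Fl_sc flip: sc_distrib)
  qed
  ultimately have "- sum ?B (J - J1) - sum (\<lambda>t. ?B t - ?F t) J1 \<in> Fl e"
    by (intro Fl_diff Fl_minus)
  then have "sum ?F J1 \<in> Fl e"
    unfolding sum_subtractf 1 by simp
  then have "x u = 0"
    by (rule mon_Fmon_independent_degree[rotated]) (use assms(1,3) u in \<open>auto simp: J1_def J_def\<close>)
  then show False using u by (simp add: J1_def J_def)
qed

end

section \<open>A module with a highest weight vector\<close>

text \<open>\<open>gact\<close> describes the Verma module in the basis \<open>F\<^sub>1\<^sup>a (F\<^sub>2 F\<^sub>1 - q F\<^sub>1 F\<^sub>2)\<^sup>b F\<^sub>2\<^sup>c v\<close> on coefficient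
  functions; the formulas satisfy the relations for all integers \<open>a\<close>, \<open>b\<close>, \<open>c\<close>, which avoids boundary
  cases.\<close>

type_synonym vfun = "int \<Rightarrow> int \<Rightarrow> int \<Rightarrow> Qq"

fun gact :: "int \<Rightarrow> int \<Rightarrow> gen \<Rightarrow> vfun \<Rightarrow> vfun" where
  "gact m n (gF N1) f = (\<lambda>a b c. f (a - 1) b c)"
| "gact m n (gF N2) f = (\<lambda>a b c. qq powi (a - b) * f a b (c - 1) + qnum (a + 1) * f (a + 1) (b - 1) c)"
| "gact m n (gE N1) f = (\<lambda>a b c. qnum (a + 1) * qnum (m - b + c - a) * f (a + 1) b c
      - qq powi (m - b + c) * qnum (b + 1) * f a (b + 1) (c - 1))"
| "gact m n (gE N2) f = (\<lambda>a b c. qnum (c + 1) * qnum (n - c) * f a b (c + 1)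
      + qq powi (2 * c - n) * qnum (b + 1) * f (a - 1) (b + 1) c)"
| "gact m n (gK N1) f = (\<lambda>a b c. qq powi (m - 2 * a - b + c) * f a b c)"
| "gact m n (gK N2) f = (\<lambda>a b c. qq powi (n + a - b - 2 * c) * f a b c)"
| "gact m n (gKinv N1) f = (\<lambda>a b c. qq powi (- (m - 2 * a - b + c)) * f a b c)"
| "gact m n (gKinv N2) f = (\<lambda>a b c. qq powi (- (n + a - b - 2 * c)) * f a b c)"

primrec trep :: "int \<Rightarrow> int \<Rightarrow> trm \<Rightarrow> vfun \<Rightarrow> vfun" where
  "trep m n (Gen g) = gact m n g"
| "trep m n (Scal d) = (\<lambda>f a b c. d * f a b c)"
| "trep m n (x \<boxplus> y) = (\<lambda>f a b c. trep m n x f a b c + trep m n y f a b c)"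
| "trep m n (x \<boxtimes> y) = (\<lambda>f. trep m n x (trep m n y f))"

lemma gact_add: "gact m n g (\<lambda>a b c. f a b c + h a b c) = (\<lambda>a b c. gact m n g f a b c + gact m n g h a b c)"
  by (induction m n g f rule: gact.induct) (auto simp: fun_eq_iff algebra_simps)

lemma gact_mult: "gact m n g (\<lambda>a b c. d * f a b c) = (\<lambda>a b c. d * gact m n g f a b c)"
  by (induction m n g f rule: gact.induct) (auto simp: fun_eq_iff algebra_simps)

lemma trep_add: "trep m n t (\<lambda>a b c. f a b c + h a b c) = (\<lambda>a b c. trep m n t f a b c + trep m n t h a b c)"
  by (induction t arbitrary: f h) (simp_all add: gact_add algebra_simps)

lemma trep_mult: "trep m n t (\<lambda>a b c. d * f a b c) = (\<lambda>a b c. d * trep m n t f a b c)"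
  by (induction t arbitrary: f) (simp_all add: gact_mult algebra_simps)

text \<open>Kept as an opaque symbol, so that identities between quantum integers become polynomial
  identities in powers of \<open>qq\<close>.\<close>

definition Dq :: Qq where
  "Dq = inverse (qq - inverse qq)"

lemma qnum_split: "qnum r = (qq powi r - 1 / qq powi r) * Dq"
  by (simp add: qnum_def power_int_minus divide_inverse Dq_def)

lemmas laurent = qnum_split qq_powi_split power_int_minus inverse_eq_divide power_int_mult

lemma trep_EF_same: "trep m n ((tE i \<boxtimes> tF i) \<boxminus> (tF i \<boxtimes> tE i)) f a b c =
    trep m n (Scal (inverse (qq - inverse qq)) \<boxtimes> (tK i \<boxminus> tKinv i)) f a b c"
proof (cases i)
  case N1
  have "trep m n (Scal (inverse (qq - inverse qq)) \<boxtimes> (tK i \<boxminus> tKinv i)) f a b c =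
      qnum ((m - b + c - a) - a) * f a b c"
    by (simp add: N1 qnum_def divide_inverse algebra_simps)
  moreover have "trep m n ((tE i \<boxtimes> tF i) \<boxminus> (tF i \<boxtimes> tE i)) f a b c =
      (qnum (a + 1) * qnum (m - b + c - a) - qnum (m - b + c - a + 1) * qnum a) * f a b c"
    by (simp add: N1 algebra_simps)
  ultimately show ?thesis unfolding qnum_cross by simp
next
  case N2
  \<comment> \<open>The splitting separates the two ways in which E_2 F_2 and F_2 E_2 return to the
    same basis vector: by changing c, and by trading a against b.\<close>
  have "qnum (n + a - b - 2 * c) = qnum ((n - c - c) + (a - b))"
    by (simp add: algebra_simps)
  also have "\<dots> = qq powi (a - b) * (qnum (c + 1) * qnum (n - c) - qnum (n - c + 1) * qnum c)
      + qq powi (- (n - c - c)) * (qnum (b + 1) * qnum a - qnum (a + 1) * qnum b)"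
    unfolding qnum_add_right[of "n - c - c"] by (simp add: qnum_cross)
  finally have "qnum (n + a - b - 2 * c) * f a b c =
     (qq powi (a - b) * (qnum (c + 1) * qnum (n - c) - qnum (n - c + 1) * qnum c)
      + qq powi (- (n - c - c)) * (qnum (b + 1) * qnum a - qnum (a + 1) * qnum b)) * f a b c"
    by simp
  moreover have "trep m n (Scal (inverse (qq - inverse qq)) \<boxtimes> (tK i \<boxminus> tKinv i)) f a b c = qnum (n + a - b - 2 * c) * f a b c"
    by (simp add: N2 qnum_def divide_inverse algebra_simps)
  moreover have "trep m n ((tE i \<boxtimes> tF i) \<boxminus> (tF i \<boxtimes> tE i)) f a b c =
     (qq powi (a - b) * (qnum (c + 1) * qnum (n - c) - qnum (n - c + 1) * qnum c)
      + qq powi (- (n - c - c)) * (qnum (b + 1) * qnum a - qnum (a + 1) * qnum b)) * f a b c"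
  proof -
    have "qq powi (a - (b + 2)) * qq powi (c * 2 - n) = qq powi (a - b) * qq powi (c * 2 - (n + 2))"
      by (simp add: algebra_simps flip: power_int_add)
    then show ?thesis by (simp add: N2 algebra_simps)
  qed
  ultimately show ?thesis by (simp only:)
qed

lemma trep_EF_diff:
  assumes "i \<noteq> j"
  shows "trep m n ((tE i \<boxtimes> tF j) \<boxminus> (tF j \<boxtimes> tE i)) f a b c = 0"
proof (cases i)
  case N1
  then have "j = N2" using assms by (cases j) auto
  then show ?thesis
    by (simp add: N1 algebra_simps) (simp add: laurent, simp add: divide_simps, simp add: algebra_simps power2_eq_square)
next
  case N2
  then have "j = N1" using assms by (cases j) auto
  then show ?thesis by (simp add: N2 algebra_simps)
qed

lemma trep_Serre_F:
  assumes "i \<noteq> j"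
  shows "trep m n (tF j \<boxtimes> (tF i \<boxtimes> tF i)) f a b c + trep m n ((tF i \<boxtimes> tF i) \<boxtimes> tF j) f a b c =
    (qq + 1 / qq) * trep m n (tF i \<boxtimes> tF j \<boxtimes> tF i) f a b c"
  using assms
  by (cases i; cases j; simp add: algebra_simps)
   (simp add: laurent, simp add: divide_simps, simp add: algebra_simps power2_eq_square)+

text \<open>Two paths lead to the middle shift and combine by [2][H - 1] = [H] + [H - 2]. Having the
  square in closed form keeps the Serre expressions short.\<close>

lemma E1_E1:
  fixes f m a b c
  defines "H \<equiv> m - b + c - a"
  shows "gact m n (gE N1) (gact m n (gE N1) f) a b c =
     qnum (a + 1) * qnum (a + 2) * qnum H * qnum (H - 1) * f (a + 2) b c
   - qnum 2 * qnum (a + 1) * qnum (H - 1) * (qq powi (m - b + c) * qnum (b + 1)) * f (a + 1) (b + 1) (c - 1)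
   + qq powi (2 * m - 2 * b + 2 * c - 2) * qnum (b + 1) * qnum (b + 2) * f a (b + 2) (c - 2)"
proof -
  have 1: "qnum 2 * qnum (H - 1) = qnum H + qnum (H - 2)" using qnum_2_mult[of "H - 1"] by simp
  have 2: "qq powi (2 * m - 2 * b + 2 * c - 2) = qq powi (m - b + c) * qq powi (m - (b + 1) + (c - 1))"
    by (simp flip: power_int_add)
  have "qnum 2 * qnum (a + 1) * qnum (H - 1) * X = (qnum H + qnum (H - 2)) * qnum (a + 1) * X" for X
    unfolding 1[symmetric] by (simp add: mult_ac)
  from this[of "qq powi (m - b + c) * qnum (b + 1) * f (a + 1) (b + 1) (c - 1)"] show ?thesis
    unfolding 2 by (simp add: H_def algebra_simps)
qed

lemma E2_E2:
  "gact m n (gE N2) (gact m n (gE N2) f) a b c =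
     qnum (c + 1) * qnum (n - c) * qnum (c + 2) * qnum (n - c - 1) * f a b (c + 2)
   + qnum 2 * qq powi (2 * c - n + 1) * qnum (b + 1) * qnum (c + 1) * qnum (n - c) * f (a - 1) (b + 1) (c + 1)
   + qq powi (4 * c - 2 * n) * qnum (b + 1) * qnum (b + 2) * f (a - 2) (b + 2) c"
proof -
  have 1: "qnum 2 * qq powi (2 * c - n + 1) = qq powi (2 * (c + 1) - n) + qq powi (2 * c - n)"
  proof -
    have "qq powi (2 * (c + 1) - n) = qq powi (2 * c - n + 1) * qq powi 1"
      by (simp only: power_int_add[OF disjI1[OF qq_nonzero], symmetric]) (simp add: algebra_simps)
    moreover have "qq powi (2 * c - n) = qq powi (2 * c - n + 1) * qq powi (- 1)"
      by (simp only: power_int_add[OF disjI1[OF qq_nonzero], symmetric]) simp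
    ultimately show ?thesis by (simp add: qnum_2 power_int_minus algebra_simps)
  qed
  have 2: "qq powi (4 * c - 2 * n) = qq powi (2 * c - n) * qq powi (2 * c - n)"
    by (simp flip: power_int_add)
  show ?thesis unfolding 1 2 by (simp add: algebra_simps)
qed

lemma qq_powi_merge:
  "qq powi x * qq powi y = qq powi (x + y)" "qq powi x * (qq powi y * z) = qq powi (x + y) * z"
  by (simp_all add: power_int_add)

lemma qnum_2': "qnum 2 = qq powi 1 + qq powi (- 1)"
  by (simp add: qnum_2 power_int_minus)

lemma qnum_expand: "qnum x = qq powi x * Dq - qq powi (- x) * Dq"
  by (simp add: qnum_def divide_inverse Dq_def ring_distribs)

lemma Dq_commute: "Dq * qq powi y = qq powi y * Dq" "Dq * (qq powi y * z) = qq powi y * (Dq * z)"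
  by (simp_all add: mult_ac)

lemmas laurent_expand = qnum_expand ring_distribs mult.assoc Dq_commute qq_powi_merge
  mult_minus_left mult_minus_right minus_minus

text \<open>All three products expand in the same four shifts of f. Once products of powers of q are
  merged, each of the four coefficient identities holds monomial by monomial.\<close>

lemma gact_Serre_12:
  fixes f :: vfun and a b c m n :: int
  defines "H \<equiv> m - b + c - a"
  shows "gact m n (gE N2) (gact m n (gE N1) (gact m n (gE N1) f)) a b c + gact m n (gE N1) (gact m n (gE N1) (gact m n (gE N2) f)) a b c =
    qnum 2 * gact m n (gE N1) (gact m n (gE N2) (gact m n (gE N1) f)) a b c"
proof -
  have A: "gact m n (gE N2) (gact m n (gE N1) (gact m n (gE N1) f)) a b c =
      qnum (c+1)*qnum (n-c)*(qnum (a+1)*qnum (a+2)*qnum (H+1)*qnum (H)) * f (a + 2) b (c + 1)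
      + (-(qnum (c+1)*qnum (n-c)*(qnum (2)*qnum (a+1)*qnum (H)*(qq powi (m-b+c+1)*qnum (b+1))))+qq powi (2 * c-n)*qnum (b+1)*(qnum (a)*qnum (a+1)*qnum (H)*qnum (H-1))) * f (a + 1) (b + 1) c
      + (qnum (c+1)*qnum (n-c)*(qq powi (2 * m-2 * b+2 * c)*qnum (b+1)*qnum (b+2))-qq powi (2 * c-n)*qnum (b+1)*(qnum (2)*qnum (a)*qnum (H-1)*(qq powi (m-b-1+c)*qnum (b+2)))) * f a (b + 2) (c - 1)
      + qq powi (2 * c-n)*qnum (b+1)*(qq powi (2 * m-2 * b+2 * c-4)*qnum (b+2)*qnum (b+3)) * f (a - 1) (b + 3) (c - 2)"
    unfolding gact.simps(4)[of m n "gact m n (gE N1) (gact m n (gE N1) f)"] E1_E1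
    by (simp add: H_def algebra_simps)
  have B: "gact m n (gE N1) (gact m n (gE N1) (gact m n (gE N2) f)) a b c =
      qnum (a+1)*qnum (a+2)*qnum (H)*qnum (H-1)*(qnum (c+1)*qnum (n-c)) * f (a + 2) b (c + 1)
      + (qnum (a+1)*qnum (a+2)*qnum (H)*qnum (H-1)*(qq powi (2 * c-n)*qnum (b+1))-qnum (2)*qnum (a+1)*qnum (H-1)*(qq powi (m-b+c)*qnum (b+1))*(qnum (c)*qnum (n-c+1))) * f (a + 1) (b + 1) c
      + (-(qnum (2)*qnum (a+1)*qnum (H-1)*(qq powi (m-b+c)*qnum (b+1))*(qq powi (2 * c-2-n)*qnum (b+2)))+qq powi (2 * m-2 * b+2 * c-2)*qnum (b+1)*qnum (b+2)*(qnum (c-1)*qnum (n-c+2))) * f a (b + 2) (c - 1)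
      + qq powi (2 * m-2 * b+2 * c-2)*qnum (b+1)*qnum (b+2)*(qq powi (2 * c-4-n)*qnum (b+3)) * f (a - 1) (b + 3) (c - 2)"
    unfolding E1_E1 by (simp add: H_def algebra_simps)
  have C: "gact m n (gE N1) (gact m n (gE N2) (gact m n (gE N1) f)) a b c =
      qnum (a+1)*qnum (H)*(qnum (c+1)*qnum (n-c)*(qnum (a+2)*qnum (H))) * f (a + 2) b (c + 1)
      + (qnum (a+1)*qnum (H)*(-(qnum (c+1)*qnum (n-c)*(qq powi (m-b+c+1)*qnum (b+1)))+qq powi (2 * c-n)*qnum (b+1)*(qnum (a+1)*qnum (H-1)))-qq powi (m-b+c)*qnum (b+1)*(qnum (c)*qnum (n-c+1)*(qnum (a+1)*qnum (H-1)))) * f (a + 1) (b + 1) c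
      + (-(qnum (a+1)*qnum (H)*(qq powi (2 * c-n)*qnum (b+1)*(qq powi (m-b-1+c)*qnum (b+2))))-qq powi (m-b+c)*qnum (b+1)*(-(qnum (c)*qnum (n-c+1)*(qq powi (m-b-1+c)*qnum (b+2)))+qq powi (2 * c-2-n)*qnum (b+2)*(qnum (a)*qnum (H-2)))) * f a (b + 2) (c - 1)
      + qq powi (m-b+c)*qnum (b+1)*(qq powi (2 * c-2-n)*qnum (b+2)*(qq powi (m-b-3+c)*qnum (b+3))) * f (a - 1) (b + 3) (c - 2)"
    by (simp add: H_def algebra_simps)
  have c1: "qnum (c+1)*qnum (n-c)*(qnum (a+1)*qnum (a+2)*qnum (H+1)*qnum (H))
      + qnum (a+1)*qnum (a+2)*qnum (H)*qnum (H-1)*(qnum (c+1)*qnum (n-c)) = qnum 2 * (qnum (a+1)*qnum (H)*(qnum (c+1)*qnum (n-c)*(qnum (a+2)*qnum (H))))"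
    unfolding H_def qnum_2'
    by (simp only: laurent_expand) (simp add: algebra_simps)
  have c2: "(-(qnum (c+1)*qnum (n-c)*(qnum (2)*qnum (a+1)*qnum (H)*(qq powi (m-b+c+1)*qnum (b+1))))+qq powi (2 * c-n)*qnum (b+1)*(qnum (a)*qnum (a+1)*qnum (H)*qnum (H-1)))
      + (qnum (a+1)*qnum (a+2)*qnum (H)*qnum (H-1)*(qq powi (2 * c-n)*qnum (b+1))-qnum (2)*qnum (a+1)*qnum (H-1)*(qq powi (m-b+c)*qnum (b+1))*(qnum (c)*qnum (n-c+1))) = qnum 2 * ((qnum (a+1)*qnum (H)*(-(qnum (c+1)*qnum (n-c)*(qq powi (m-b+c+1)*qnum (b+1)))+qq powi (2 * c-n)*qnum (b+1)*(qnum (a+1)*qnum (H-1)))-qq powi (m-b+c)*qnum (b+1)*(qnum (c)*qnum (n-c+1)*(qnum (a+1)*qnum (H-1)))))"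
    unfolding H_def qnum_2'
    by (simp only: laurent_expand) (simp add: algebra_simps)
  have c3: "(qnum (c+1)*qnum (n-c)*(qq powi (2 * m-2 * b+2 * c)*qnum (b+1)*qnum (b+2))-qq powi (2 * c-n)*qnum (b+1)*(qnum (2)*qnum (a)*qnum (H-1)*(qq powi (m-b-1+c)*qnum (b+2))))
      + (-(qnum (2)*qnum (a+1)*qnum (H-1)*(qq powi (m-b+c)*qnum (b+1))*(qq powi (2 * c-2-n)*qnum (b+2)))+qq powi (2 * m-2 * b+2 * c-2)*qnum (b+1)*qnum (b+2)*(qnum (c-1)*qnum (n-c+2))) = qnum 2 * ((-(qnum (a+1)*qnum (H)*(qq powi (2 * c-n)*qnum (b+1)*(qq powi (m-b-1+c)*qnum (b+2))))-qq powi (m-b+c)*qnum (b+1)*(-(qnum (c)*qnum (n-c+1)*(qq powi (m-b-1+c)*qnum (b+2)))+qq powi (2 * c-2-n)*qnum (b+2)*(qnum (a)*qnum (H-2)))))"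
    unfolding H_def qnum_2'
    by (simp only: laurent_expand) (simp add: algebra_simps)
  have c4: "qq powi (2 * c-n)*qnum (b+1)*(qq powi (2 * m-2 * b+2 * c-4)*qnum (b+2)*qnum (b+3))
      + qq powi (2 * m-2 * b+2 * c-2)*qnum (b+1)*qnum (b+2)*(qq powi (2 * c-4-n)*qnum (b+3)) = qnum 2 * (qq powi (m-b+c)*qnum (b+1)*(qq powi (2 * c-2-n)*qnum (b+2)*(qq powi (m-b-3+c)*qnum (b+3))))"
    unfolding H_def qnum_2'
    by (simp only: laurent_expand) (simp add: algebra_simps)
  have *: "x1 * f1 + x2 * f2 + x3 * f3 + x4 * f4 + (y1 * f1 + y2 * f2 + y3 * f3 + y4 * f4) =
      qnum 2 * (z1 * f1 + z2 * f2 + z3 * f3 + z4 * f4)"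
    if "x1 + y1 = qnum 2 * z1" "x2 + y2 = qnum 2 * z2" "x3 + y3 = qnum 2 * z3" "x4 + y4 = qnum 2 * z4"
    for x1 x2 x3 x4 y1 y2 y3 y4 z1 z2 z3 z4 f1 f2 f3 f4
  proof -
    have "x1 * f1 + x2 * f2 + x3 * f3 + x4 * f4 + (y1 * f1 + y2 * f2 + y3 * f3 + y4 * f4) =
      (x1 + y1) * f1 + (x2 + y2) * f2 + (x3 + y3) * f3 + (x4 + y4) * f4" by (simp add: algebra_simps)
    then show ?thesis unfolding that by (simp add: algebra_simps)
  qed
  show ?thesis unfolding A B C by (rule *[OF c1 c2 c3 c4])
qed

lemma gact_Serre_21:
  fixes f :: vfun and a b c m n :: int
  defines "H \<equiv> m - b + c - a"
  shows "gact m n (gE N1) (gact m n (gE N2) (gact m n (gE N2) f)) a b c + gact m n (gE N2) (gact m n (gE N2) (gact m n (gE N1) f)) a b c =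
    qnum 2 * gact m n (gE N2) (gact m n (gE N1) (gact m n (gE N2) f)) a b c"
proof -
  have A: "gact m n (gE N1) (gact m n (gE N2) (gact m n (gE N2) f)) a b c =
      qnum (a+1)*qnum (H)*(qnum (c+1)*qnum (n-c)*qnum (c+2)*qnum (n-c-1)) * f (a + 1) b (c + 2)
      + (qnum (a+1)*qnum (H)*(qnum (2)*qq powi (2 * c-n+1)*qnum (b+1)*qnum (c+1)*qnum (n-c))-qq powi (m-b+c)*qnum (b+1)*(qnum (c)*qnum (n-c+1)*qnum (c+1)*qnum (n-c))) * f a (b + 1) (c + 1)
      + (qnum (a+1)*qnum (H)*(qq powi (4 * c-2 * n)*qnum (b+1)*qnum (b+2))-qq powi (m-b+c)*qnum (b+1)*(qnum (2)*qq powi (2 * c-1-n)*qnum (b+2)*qnum (c)*qnum (n-c+1))) * f (a - 1) (b + 2) c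
      + (-(qq powi (m-b+c)*qnum (b+1)*(qq powi (4 * c-4-2 * n)*qnum (b+2)*qnum (b+3)))) * f (a - 2) (b + 3) (c - 1)"
    unfolding gact.simps(3)[of m n "gact m n (gE N2) (gact m n (gE N2) f)"] E2_E2
    by (simp add: H_def algebra_simps)
  have B: "gact m n (gE N2) (gact m n (gE N2) (gact m n (gE N1) f)) a b c =
      qnum (c+1)*qnum (n-c)*qnum (c+2)*qnum (n-c-1)*(qnum (a+1)*qnum (H+2)) * f (a + 1) b (c + 2)
      + (-(qnum (c+1)*qnum (n-c)*qnum (c+2)*qnum (n-c-1)*(qq powi (m-b+c+2)*qnum (b+1)))+qnum (2)*qq powi (2 * c-n+1)*qnum (b+1)*qnum (c+1)*qnum (n-c)*(qnum (a)*qnum (H+1))) * f a (b + 1) (c + 1)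
      + (-(qnum (2)*qq powi (2 * c-n+1)*qnum (b+1)*qnum (c+1)*qnum (n-c)*(qq powi (m-b+c)*qnum (b+2)))+qq powi (4 * c-2 * n)*qnum (b+1)*qnum (b+2)*(qnum (a-1)*qnum (H))) * f (a - 1) (b + 2) c
      + (-(qq powi (4 * c-2 * n)*qnum (b+1)*qnum (b+2)*(qq powi (m-b-2+c)*qnum (b+3)))) * f (a - 2) (b + 3) (c - 1)"
    unfolding E2_E2 by (simp add: H_def algebra_simps)
  have C: "gact m n (gE N2) (gact m n (gE N1) (gact m n (gE N2) f)) a b c =
      qnum (c+1)*qnum (n-c)*(qnum (a+1)*qnum (H+1)*(qnum (c+2)*qnum (n-c-1))) * f (a + 1) b (c + 2)
      + (qnum (c+1)*qnum (n-c)*(qnum (a+1)*qnum (H+1)*(qq powi (2 * c+2-n)*qnum (b+1))-qq powi (m-b+c+1)*qnum (b+1)*(qnum (c+1)*qnum (n-c)))+qq powi (2 * c-n)*qnum (b+1)*(qnum (a)*qnum (H)*(qnum (c+1)*qnum (n-c)))) * f a (b + 1) (c + 1)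
      + (-(qnum (c+1)*qnum (n-c)*(qq powi (m-b+c+1)*qnum (b+1)*(qq powi (2 * c-n)*qnum (b+2))))+qq powi (2 * c-n)*qnum (b+1)*(qnum (a)*qnum (H)*(qq powi (2 * c-n)*qnum (b+2))-qq powi (m-b-1+c)*qnum (b+2)*(qnum (c)*qnum (n-c+1)))) * f (a - 1) (b + 2) c
      + (-(qq powi (2 * c-n)*qnum (b+1)*(qq powi (m-b-1+c)*qnum (b+2)*(qq powi (2 * c-2-n)*qnum (b+3))))) * f (a - 2) (b + 3) (c - 1)"
    by (simp add: H_def algebra_simps)
  have c1: "qnum (a+1)*qnum (H)*(qnum (c+1)*qnum (n-c)*qnum (c+2)*qnum (n-c-1))
      + qnum (c+1)*qnum (n-c)*qnum (c+2)*qnum (n-c-1)*(qnum (a+1)*qnum (H+2)) = qnum 2 * (qnum (c+1)*qnum (n-c)*(qnum (a+1)*qnum (H+1)*(qnum (c+2)*qnum (n-c-1))))"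
    unfolding H_def qnum_2'
    by (simp only: laurent_expand) (simp add: algebra_simps)
  have c2: "(qnum (a+1)*qnum (H)*(qnum (2)*qq powi (2 * c-n+1)*qnum (b+1)*qnum (c+1)*qnum (n-c))-qq powi (m-b+c)*qnum (b+1)*(qnum (c)*qnum (n-c+1)*qnum (c+1)*qnum (n-c)))
      + (-(qnum (c+1)*qnum (n-c)*qnum (c+2)*qnum (n-c-1)*(qq powi (m-b+c+2)*qnum (b+1)))+qnum (2)*qq powi (2 * c-n+1)*qnum (b+1)*qnum (c+1)*qnum (n-c)*(qnum (a)*qnum (H+1))) = qnum 2 * ((qnum (c+1)*qnum (n-c)*(qnum (a+1)*qnum (H+1)*(qq powi (2 * c+2-n)*qnum (b+1))-qq powi (m-b+c+1)*qnum (b+1)*(qnum (c+1)*qnum (n-c)))+qq powi (2 * c-n)*qnum (b+1)*(qnum (a)*qnum (H)*(qnum (c+1)*qnum (n-c)))))"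
    unfolding H_def qnum_2'
    by (simp only: laurent_expand) (simp add: algebra_simps)
  have c3: "(qnum (a+1)*qnum (H)*(qq powi (4 * c-2 * n)*qnum (b+1)*qnum (b+2))-qq powi (m-b+c)*qnum (b+1)*(qnum (2)*qq powi (2 * c-1-n)*qnum (b+2)*qnum (c)*qnum (n-c+1)))
      + (-(qnum (2)*qq powi (2 * c-n+1)*qnum (b+1)*qnum (c+1)*qnum (n-c)*(qq powi (m-b+c)*qnum (b+2)))+qq powi (4 * c-2 * n)*qnum (b+1)*qnum (b+2)*(qnum (a-1)*qnum (H))) = qnum 2 * ((-(qnum (c+1)*qnum (n-c)*(qq powi (m-b+c+1)*qnum (b+1)*(qq powi (2 * c-n)*qnum (b+2))))+qq powi (2 * c-n)*qnum (b+1)*(qnum (a)*qnum (H)*(qq powi (2 * c-n)*qnum (b+2))-qq powi (m-b-1+c)*qnum (b+2)*(qnum (c)*qnum (n-c+1)))))"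
    unfolding H_def qnum_2'
    by (simp only: laurent_expand) (simp add: algebra_simps)
  have c4: "(-(qq powi (m-b+c)*qnum (b+1)*(qq powi (4 * c-4-2 * n)*qnum (b+2)*qnum (b+3))))
      + (-(qq powi (4 * c-2 * n)*qnum (b+1)*qnum (b+2)*(qq powi (m-b-2+c)*qnum (b+3)))) = qnum 2 * ((-(qq powi (2 * c-n)*qnum (b+1)*(qq powi (m-b-1+c)*qnum (b+2)*(qq powi (2 * c-2-n)*qnum (b+3))))))"
    unfolding H_def qnum_2'
    by (simp only: laurent_expand) (simp add: algebra_simps)
  have *: "x1 * f1 + x2 * f2 + x3 * f3 + x4 * f4 + (y1 * f1 + y2 * f2 + y3 * f3 + y4 * f4) =
      qnum 2 * (z1 * f1 + z2 * f2 + z3 * f3 + z4 * f4)"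
    if "x1 + y1 = qnum 2 * z1" "x2 + y2 = qnum 2 * z2" "x3 + y3 = qnum 2 * z3" "x4 + y4 = qnum 2 * z4"
    for x1 x2 x3 x4 y1 y2 y3 y4 z1 z2 z3 z4 f1 f2 f3 f4
  proof -
    have "x1 * f1 + x2 * f2 + x3 * f3 + x4 * f4 + (y1 * f1 + y2 * f2 + y3 * f3 + y4 * f4) =
      (x1 + y1) * f1 + (x2 + y2) * f2 + (x3 + y3) * f3 + (x4 + y4) * f4" by (simp add: algebra_simps)
    then show ?thesis unfolding that by (simp add: algebra_simps)
  qed
  show ?thesis unfolding A B C by (rule *[OF c1 c2 c3 c4])
qed

lemma trep_Serre:
  assumes "\<And>a b c. gact m n y (gact m n x (gact m n x f)) a b c + gact m n x (gact m n x (gact m n y f)) a b c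
     = qnum 2 * gact m n x (gact m n y (gact m n x f)) a b c"
  shows "trep m n (((Gen y \<boxtimes> tdp2 (Gen x)) \<boxminus> (Gen x \<boxtimes> Gen y \<boxtimes> Gen x)) \<boxplus> (tdp2 (Gen x) \<boxtimes> Gen y)) f =
    (\<lambda>a b c. 0)"
proof (intro ext)
  fix a b c
  have q2: "qfact 2 = qnum 2" using qfact_Suc[of 1] qfact_Suc[of 0] by (simp add: numeral_2_eq_2)
  have "trep m n (((Gen y \<boxtimes> tdp2 (Gen x)) \<boxminus> (Gen x \<boxtimes> Gen y \<boxtimes> Gen x)) \<boxplus> (tdp2 (Gen x) \<boxtimes> Gen y)) f a b c =
    inverse (qnum 2) * (gact m n y (gact m n x (gact m n x f)) a b c + gact m n x (gact m n x (gact m n y f)) a b c)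
    - gact m n x (gact m n y (gact m n x f)) a b c"
    by (simp add: q2 gact_mult algebra_simps)
  also have "\<dots> = 0"
    unfolding assms by simp
  finally show "trep m n (((Gen y \<boxtimes> tdp2 (Gen x)) \<boxminus> (Gen x \<boxtimes> Gen y \<boxtimes> Gen x)) \<boxplus> (tdp2 (Gen x) \<boxtimes> Gen y)) f a b c = 0" .
qed

lemma gact_K_conj:
  "gact m n (gK i) (gact m n (gE j) (gact m n (gKinv i) f)) = (\<lambda>a b c. qq powi cartan i j * gact m n (gE j) f a b c)"
  "gact m n (gK i) (gact m n (gF j) (gact m n (gKinv i) f)) = (\<lambda>a b c. qq powi (- cartan i j) * gact m n (gF j) f a b c)"
  by (intro ext; cases i; cases j; simp add: cartan_def algebra_simps; simp add: laurent; simp add: divide_simps; simp add: algebra_simps power2_eq_square)+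

lemma trep_cong: "ueq x y \<Longrightarrow> trep m n x = trep m n y"
proof (induction rule: ueq.induct)
  case (E_F_same i)
  then show ?case using trep_EF_same by (intro ext) blast
next
  case (E_F_diff i j)
  then show ?case using trep_EF_diff by (intro ext) simp
next
  case (Serre_E i j)
  have "gact m n (gE j) (gact m n (gE i) (gact m n (gE i) f)) a b c +
        gact m n (gE i) (gact m n (gE i) (gact m n (gE j) f)) a b c
      = qnum 2 * gact m n (gE i) (gact m n (gE j) (gact m n (gE i) f)) a b c" for f a b c
    using Serre_E by (cases i; cases j) (simp_all only: gact_Serre_12 gact_Serre_21 simp_thms)
  from trep_Serre[OF this] show ?case by (intro ext) simp
next
  case (Serre_F i j)
  have "gact m n (gF j) (gact m n (gF i) (gact m n (gF i) f)) a b c +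
        gact m n (gF i) (gact m n (gF i) (gact m n (gF j) f)) a b c
      = qnum 2 * gact m n (gF i) (gact m n (gF j) (gact m n (gF i) f)) a b c" for f a b c
    using trep_Serre_F[OF Serre_F, of m n f a b c] by (simp add: qnum_2 inverse_eq_divide)
  from trep_Serre[OF this] show ?case by (intro ext) simp
next
  case (K_E i j)
  then show ?case by (simp add: gact_K_conj)
next
  case (K_F i j)
  then show ?case by (simp add: gact_K_conj)
next
  case (K_Kinv i)
  then show ?case by (intro ext) (cases i; simp add: algebra_simps flip: power_int_add)
next
  case (Kinv_K i)
  then show ?case by (intro ext) (cases i; simp add: algebra_simps flip: power_int_add)
next
  case (K_K i j)
  then show ?case by (intro ext) (cases i; cases j; simp add: algebra_simps)
next
  case (times_cong x x' y y')
  then show ?case by simp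
next
  case (plus_cong x x' y y')
  then show ?case by simp
qed (auto simp: fun_eq_iff trep_add trep_mult algebra_simps)

section \<open>The representation and its vacuum vector\<close>

lift_definition rep :: "int \<Rightarrow> int \<Rightarrow> Uq \<Rightarrow> vfun \<Rightarrow> vfun" is trep
  by (rule trep_cong)

lemma rep_add: "rep m n (x + y) f a b c = rep m n x f a b c + rep m n y f a b c"
  by transfer simp

lemma rep_mult: "rep m n (x * y) f = rep m n x (rep m n y f)"
  by transfer simp

lemma rep_scal: "rep m n (scal d) f = (\<lambda>a b c. d * f a b c)"
  by (simp add: rep.abs_eq scal.abs_eq)

lemma rep_mult_fun: "rep m n x (\<lambda>a b c. d * f a b c) = (\<lambda>a b c. d * rep m n x f a b c)"
  by (induction x rule: Uq.abs_induct) (simp add: rep.abs_eq trep_mult)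

definition vac :: vfun where
  "vac a b c = (if a = 0 \<and> b = 0 \<and> c = 0 then 1 else 0)"

lemma rep_EE_vac: "rep m n (EE i) vac = (\<lambda>a b c. 0 * vac a b c)"
proof -
  have "trep m n (tE i) vac = (\<lambda>a b c. 0)"
    by (intro ext) (cases i; auto simp: vac_def)
  then show ?thesis by (simp add: rep.abs_eq EE.abs_eq)
qed

lemma rep_KK_vac: "rep (int m) (int n) (KK i) vac = (\<lambda>a b c. qq powi int (hw m n i) * vac a b c)"
proof -
  have "trep (int m) (int n) (tK i) vac = (\<lambda>a b c. qq powi int (hw m n i) * vac a b c)"
    by (intro ext) (cases i; auto simp: vac_def)
  then show ?thesis by (simp add: rep.abs_eq KK.abs_eq)
qed

text \<open>The coefficient at the origin is a functional of the highest weight for K acting from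
  the left, so components of any other weight have coefficient 0.\<close>

lemma rep_KK_0: "rep (int m) (int n) (KK i) f 0 0 0 = qq powi int (hw m n i) * f 0 0 0"
proof -
  have "trep (int m) (int n) (tK i) f 0 0 0 = qq powi int (hw m n i) * f 0 0 0"
    by (cases i) auto
  then show ?thesis by (simp add: rep.abs_eq KK.abs_eq)
qed

section \<open>The simple modules\<close>

text \<open>\<open>L(m,n)\<close> is realised as the submodule generated by the vacuum functional in the additive
  functionals on the quantum group, on which the latter acts by right multiplication.\<close>

typedef ufun = "{f :: Uq \<Rightarrow> Qq. \<forall>x y. f (x + y) = f x + f y}"
  morphisms app Abs_ufun by (rule exI[of _ "\<lambda>_. 0"]) simp

lemma app_plus: "app f (v + w) = app f v + app f w"
  using app[of f] by simp

lemma ufun_eqI: "(\<And>w. app f w = app g w) \<Longrightarrow> f = g"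
  by (metis app_inject ext)

instantiation ufun :: ab_group_add
begin

definition "0 = Abs_ufun (\<lambda>_. 0)"
definition "f + g = Abs_ufun (\<lambda>x. app f x + app g x)"
definition "- f = Abs_ufun (\<lambda>x. - app f x)"
definition "f - g = Abs_ufun (\<lambda>x. app f x - app g x)"

lemma app_0: "app 0 w = 0"
  and app_add: "app (f + g) w = app f w + app g w"
  and app_uminus: "app (- f) w = - app f w"
  and app_minus: "app (f - g) w = app f w - app g w"
  by (simp_all add: zero_ufun_def plus_ufun_def uminus_ufun_def minus_ufun_def
      Abs_ufun_inverse app_plus algebra_simps)

instance
  by standard (rule ufun_eqI; simp add: app_0 app_add app_uminus app_minus)+

end

definition uact :: "Uq \<Rightarrow> ufun \<Rightarrow> ufun" where
  "uact u f = Abs_ufun (\<lambda>w. app f (w * u))"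

lemma app_uact: "app (uact u f) w = app f (w * u)"
  unfolding uact_def by (subst Abs_ufun_inverse) (simp_all add: app_plus ring_distribs)

lemma app_sum: "app (\<Sum>k\<in>I. f k) w = (\<Sum>k\<in>I. app (f k) w)"
  by (induction I rule: infinite_finite_induct) (simp_all add: app_0 app_add)

lemma app_diff: "app f (v - w) = app f v - app f w"
  using app_plus[of f "v - w" w] by simp

interpretation L: uq_mod uact
  by standard (rule ufun_eqI; simp add: app_uact app_add app_plus mult.assoc ring_distribs)+

text \<open>The matrix coefficient of the highest weight vector. An element u kills it exactly when
  w u \<open>vac\<close> has coefficient 0 at the origin for every w, so the passage to functionals
  divides out the radical of the Verma module.\<close>

definition vacuum :: "nat \<Rightarrow> nat \<Rightarrow> ufun" where
  "vacuum m n = Abs_ufun (\<lambda>u. rep (int m) (int n) u vac 0 0 0)"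

lemma app_vacuum: "app (vacuum m n) u = rep (int m) (int n) u vac 0 0 0"
  unfolding vacuum_def by (subst Abs_ufun_inverse) (simp_all add: rep_add)

lemma hw_mod_uact:
  assumes "f \<noteq> 0" "\<And>i w. app f (w * EE i) = 0"
    "\<And>i w. app f (w * KK i) = app f (w * scal (qq powi int (M i)))"
  shows "hw_mod uact f M"
proof
  show "f \<noteq> 0" by fact
  show "uact (EE i) f = 0" for i
    by (rule ufun_eqI) (simp add: app_uact assms app_0)
  show "L.wtv (\<lambda>i. int (M i)) f"
    unfolding L.wtv_def L.sc_def by (intro allI ufun_eqI) (simp only: app_uact assms(3))
qed

lemma hw_mod_nonzero:
  assumes "hw_mod uact f M"
  shows "f \<noteq> 0"
proof -
  interpret hw_mod uact f M by fact
  show ?thesis by (rule eta_nonzero)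
qed

lemma app_vacuum_1: "app (vacuum m n) 1 = 1"
proof -
  have "rep m n 1 vac = vac" for m n by (simp flip: scal_1 add: rep_scal)
  then show ?thesis by (simp add: app_vacuum vac_def)
qed

lemma hw_vacuum: "hw_mod uact (vacuum m n) (hw m n)"
proof (rule hw_mod_uact)
  show "vacuum m n \<noteq> 0" using app_vacuum_1[of m n] app_0 by fastforce
  show "app (vacuum m n) (w * EE i) = 0" for i w
    unfolding app_vacuum rep_mult rep_EE_vac rep_mult_fun by (rule mult_zero_left)
  show "app (vacuum m n) (w * KK i) = app (vacuum m n) (w * scal (qq powi int (hw m n i)))" for i w
    by (simp only: app_vacuum rep_mult rep_KK_vac rep_scal)
qed

lemma app_vacuum_KK: "app (vacuum m n) (KK i * u) = qq powi int (hw m n i) * app (vacuum m n) u"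
  by (simp only: app_vacuum rep_mult rep_KK_0)

definition pact :: "Uq \<Rightarrow> ufun \<times> ufun \<Rightarrow> ufun \<times> ufun" where
  "pact u = (\<lambda>(f, g). (uact u f, uact u g))"

lemma uq_mod_pact: "uq_mod pact"
proof (rule uq_mod.intro)
  fix x y :: Uq and v w :: "ufun \<times> ufun"
  obtain a b where v: "v = (a, b)" by (cases v)
  obtain c d where w: "w = (c, d)" by (cases w)
  show "pact (x + y) v = pact x v + pact y v"
    unfolding v by (simp add: pact_def L.act_add)
  show "pact x (v + w) = pact x v + pact x w"
    unfolding v w by (simp add: pact_def L.act_plus)
  show "pact (x * y) v = pact x (pact y v)"
    unfolding v by (simp add: pact_def L.act_mult)
  show "pact 1 v = v"
    unfolding v by (simp add: pact_def)
qed

interpretation LL: uq_mod pact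
  by (rule uq_mod_pact)

lemma LL_sc: "LL.sc c (f, g) = (L.sc c f, L.sc c g)"
  by (simp only: LL.sc_def L.sc_def pact_def prod.case)

lemma app_vacuum_sc: "app (L.sc c (uact u (vacuum m n))) 1 = c * app (vacuum m n) u"
  by (simp only: L.sc_def app_uact app_vacuum rep_mult rep_scal mult_1_left)

text \<open>In the module generated by the pair of both vectors, projection to degree 0 is the
  action of one element p, which forces the same scalar on both components. With f the vacuum this
  yields simplicity; with f from another quotient it yields uniqueness.\<close>

lemma project_to_vacuum:
  assumes "hw_mod uact f (hw m n)"
  shows "\<exists>p. uact (p * y) (vacuum m n) = L.sc (app (vacuum m n) y) (vacuum m n) \<and>
             uact (p * y) f = L.sc (app (vacuum m n) y) f"
proof -
  interpret f: hw_mod uact f "hw m n" by fact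
  interpret v: hw_mod uact "vacuum m n" "hw m n" by (rule hw_vacuum)
  let ?v = "vacuum m n"
  interpret P: hw_mod pact "(?v, f)" "hw m n"
  proof
    show "(?v, f) \<noteq> 0" using f.eta_nonzero by (simp add: zero_prod_def)
    show "pact (EE i) (?v, f) = 0" for i by (simp add: pact_def f.EE_eta v.EE_eta zero_prod_def)
    show "LL.wtv (\<lambda>i. int (hw m n i)) (?v, f)"
      unfolding LL.wtv_def LL_sc using L.wtv_KK[OF v.wtv_eta] L.wtv_KK[OF f.wtv_eta] by (simp add: pact_def)
  qed
  obtain e where "pact y (?v, f) \<in> P.Fl e" using P.Fl_cyclic by blast
  \<comment> \<open>The filtration index is raised so that a component of degree 0 is present even
    for e = 0.\<close>
  then have "pact y (?v, f) \<in> P.Fl (Suc e)" by (rule P.Fl_mono) simp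
  from P.Fl_decompose[OF this] obtain w where w: "pact y (?v, f) = (\<Sum>k<Suc e. w k)"
    "\<And>k. pact KK12 (w k) = LL.sc (qq powi (P.M12 - int k)) (w k)" "\<And>k. \<exists>u. w k = pact u (?v, f)"
    "\<exists>c. w 0 = LL.sc c (?v, f)" by blast
  obtain c where c: "w 0 = (L.sc c ?v, L.sc c f)" using w(4) by (auto simp: LL_sc)
  have e: "{..<Suc e} = insert 0 {1..<Suc e}" by auto
  have "\<exists>p. pact p (\<Sum>k\<in>insert 0 {1..<Suc e}. w k) = w 0"
    by (rule LL.eigenvector_projection[where Z = KK12 and g = "\<lambda>k. P.M12 - int k"])
       (auto simp: w(2) inj_on_def)
  then obtain p where "pact p (pact y (?v, f)) = w 0" unfolding w(1) e by blast
  then have p: "uact (p * y) ?v = L.sc c ?v" "uact (p * y) f = L.sc c f"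
    by (simp_all add: c pact_def L.act_mult)
  \<comment> \<open>On the vacuum coefficient \<open>KK12\<close> acts by the highest weight, on the
    component of degree k by that weight lowered by k; for k > 0 the coefficient must be 0.\<close>
  have 0: "app (fst (w k)) 1 = 0" if "k \<noteq> 0" for k
  proof -
    obtain u where u: "w k = (uact u ?v, uact u f)" using w(3)[of k] by (auto simp: pact_def)
    have "uact KK12 (uact u ?v) = L.sc (qq powi (P.M12 - int k)) (uact u ?v)"
      using w(2)[of k] by (simp add: u pact_def LL_sc)
    then have "app (uact KK12 (uact u ?v)) 1 = app (L.sc (qq powi (P.M12 - int k)) (uact u ?v)) 1" by simp
    then have "qq powi P.M12 * app ?v u = qq powi (P.M12 - int k) * app ?v u"
      by (simp add: app_uact KK12_def mult.assoc app_vacuum_KK app_vacuum_sc power_int_add)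
    then have "app ?v u = 0" using that by simp
    then show ?thesis by (simp add: u app_uact)
  qed
  have "app ?v y = app (fst (pact y (?v, f))) 1"
    by (simp add: pact_def app_uact)
  also have "\<dots> = (\<Sum>k<Suc e. app (fst (w k)) 1)"
    unfolding w(1) by (simp add: app_sum fst_sum app_add)
  also have "\<dots> = app (fst (w 0)) 1"
    unfolding e by (simp add: 0)
  also have "\<dots> = c"
    using app_vacuum_sc[of c 1 m n] app_vacuum_1 by (simp add: c)
  finally show ?thesis using p by auto
qed

lemma vacuum_module_simple:
  assumes "uact u (vacuum m n) \<noteq> 0"
  shows "\<exists>w. uact (w * u) (vacuum m n) = vacuum m n"
proof -
  obtain w where w: "app (uact u (vacuum m n)) w \<noteq> 0"
    using assms ufun_eqI app_0 by metis
  define c where "c = app (vacuum m n) (w * u)"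
  obtain p where p: "uact (p * (w * u)) (vacuum m n) = L.sc c (vacuum m n)"
    using project_to_vacuum[OF hw_vacuum] unfolding c_def by metis
  have "uact ((inverse c \<odot> (p * w)) * u) (vacuum m n) = vacuum m n"
    using w p by (simp add: c_def app_uact mult.assoc)
  then show ?thesis by blast
qed

section \<open>Quotients by left ideals and uniqueness of the annihilator\<close>

lemma left_ideal_cls_eq:
  assumes "left_ideal I"
  shows "cls I x = cls I y \<longleftrightarrow> x - y \<in> I"
proof -
  have add: "\<And>x y. x \<in> I \<Longrightarrow> y \<in> I \<Longrightarrow> x + y \<in> I" and neg: "\<And>x. x \<in> I \<Longrightarrow> - x \<in> I" and 0: "0 \<in> I"
    using assms unfolding left_ideal_def by (blast, metis mult_minus1, blast)
  show ?thesis
  proof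
    assume eq: "cls I x = cls I y"
    have "x \<in> cls I x" using 0 by (simp add: cls_def)
    then show "x - y \<in> I" unfolding eq by (simp add: cls_def)
  next
    assume xy: "x - y \<in> I"
    have "z - x \<in> I \<longleftrightarrow> z - y \<in> I" for z
    proof
      assume "z - x \<in> I"
      from add[OF this xy] show "z - y \<in> I" by simp
    next
      assume "z - y \<in> I"
      from add[OF this neg[OF xy]] show "z - x \<in> I" by simp
    qed
    then show "cls I x = cls I y" by (simp add: cls_def)
  qed
qed

lemma mact_cls:
  assumes "left_ideal I"
  shows "mact I u (cls I x) = cls I (u * x)"
proof -
  have "cls I (u * z) = cls I (u * x)" if "z \<in> cls I x" for z
  proof -
    have "u * (z - x) \<in> I" using that assms by (simp add: cls_def left_ideal_def)
    then show ?thesis by (simp add: left_ideal_cls_eq[OF assms] algebra_simps)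
  qed
  then have "mact I u (cls I x) = (\<Union>z\<in>cls I x. cls I (u * x))"
    unfolding mact_def by (rule SUP_cong[OF HOL.refl])
  moreover have "x \<in> cls I x" using assms by (simp add: cls_def left_ideal_def)
  then have "cls I x \<noteq> {}" by blast
  ultimately show ?thesis by simp
qed

lemma hw_vector_iff:
  assumes "left_ideal I"
  shows "highest_weight_vector I m n (cls I 1) \<longleftrightarrow>
    1 \<notin> I \<and> (\<forall>i. EE i \<in> I \<and> KK i - scal (qq ^ hw m n i) \<in> I)"
  unfolding highest_weight_vector_def mact_cls[OF assms] left_ideal_cls_eq[OF assms]
  by (auto simp: quot_def)

definition vann :: "nat \<Rightarrow> nat \<Rightarrow> Uq set" where
  "vann m n = {u. uact u (vacuum m n) = 0}"

lemma left_ideal_vann: "left_ideal (vann m n)"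
  by (simp add: left_ideal_def vann_def L.act_add L.act_mult)

lemma cls_vann_eq: "cls (vann m n) x = cls (vann m n) y \<longleftrightarrow> uact x (vacuum m n) = uact y (vacuum m n)"
  unfolding left_ideal_cls_eq[OF left_ideal_vann] by (simp add: vann_def L.act_diff)

lemma simple_module_vann: "simple_module (vann m n)"
  unfolding simple_module_def
proof (intro conjI allI impI)
  let ?I = "vann m n"
  have "cls ?I 1 \<noteq> cls ?I 0"
    using hw_mod_nonzero[OF hw_vacuum] by (simp add: cls_vann_eq)
  then show "quot ?I \<noteq> {cls ?I 0}" by (auto simp: quot_def)
  fix S assume S: "submodule ?I S"
  show "S = {cls ?I 0} \<or> S = quot ?I"
  proof (cases "S = {cls ?I 0}")
    case False
    then obtain X where X: "X \<in> S" "X \<noteq> cls ?I 0" using S by (auto simp: submodule_def)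
    then obtain u where u: "X = cls ?I u" using S by (auto simp: submodule_def quot_def)
    then have "uact u (vacuum m n) \<noteq> 0" using X(2) by (simp add: u cls_vann_eq)
    then obtain w where w: "uact (w * u) (vacuum m n) = vacuum m n" using vacuum_module_simple by blast
    have "cls ?I x \<in> S" for x
    proof -
      have "mact ?I (x * w) X \<in> S" using S X by (simp add: submodule_def)
      moreover have "mact ?I (x * w) X = cls ?I x"
        using w by (simp add: u mact_cls[OF left_ideal_vann] cls_vann_eq L.act_mult)
      ultimately show ?thesis by simp
    qed
    then show ?thesis using S by (auto simp: submodule_def quot_def)
  qed simp
qed

lemma hw_vector_vann: "highest_weight_vector (vann m n) m n (cls (vann m n) 1)"
proof -
  interpret v: hw_mod uact "vacuum m n" "hw m n" by (rule hw_vacuum)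
  show ?thesis
    unfolding hw_vector_iff[OF left_ideal_vann]
    using v.eta_nonzero by (simp add: vann_def v.EE_eta L.act_diff L.wtv_KK[OF v.wtv_eta])
qed

text \<open>The image of J in the quotient by I is a submodule that misses the class of 1, hence is
  zero.\<close>

lemma simple_module_maximal:
  assumes "simple_module I" "left_ideal I" "left_ideal J" "I \<subseteq> J" "1 \<notin> J"
  shows "J = I"
proof -
  define S where "S = cls I ` J"
  have J: "0 \<in> J" "\<And>x y. x \<in> J \<Longrightarrow> y \<in> J \<Longrightarrow> x + y \<in> J" "\<And>u x. x \<in> J \<Longrightarrow> u * x \<in> J"
    using assms(3) by (auto simp: left_ideal_def)
  have mem: "z \<in> J" if z: "cls I z \<in> S" for z
  proof -
    obtain x where "x \<in> J" "z - x \<in> I" using z unfolding S_def image_iff left_ideal_cls_eq[OF assms(2)] by blast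
    then show ?thesis using J(2)[of x "z - x"] assms(4) by auto
  qed
  have mplus: "mplus I (cls I x) (cls I y) = cls I (x + y)" for x y
  proof -
    have "cls I (x' + y') = cls I (x + y)" if "x' \<in> cls I x" "y' \<in> cls I y" for x' y'
    proof -
      have "(x' - x) + (y' - y) \<in> I" using that assms(2) by (simp add: cls_def left_ideal_def)
      then show ?thesis by (simp add: left_ideal_cls_eq[OF assms(2)] algebra_simps)
    qed
    then have "mplus I (cls I x) (cls I y) = (\<Union>x'\<in>cls I x. \<Union>y'\<in>cls I y. cls I (x + y))"
      unfolding mplus_def by (intro SUP_cong[OF HOL.refl])
    moreover have "x \<in> cls I x" "y \<in> cls I y" using assms(2) by (simp_all add: cls_def left_ideal_def)
    then have "cls I x \<noteq> {}" "cls I y \<noteq> {}" by blast+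
    ultimately show ?thesis by simp
  qed
  have "submodule I S"
    unfolding submodule_def S_def quot_def using J
    by (simp add: image_subset_iff mplus mact_cls[OF assms(2)])
  moreover have "cls I 1 \<notin> S" using mem assms(5) by blast
  then have "S \<noteq> quot I" by (auto simp: quot_def)
  ultimately have "S = {cls I 0}" using assms(1) by (auto simp: simple_module_def)
  then have "x - 0 \<in> I" if "x \<in> J" for x
    unfolding left_ideal_cls_eq[OF assms(2), symmetric] using that by (auto simp: S_def)
  then have "J \<subseteq> I" by auto
  then show ?thesis using assms(4) by blast
qed

interpretation Uqv: vector_space sm
  by standard (simp_all add: sm_distrib)

interpretation UqQ: vector_space_pair sm "(*) :: Qq \<Rightarrow> Qq \<Rightarrow> Qq"
  by standard (simp_all add: algebra_simps)

text \<open>This transports an arbitrary quotient by a left ideal into the space of functionals,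
  where it can be compared with \<open>vacuum\<close>.\<close>

lemma functional_exists:
  assumes "left_ideal I" "1 \<notin> I"
  shows "\<exists>f. app f 1 = 1 \<and> (\<forall>x\<in>I. app f x = 0)"
proof -
  have sub: "Uqv.subspace I"
    using assms(1) by (auto simp: Uqv.subspace_def left_ideal_def sm_def)
  obtain B where B: "B \<subseteq> I" "Uqv.independent B" "I \<subseteq> Uqv.span B"
    using Uqv.maximal_independent_subset by blast
  have span: "Uqv.span B \<subseteq> I" by (rule Uqv.span_minimal[OF B(1) sub])
  then have "Uqv.independent (insert 1 B)"
    using assms(2) B(2) by (intro Uqv.independent_insertI) auto
  from UqQ.linear_independent_extend[OF this, of "\<lambda>x. if x = 1 then 1 else 0"]
  obtain g where g: "Vector_Spaces.linear sm (*) g" "\<forall>x\<in>insert 1 B. g x = (if x = 1 then 1 else 0)" by blast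
  interpret g: Vector_Spaces.linear sm "(*) :: Qq \<Rightarrow> Qq \<Rightarrow> Qq" g by fact
  have "g x = 0" if "x \<in> I" for x
  proof (rule g.eq_0_on_span[of B])
    show "x \<in> Uqv.span B" using that B(3) by blast
    show "g y = 0" if "y \<in> B" for y using that g(2) B(1) assms(2) by auto
  qed
  moreover have "app (Abs_ufun g) = g" by (rule Abs_ufun_inverse) (simp add: g.add)
  ultimately show ?thesis using g(2) by (intro exI[of _ "Abs_ufun g"]) auto
qed

lemma ann_eq: "ann m n = vann m n"
  unfolding ann_def
proof (rule the_equality)
  show "left_ideal (vann m n) \<and> simple_module (vann m n) \<and> highest_weight_vector (vann m n) m n (cls (vann m n) 1)"
    using left_ideal_vann simple_module_vann hw_vector_vann by blast
next
  fix I assume I: "left_ideal I \<and> simple_module I \<and> highest_weight_vector I m n (cls I 1)"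
  then have I': "left_ideal I" "1 \<notin> I" "\<And>i. EE i \<in> I" "\<And>i. KK i - scal (qq ^ hw m n i) \<in> I"
    using hw_vector_iff[of I m n] by auto
  have Imult: "\<And>w x. x \<in> I \<Longrightarrow> w * x \<in> I" using I'(1) by (auto simp: left_ideal_def)
  obtain f where f: "app f 1 = 1" "\<And>x. x \<in> I \<Longrightarrow> app f x = 0"
    using functional_exists[OF I'(1,2)] by blast
  have hw: "hw_mod uact f (hw m n)"
  proof (rule hw_mod_uact)
    show "f \<noteq> 0" using f(1) app_0[of 1] by auto
    show "app f (w * EE i) = 0" for i w using f(2) Imult I'(3) by blast
    show "app f (w * KK i) = app f (w * scal (qq powi int (hw m n i)))" for i w
      using f(2)[OF Imult[OF I'(4)[of i], of w]] by (simp add: algebra_simps app_diff)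
  qed
  have "uact u f = 0" if "u \<in> I" for u
    using Imult[OF that] f(2) by (intro ufun_eqI) (simp add: app_uact app_0)
  \<comment> \<open>The common p sends f to a multiple of itself although u kills f; the factor is
    the vacuum coefficient of w u, which is therefore 0.\<close>
  then have "app (vacuum m n) (w * u) = 0" if "u \<in> I" for w u
    using project_to_vacuum[OF hw, of "w * u"] that hw_mod_nonzero[OF hw] Imult
    by (metis L.V.scale_eq_0_iff)
  then have "I \<subseteq> vann m n"
    by (auto simp: vann_def app_uact app_0 intro!: ufun_eqI)
  moreover have "1 \<notin> vann m n" using hw_mod_nonzero[OF hw_vacuum] by (simp add: vann_def)
  ultimately show "I = vann m n"
    using simple_module_maximal[of I "vann m n"] I left_ideal_vann by auto
qed

lemma left_ideal_ann: "left_ideal (ann m n)"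
  by (simp add: ann_eq left_ideal_vann)

lemma act_eta_eq: "act m n u (eta m n) = cls (ann m n) u"
  by (rule act_eta[OF left_ideal_ann])

lemma act_eta_eq_iff: "act m n u (eta m n) = act m n w (eta m n) \<longleftrightarrow> uact u (vacuum m n) = uact w (vacuum m n)"
  by (simp add: act_eta_eq ann_eq cls_vann_eq)

text \<open>At the exponent \<open>Suc (hw m n i)\<close> the vector is singular, as the coefficient
  in \<open>EE_dpow_FF_eta\<close> is [0]. Were it nonzero, simplicity would recover the vacuum from
  it, but words in the F only lower the degree.\<close>

lemma FF_vacuum:
  assumes "hw m n i < r"
  shows "uact (dpow (FF i) (int r)) (vacuum m n) = 0"
proof -
  interpret v: hw_mod uact "vacuum m n" "hw m n" by (rule hw_vacuum)
  define d where "d = Suc (hw m n i)"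
  define x where "x = uact (dpow (FF i) (int d)) (vacuum m n)"
  have "x = 0"
  proof (rule ccontr)
    assume nz: "x \<noteq> 0"
    then obtain w where w: "uact (w * dpow (FF i) (int d)) (vacuum m n) = vacuum m n"
      using vacuum_module_simple unfolding x_def by metis
    define M' where "M' = (\<lambda>k. int (hw m n k) - int d * cartan k i)"
    interpret x: singular_vector uact x M'
    proof
      show "L.wtv M' x" unfolding M'_def x_def by (rule L.wtv_dpow_FF[OF v.wtv_eta])
      show "uact (EE j) x = 0" for j
        using v.EE_dpow_FF_eta[of i "int d"] L.EE_dpow_FF_other[of j i] v.EE_eta
        by (cases "j = i") (auto simp: x_def d_def)
    qed (rule nz)
    obtain e where "uact w x \<in> x.Fl e" using x.Fl_cyclic by blast
    from x.Fl_decompose[OF this] obtain y where y: "uact w x = (\<Sum>k<e. y k)"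
      "\<And>k. uact KK12 (y k) = L.sc (qq powi (x.M12 - int k)) (y k)" by blast
    have M12: "x.M12 = v.M12 - int d"
      unfolding M'_def by (cases i) (simp_all add: cartan_def)
    \<comment> \<open>The free index e carries the vacuum, whose degree exceeds every degree
      reachable from the singular vector.\<close>
    define y' where "y' k = (if k = e then - vacuum m n else y k)" for k
    have "y' e = 0"
    proof (rule L.eigenvectors_independent[where I = "{..e}" and Z = KK12
          and g = "\<lambda>k. if k = e then v.M12 else x.M12 - int k"])
      have "(\<Sum>k<e. y' k) = uact w x"
        unfolding y(1) by (intro sum.cong) (auto simp: y'_def)
      then show "(\<Sum>k\<le>e. y' k) = 0"
        using w by (simp add: y'_def x_def L.act_mult flip: lessThan_Suc_atMost)
    qed (auto simp: y'_def y(2) L.act_minus inj_on_def v.wtv_KK12[OF v.wtv_eta] M12 d_def split: if_splits)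
    then show False using v.eta_nonzero by (simp add: y'_def)
  qed
  moreover have "uact (dpow (FF i) (int (d + k))) (vacuum m n) = 0" if "x = 0" for k
  proof (induction k)
    case (Suc k)
    have "qnum (int (d + k) + 1) \<odot> dpow (FF i) (int (d + k) + 1) = FF i * dpow (FF i) (int (d + k))"
      by (simp add: mult_dpow)
    then have "uact (qnum (int (d + k) + 1) \<odot> dpow (FF i) (int (d + k) + 1)) (vacuum m n) = 0"
      using Suc by (simp add: L.act_mult)
    then show ?case by (simp add: add.commute)
  qed (use that in \<open>simp add: x_def\<close>)
  ultimately show ?thesis using assms by (metis d_def Suc_leI le_add_diff_inverse)
qed

section \<open>The Serre relation of the iquantum group\<close>

text \<open>X, X' stand for \<open>FF i\<close>, \<open>FF (tau i)\<close> and Y, Y' for the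
  E-summands of the corresponding B; k and l are the two kk, and c is a product of two inverse K.
  Sorted by multidegree there are two pure parts, which are Serre relations, and four mixed ones, in
  each of which c cancels and a multiple of k or l survives.\<close>

lemma iserre_abstract:
  fixes X Y X' Y' k l c :: Uq and q t h h' :: Qq
  assumes qt: "q * t = 1"
    and YX: "Y * X = (q * q) \<odot> (X * Y)"
    and YX': "Y * X' = t \<odot> (X' * Y) + (t * h) \<odot> l - (t * h) \<odot> c"
    and Y'X: "Y' * X = t \<odot> (X * Y') + (t * h') \<odot> k - (t * h') \<odot> c"
    and lX: "l * X = (q * q * q) \<odot> (X * l)" and kX: "k * X = (t * t * t) \<odot> (X * k)"
    and cX: "c * X = q \<odot> (X * c)"
    and lY: "l * Y = (q * q * q) \<odot> (Y * l)" and kY: "k * Y = (t * t * t) \<odot> (Y * k)"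
    and cY: "c * Y = t \<odot> (Y * c)"
    and SX: "X' * X * X = (q + t) \<odot> (X * X' * X) - X * X * X'"
    and SY: "Y' * Y * Y = (q + t) \<odot> (Y * Y' * Y) - Y * Y * Y'"
  shows "(X + Y) * (X + Y) * (X' + Y') - (q + t) \<odot> ((X + Y) * (X' + Y') * (X + Y)) + (X' + Y') * (X + Y) * (X + Y)
    = - ((q + t) * (q - t)) \<odot> ((X + Y) * ((h' * t * t) \<odot> k + (h * q) \<odot> l))"
proof -
  have qt': "t * q = 1" "q * (t * z) = z" "t * (q * z) = z" for z :: Qq
    using qt by (simp_all add: mult.commute flip: mult.assoc)
  have tails: "Y * (X * z) = (q * q) \<odot> (X * (Y * z))"
    "Y * (X' * z) = t \<odot> (X' * (Y * z)) + (t * h) \<odot> (l * z) - (t * h) \<odot> (c * z)"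
    "Y' * (X * z) = t \<odot> (X * (Y' * z)) + (t * h') \<odot> (k * z) - (t * h') \<odot> (c * z)" for z
    using arg_cong[OF YX, of "\<lambda>x. x * z"] arg_cong[OF YX', of "\<lambda>x. x * z"] arg_cong[OF Y'X, of "\<lambda>x. x * z"]
    by (simp_all add: ring_distribs mult.assoc)
  note rels = YX YX' Y'X lX kX cX lY kY cY tails
  have SX': "X' * (X * X) = (q + t) \<odot> (X * (X' * X)) - X * (X * X')" using SX by (simp add: mult.assoc)
  have SY': "Y' * (Y * Y) = (q + t) \<odot> (Y * (Y' * Y)) - Y * (Y * Y')" using SY by (simp add: mult.assoc)
  note norm = ring_distribs mult.assoc rels SX' SY' sm_distrib sm_simps
  have 1: "X * X * Y' - (q + t) \<odot> (X * Y' * X) + Y' * X * X = - ((q + t) * (q - t)) \<odot> (X * ((h' * t * t) \<odot> k))"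
    by (simp only: norm qt qt' mult_1_left mult_1_right,
        simp only: ring_distribs mult_minus_left mult_minus_right minus_minus minus_diff_eq sm_distrib sm_simps(7,8) mult_ac qt qt' mult_1_left mult_1_right, simp)
  have 2: "(X * Y + Y * X) * X' - (q + t) \<odot> (X * X' * Y + Y * X' * X) + X' * (X * Y + Y * X) =
     - ((q + t) * (q - t)) \<odot> (X * ((h * q) \<odot> l))"
    by (simp only: norm qt qt' mult_1_left mult_1_right,
        simp only: ring_distribs mult_minus_left mult_minus_right minus_minus minus_diff_eq sm_distrib sm_simps(7,8) mult_ac qt qt' mult_1_left mult_1_right, simp)
  have 3: "Y * Y * X' - (q + t) \<odot> (Y * X' * Y) + X' * Y * Y = - ((q + t) * (q - t)) \<odot> (Y * ((h * q) \<odot> l))"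
    by (simp only: norm qt qt' mult_1_left mult_1_right,
        simp only: ring_distribs mult_minus_left mult_minus_right minus_minus minus_diff_eq sm_distrib sm_simps(7,8) mult_ac qt qt' mult_1_left mult_1_right, simp)
  have 4: "(X * Y + Y * X) * Y' - (q + t) \<odot> (X * Y' * Y + Y * Y' * X) + Y' * (X * Y + Y * X) =
     - ((q + t) * (q - t)) \<odot> (Y * ((h' * t * t) \<odot> k))"
    by (simp only: norm qt qt' mult_1_left mult_1_right,
        simp only: ring_distribs mult_minus_left mult_minus_right minus_minus minus_diff_eq sm_distrib sm_simps(7,8) mult_ac qt qt' mult_1_left mult_1_right, simp)
  have "(X + Y) * (X + Y) * (X' + Y') - (q + t) \<odot> ((X + Y) * (X' + Y') * (X + Y)) + (X' + Y') * (X + Y) * (X + Y) =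
    (X * X * X' - (q + t) \<odot> (X * X' * X) + X' * X * X) + (Y * Y * Y' - (q + t) \<odot> (Y * Y' * Y) + Y' * Y * Y)
    + (X * X * Y' - (q + t) \<odot> (X * Y' * X) + Y' * X * X)
    + ((X * Y + Y * X) * X' - (q + t) \<odot> (X * X' * Y + Y * X' * X) + X' * (X * Y + Y * X))
    + (Y * Y * X' - (q + t) \<odot> (Y * X' * Y) + X' * Y * Y)
    + ((X * Y + Y * X) * Y' - (q + t) \<odot> (X * Y' * Y + Y * Y' * X) + Y' * (X * Y + Y * X))"
    by (simp only: ring_distribs mult.assoc sm_distrib(1)) simp
  also have "\<dots> = - ((q + t) * (q - t)) \<odot> ((X + Y) * ((h' * t * t) \<odot> k + (h * q) \<odot> l))"
    unfolding 1 2 3 4 using SX SY by (simp add: ring_distribs sm_distrib(1))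
  finally show ?thesis .
qed

text \<open>Bar exchanges \<open>kk N1\<close> and \<open>kk N2\<close>, so these are its fixed
  elements in their span. The Cartan factor of the Serre relation for the B is of this form.\<close>

definition kap :: "Qq \<Rightarrow> Uq" where
  "kap c = c \<odot> kk N1 + bar c \<odot> kk N2"

lemma BB_eq: "BB vs i = FF i + qq powi vs i \<odot> (EE (tau i) * KKinv i)"
  by (simp add: BB_def sm_def mult.assoc)

lemma KK_past_EE: "KK a * (EE b * z) = qq powi (cartan a b) \<odot> (EE b * (KK a * z))"
  "KKinv a * (EE b * z) = qq powi (- cartan a b) \<odot> (EE b * (KKinv a * z))"
  using arg_cong[OF KK_EE'[of a b], of "\<lambda>x. x * z"] arg_cong[OF KKinv_EE'[of a b], of "\<lambda>x. x * z"]
  by (simp_all add: mult.assoc)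

lemma KK_past_FF: "KK a * (FF b * z) = qq powi (- cartan a b) \<odot> (FF b * (KK a * z))"
  "KKinv a * (FF b * z) = qq powi (cartan a b) \<odot> (FF b * (KKinv a * z))"
  using arg_cong[OF KK_FF'[of a b], of "\<lambda>x. x * z"] arg_cong[OF KKinv_FF'[of a b], of "\<lambda>x. x * z"]
  by (simp_all add: mult.assoc)

lemma EE_past_FF: "i \<noteq> j \<Longrightarrow> EE i * (FF j * z) = FF j * (EE i * z)"
  "EE i * (FF i * z) = FF i * (EE i * z) + inverse (qq - inverse qq) \<odot> (KK i * z - KKinv i * z)"
  using arg_cong[OF EE_FF_other[of i j], of "\<lambda>x. x * z"] arg_cong[OF EE_FF_same[of i], of "\<lambda>x. x * z"]
  by (simp_all add: mult.assoc ring_distribs)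

lemma KKinv_past_KK: "KKinv i * (KK j * z) = KK j * (KKinv i * z)"
  using arg_cong[OF KKinv_KK_comm[of i j], of "\<lambda>x. x * z"] by (simp add: mult.assoc)

lemmas past = KK_past_EE KK_past_FF EE_past_FF KK_EE' KKinv_EE' KK_FF' KKinv_FF' KKinv_KK_comm KKinv_past_KK

lemma q2: "qfact 2 = qnum 2"
  using qfact_Suc[of 1] qfact_Suc[of 0] by (simp add: numeral_2_eq_2)

lemma serre_form:
  assumes "y * dpow x 2 - x * y * x + dpow x 2 * y = 0"
  shows "y * x * x = (qq + inverse qq) \<odot> (x * y * x) - x * x * y"
proof -
  have "inverse (qnum 2) \<odot> (y * x * x + x * x * y) = x * y * x"
    using assms unfolding dpow_2 q2 by (simp add: sm_def[symmetric] sm_distrib mult.assoc algebra_simps)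
  then have "qnum 2 \<odot> inverse (qnum 2) \<odot> (y * x * x + x * x * y) = qnum 2 \<odot> (x * y * x)" by (simp only:)
  then show ?thesis by (simp add: qnum_2[symmetric] algebra_simps)
qed

text \<open>One factor B on the right against three on the left: up to shorter words the B satisfy
  the Serre relation of the F. The denominators q - q^-1 from the commutators of E and F cancel
  against the factor q - t of \<open>iserre_abstract\<close>.\<close>

lemma BB_serre:
  fixes i vs
  defines "j \<equiv> tau i"
  shows "BB vs i * BB vs i * BB vs j - qnum 2 \<odot> (BB vs i * BB vs j * BB vs i) + BB vs j * BB vs i * BB vs i =
    - qnum 2 \<odot> (BB vs i * (qq powi (vs j - 2) \<odot> kk i + qq powi (vs i + 1) \<odot> kk j))"
proof -
  define D where "D = inverse (qq - inverse qq)"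
  have D: "D * (qq - inverse qq) = 1" unfolding D_def by simp
  define t where "t = inverse qq"
  have pw: "qq powi (- 1) = t" "qq powi 1 = qq" "qq powi (- 2) = t * t" "qq powi 2 = qq * qq"
    by (simp_all add: t_def power_int_minus power2_eq_square)
  have ij: "tau j = i" "cartan i j = -1" "cartan j i = -1" "i \<noteq> j" "j \<noteq> i" by (simp_all add: j_def)
  have qt: "qq * t = 1" "t * qq = 1" "qq * (t * z) = z" "t * (qq * z) = z" for z
    by (simp_all add: t_def)
  have SE: "EE i * (EE j * EE j) = (qq + t) \<odot> (EE j * (EE i * EE j)) - EE j * (EE j * EE i)"
    using serre_form[OF Serre_EE[OF ij(5)]] by (simp only: mult.assoc t_def)
  have SF: "FF j * FF i * FF i = (qq + t) \<odot> (FF i * FF j * FF i) - FF i * FF i * FF j"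
    unfolding t_def by (rule serre_form[OF Serre_FF]) (rule ij)
  define p r where "p = qq powi vs i" and "r = qq powi vs j"
  define k l c where "k = KK i * KKinv j" and "l = KK j * KKinv i" and "c = KKinv i * KKinv j"
  have BBi: "BB vs i = FF i + p \<odot> (EE j * KKinv i)" and BBj: "BB vs j = FF j + r \<odot> (EE i * KKinv j)"
    by (simp_all add: BB_eq p_def r_def ij flip: j_def)
  \<comment> \<open>Only instances with numerical Cartan integers are used, and powers of q become
    products of the atoms \<open>qq\<close> and \<open>t\<close>, so that both sides reach the same
    ordered form.\<close>
  note mv = KK_past_EE[of i i, unfolded cartan_simps pw] KK_past_EE[of i j, unfolded ij(2) pw]
    KK_past_EE[of j i, unfolded ij(3) pw] KK_past_EE[of j j, unfolded cartan_simps pw]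
    KK_past_FF[of i i, unfolded cartan_simps pw] KK_past_FF[of i j, unfolded ij(2) pw]
    KK_past_FF[of j i, unfolded ij(3) pw] KK_past_FF[of j j, unfolded cartan_simps pw]
    KK_FF'[of i i, unfolded cartan_simps pw] KK_FF'[of i j, unfolded ij(2) pw]
    KK_FF'[of j i, unfolded ij(3) pw] KK_FF'[of j j, unfolded cartan_simps pw]
    KKinv_FF'[of i i, unfolded cartan_simps pw] KKinv_FF'[of i j, unfolded ij(2) pw]
    KKinv_FF'[of j i, unfolded ij(3) pw] KKinv_FF'[of j j, unfolded cartan_simps pw]
    KKinv_EE'[of i i, unfolded cartan_simps pw] KKinv_EE'[of i j, unfolded ij(2) pw]
    KKinv_EE'[of j i, unfolded ij(3) pw] KKinv_EE'[of j j, unfolded cartan_simps pw]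
    EE_past_FF(1)[OF ij(4)] EE_past_FF(1)[OF ij(5)] EE_past_FF(2)[folded D_def] minus_minus
  note mv = mv[unfolded minus_minus pw]
  note kc = KKinv_KK_comm[of i i] KKinv_KK_comm[of i j] KKinv_KK_comm[of j i] KKinv_KK_comm[of j j]
    KKinv_past_KK[of i i] KKinv_past_KK[of i j] KKinv_past_KK[of j i] KKinv_past_KK[of j j]
    KKinv_KKinv[of j i] arg_cong[OF KKinv_KKinv[of j i], of "\<lambda>x. x * z" for z, unfolded mult.assoc]
  define Y Y' where "Y = p \<odot> (EE j * KKinv i)" and "Y' = r \<odot> (EE i * KKinv j)"
  have A1: "Y * FF i = (qq * qq) \<odot> (FF i * Y)"
    unfolding Y_def by (simp only: mult.assoc sm_simps mv mult_ac)
  have A2: "Y * FF j = t \<odot> (FF j * Y) + (t * (p * D)) \<odot> l - (t * (p * D)) \<odot> c"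
    unfolding Y_def l_def c_def by (simp only: mult.assoc sm_simps mv sm_distrib mult_ac kc add_diff_eq)
  have A3: "Y' * FF i = t \<odot> (FF i * Y') + (t * (r * D)) \<odot> k - (t * (r * D)) \<odot> c"
    unfolding Y'_def k_def c_def by (simp only: mult.assoc sm_simps mv sm_distrib mult_ac kc add_diff_eq)
  have A4: "l * FF i = (qq * qq * qq) \<odot> (FF i * l)" "k * FF i = (t * t * t) \<odot> (FF i * k)"
    "c * FF i = qq \<odot> (FF i * c)"
    unfolding l_def k_def c_def by (simp_all only: mult.assoc sm_simps mv mult_ac qt mult_1_right mult_1_left)
  have A5: "l * Y = (qq * qq * qq) \<odot> (Y * l)" "k * Y = (t * t * t) \<odot> (Y * k)" "c * Y = t \<odot> (Y * c)"
    unfolding l_def k_def c_def Y_def by (simp_all only: mult.assoc sm_simps mv mult_ac qt kc mult_1_right mult_1_left)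
  have A6: "Y' * Y * Y = (qq + t) \<odot> (Y * Y' * Y) - Y * Y * Y'"
  proof -
    \<comment> \<open>Moving the Cartan factors to the right costs the same scalar in all three
      products, which leaves the Serre relation of the E.\<close>
    define w where "w = KKinv i * (KKinv i * KKinv j)"
    have "Y' * Y * Y = (r * p * p * (t * t * t)) \<odot> ((EE i * (EE j * EE j)) * w)"
      unfolding Y_def Y'_def w_def by (simp only: mult.assoc sm_simps mv mult_ac qt kc mult_1_right mult_1_left)
    moreover have "Y * Y' * Y = (r * p * p * (t * t * t)) \<odot> ((EE j * (EE i * EE j)) * w)"
      unfolding Y_def Y'_def w_def by (simp only: mult.assoc sm_simps mv mult_ac qt kc mult_1_right mult_1_left)
    moreover have "Y * Y * Y' = (r * p * p * (t * t * t)) \<odot> ((EE j * (EE j * EE i)) * w)"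
      unfolding Y_def Y'_def w_def
      by (simp only: mult.assoc sm_simps mv mult_ac kc) (simp add: t_def)
    ultimately show ?thesis unfolding SE by (simp only: ring_distribs sm_distrib sm_simps mult_ac)
  qed
  have "BB vs i * BB vs i * BB vs j - (qq + t) \<odot> (BB vs i * BB vs j * BB vs i) + BB vs j * BB vs i * BB vs i =
    - ((qq + t) * (qq - t)) \<odot> (BB vs i * ((r * D * t * t) \<odot> k + (p * D * qq) \<odot> l))"
    unfolding BBi BBj Y_def[symmetric] Y'_def[symmetric]
    by (rule iserre_abstract[OF qt(1) A1 A2 A3 A4 A5 SF A6])
  moreover have "k = kk i" "l = kk j" by (simp_all add: k_def l_def kk_def ij flip: j_def)
  moreover have "(qq + t) * (qq - t) * (r * D * t * t) = qnum 2 * qq powi (vs j - 2)"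
  proof -
    have "(qq + t) * (qq - t) * (r * D * t * t) = (D * (qq - t)) * ((qq + t) * (r * (t * t)))"
      by (simp only: mult_ac)
    also have "r * (t * t) = qq powi (vs j - 2)"
      using power_int_add[of qq "vs j" "- 2"] by (simp add: pw r_def)
    finally show ?thesis using D by (simp only: t_def qnum_2 mult_1_left)
  qed
  moreover have "(qq + t) * (qq - t) * (p * D * qq) = qnum 2 * qq powi (vs i + 1)"
  proof -
    have "(qq + t) * (qq - t) * (p * D * qq) = (D * (qq - t)) * ((qq + t) * (p * qq))"
      by (simp only: mult_ac)
    also have "p * qq = qq powi (vs i + 1)"
      using power_int_add[of qq "vs i" 1] by (simp add: p_def)
    finally show ?thesis using D by (simp only: t_def qnum_2 mult_1_left)
  qed
  ultimately show ?thesis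
    by (simp only: sm_distrib(1) sm_simps ring_distribs t_def[symmetric] qnum_2[folded t_def] mult_minus_left)
qed

section \<open>A filtered bar-invariant subring\<close>

text \<open>The index bounds the number of factors B. Scalars must be bar-fixed and kk enters only
  through \<open>kap\<close>, so every member is its own bar image and may be applied to both
  components of a pair at once.\<close>

inductive bar_fixed :: "(node \<Rightarrow> int) \<Rightarrow> nat \<Rightarrow> Uq \<Rightarrow> bool" for vs where
  scal: "bar c = c \<Longrightarrow> bar_fixed vs d (scal c)"
| kap: "bar_fixed vs d (kap c)"
| BB: "bar_fixed vs (Suc d) (BB vs i)"
| plus: "bar_fixed vs d x \<Longrightarrow> bar_fixed vs d y \<Longrightarrow> bar_fixed vs d (x + y)"
| times: "bar_fixed vs d x \<Longrightarrow> bar_fixed vs e y \<Longrightarrow> bar_fixed vs (d + e) (x * y)"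

lemma bar_fixed_mono: "bar_fixed vs d x \<Longrightarrow> d \<le> e \<Longrightarrow> bar_fixed vs e x"
  using bar_fixed.times[of vs d x "e - d" 1] bar_fixed.scal[of 1 vs "e - d"] by (simp add: scal_1)

lemma bar_fixed_sm: "bar_fixed vs d x \<Longrightarrow> bar c = c \<Longrightarrow> bar_fixed vs d (c \<odot> x)"
  using bar_fixed.times[of vs 0 "scal c" d x] bar_fixed.scal[of c vs 0] by (simp add: sm_def)

lemma bar_fixed_0: "bar_fixed vs d 0"
  using bar_fixed.scal[of 0] by (simp add: scal_0)

lemma bar_fixed_1: "bar_fixed vs d 1"
  using bar_fixed.scal[of 1] by (simp add: scal_1)

lemma bar_fixed_minus: "bar_fixed vs d x \<Longrightarrow> bar_fixed vs d (- x)"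
  using bar_fixed_sm[of vs d x "- 1"] by simp

lemma bar_fixed_diff: "bar_fixed vs d x \<Longrightarrow> bar_fixed vs d y \<Longrightarrow> bar_fixed vs d (x - y)"
  using bar_fixed.plus[of vs d x "- y"] bar_fixed_minus by simp

lemma bar_fixed_times: "bar_fixed vs d x \<Longrightarrow> bar_fixed vs e y \<Longrightarrow> d + e \<le> f \<Longrightarrow> bar_fixed vs f (x * y)"
  using bar_fixed.times bar_fixed_mono by blast

lemma bar_fixed_unscale: "bar_fixed vs d (c \<odot> x) \<Longrightarrow> bar c = c \<Longrightarrow> c \<noteq> 0 \<Longrightarrow> bar_fixed vs d x"
  using bar_fixed_sm[of vs d "c \<odot> x" "inverse c"] by simp

lemma bar_fixed_dpow: "bar_fixed vs k (dpow (BB vs i) (int k))"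
proof -
  have "bar_fixed vs k (BB vs i ^ k)"
    by (induction k) (auto intro: bar_fixed_1 bar_fixed_times[OF bar_fixed.BB[of vs 0]])
  then show ?thesis by (simp add: dpow_nat bar_fixed_sm)
qed

lemma bar_fixed_Bmon: "bar_fixed vs (a + b + c) (Bmon vs i (int a) (int b) (int c))"
  unfolding Bmon_def by (intro bar_fixed.times bar_fixed_dpow)

text \<open>The value 1 of the sum is what makes the two Cartan coefficients in
  \<open>BB_serre\<close> bar conjugate to each other, so that the remainder is a
  \<open>kap\<close>.\<close>

locale iqg =
  fixes vs :: "node \<Rightarrow> int"
  assumes vs_sum: "vs N1 + vs N2 = 1"
begin

abbreviation B :: "node \<Rightarrow> Uq" where "B i \<equiv> BB vs i"
abbreviation Bd :: "node \<Rightarrow> nat \<Rightarrow> Uq" where "Bd i k \<equiv> dpow (B i) (int k)"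
abbreviation P :: "nat \<Rightarrow> Uq \<Rightarrow> bool" where "P \<equiv> bar_fixed vs"
abbreviation Bm :: "node \<Rightarrow> int \<Rightarrow> int \<Rightarrow> int \<Rightarrow> Uq" where "Bm \<equiv> Bmon vs"

section \<open>Divided power forms of the Serre relation\<close>

lemma P_B: "P d (B i)" if "1 \<le> d"
  using bar_fixed_mono[OF bar_fixed.BB[of vs 0 i]] that by simp

lemma P_serre:
  "P 1 (B i * B i * B (tau i) - qnum 2 \<odot> (B i * B (tau i) * B i) + B (tau i) * B i * B i)"
proof -
  have "\<exists>c. qq powi (vs (tau i) - 2) \<odot> kk i + qq powi (vs i + 1) \<odot> kk (tau i) = kap c"
  proof (cases i)
    case N1
    have "vs N1 + 1 = - (vs N2 - 2)" using vs_sum by simp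
    then show ?thesis using N1 by (intro exI[of _ "qq powi (vs N2 - 2)"]) (simp add: kap_def)
  next
    case N2
    have "vs N1 - 2 = - (vs N2 + 1)" using vs_sum by simp
    then show ?thesis using N2 by (intro exI[of _ "qq powi (vs N2 + 1)"]) (simp add: kap_def add.commute)
  qed
  then obtain c where c: "qq powi (vs (tau i) - 2) \<odot> kk i + qq powi (vs i + 1) \<odot> kk (tau i) = kap c" by blast
  show ?thesis
    unfolding BB_serre c by (rule bar_fixed_sm[OF bar_fixed_times[OF P_B[OF order_refl] bar_fixed.kap[of vs 0]]]) simp_all
qed

lemma B_Bd: "B i * Bd i k = qnum (int k + 1) \<odot> Bd i (Suc k)" and Bd_B: "Bd i k * B i = qnum (int k + 1) \<odot> Bd i (Suc k)"
  using mult_dpow[of "B i" "int k"] dpow_mult[of "B i" "int k"] by (simp_all add: add.commute)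

lemma B_Bd': "B i * (Bd i k * z) = qnum (int k + 1) \<odot> (Bd i (Suc k) * z)"
  using arg_cong[OF B_Bd, of "\<lambda>x. x * z"] by (simp add: mult.assoc)

lemma Bd_B': "Bd i k * (B i * z) = qnum (int k + 1) \<odot> (Bd i (Suc k) * z)"
  using arg_cong[OF Bd_B, of "\<lambda>x. x * z"] by (simp add: mult.assoc)

text \<open>The defect of a divided power Serre relation among the B. It vanishes for the F; here
  \<open>S1_low\<close> shows that it is shorter by two factors than its terms. \<open>S2\<close> is
  the counterpart for moving into an inner power.\<close>

definition S1 :: "node \<Rightarrow> nat \<Rightarrow> Uq" where
  "S1 i a = B i * Bd (tau i) (Suc a) - Bd (tau i) a * B i * B (tau i) + qnum (int a) \<odot> (Bd (tau i) (Suc a) * B i)"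

definition S2 :: "node \<Rightarrow> nat \<Rightarrow> Uq" where
  "S2 i b = B i * B (tau i) * Bd i b - Bd i (Suc b) * B (tau i) - qnum (int b) \<odot> (B (tau i) * Bd i (Suc b))"

lemma S1_low: "P a (S1 i a)"
proof (induction a)
  case 0
  have "Bd k (Suc 0) = B k" for k by simp
  then show ?case by (simp add: S1_def bar_fixed_0)
next
  case (Suc a)
  let ?j = "tau i"
  let ?s = "B ?j * B ?j * B i - qnum 2 \<odot> (B ?j * B i * B ?j) + B i * B ?j * B ?j"
  have c: "qnum 2 * qnum (int a + 1) = qnum (int a + 2) + qnum (int a)"
    using qnum_2_mult[of "int a + 1"] by (simp add: add.commute)
  note c' = c[unfolded add.commute[of "int a" 1]]
  have i2: "qnum (int (Suc a) + 1) = qnum (int a + 2)" "qnum (int (Suc a)) = qnum (int a + 1)"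
    by (simp_all add: add.commute)
  have "qnum (int a + 2) \<odot> S1 i (Suc a) = S1 i a * B ?j + Bd ?j a * ?s"
    unfolding S1_def
    by (simp only: ring_distribs sm_distrib sm_simps mult.assoc Bd_B Bd_B' i2)
       (simp add: algebra_simps c' sm_distrib)
  moreover have "P (Suc a) (S1 i a * B ?j + Bd ?j a * ?s)"
    by (rule bar_fixed.plus[OF bar_fixed_times[OF Suc P_B[OF order_refl]] bar_fixed_times[OF bar_fixed_dpow P_serre[of ?j, unfolded tau_tau]]])
      simp_all
  ultimately have "P (Suc a) (qnum (int a + 2) \<odot> S1 i (Suc a))" by (simp only:)
  then show ?case by (rule bar_fixed_unscale) simp_all
qed

lemma S2_low: "P b (S2 i b)"
proof (induction b)
  case 0
  have "Bd k (Suc 0) = B k" for k by simp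
  then show ?case by (simp add: S2_def bar_fixed_0)
next
  case (Suc b)
  let ?j = "tau i"
  let ?s = "B i * B i * B ?j - qnum 2 \<odot> (B i * B ?j * B i) + B ?j * B i * B i"
  have c: "qnum 2 * qnum (int b + 1) = qnum (int b + 2) + qnum (int b)"
    using qnum_2_mult[of "int b + 1"] by (simp add: add.commute)
  note c' = c[unfolded add.commute[of "int b" 1]]
  have i2: "qnum (int (Suc b) + 1) = qnum (int b + 2)" "qnum (int (Suc b)) = qnum (int b + 1)"
    by (simp_all add: add.commute)
  have "qnum (int b + 2) \<odot> S2 i (Suc b) = B i * S2 i b - ?s * Bd i b"
    unfolding S2_def
    by (simp only: ring_distribs sm_distrib sm_simps mult.assoc B_Bd B_Bd' i2)
       (simp add: algebra_simps c' sm_distrib)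
  moreover have "P (Suc b) (B i * S2 i b - ?s * Bd i b)"
    by (rule bar_fixed_diff[OF bar_fixed_times[OF P_B[OF order_refl] Suc] bar_fixed_times[OF P_serre bar_fixed_dpow]]) simp_all
  ultimately have "P (Suc b) (qnum (int b + 2) \<odot> S2 i (Suc b))" by (simp only:)
  then show ?case by (rule bar_fixed_unscale) simp_all
qed

lemma Bm_eq: "Bm i (int a) (int b) (int c) = Bd (tau i) a * (Bd i b * Bd (tau i) c)"
  by (simp add: Bmon_def mult.assoc)

text \<open>\<open>S1\<close> carries B i past the outer power and \<open>S2\<close> into the inner
  one; the coefficients combine to [b][a+1] - [a][b+1] = [b - a]. The remainder has two factors B
  less than the terms compared.\<close>

lemma B_inner:
  "P (a + b + c) (B i * Bm i (int (Suc a)) (int b) (int c) -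
     (qnum (int c + 1) \<odot> Bm i (int a) (int (Suc b)) (int (Suc c))
      + qnum (int b - int a) \<odot> Bm i (int (Suc a)) (int (Suc b)) (int c)))"
proof -
  have c: "qnum (int b - int a) = qnum (int b) * qnum (int a + 1) - qnum (int a) * qnum (int b + 1)"
    using qnum_cross[of "int a" "int b"] by (simp add: mult.commute)
  have "B i * Bm i (int (Suc a)) (int b) (int c) -
     (qnum (int c + 1) \<odot> Bm i (int a) (int (Suc b)) (int (Suc c))
      + qnum (int b - int a) \<odot> Bm i (int (Suc a)) (int (Suc b)) (int c)) =
     S1 i a * (Bd i b * Bd (tau i) c) + Bd (tau i) a * (S2 i b * Bd (tau i) c)"
    unfolding Bm_eq S1_def S2_def
    by (simp only: ring_distribs sm_distrib sm_simps mult.assoc B_Bd B_Bd' Bd_B Bd_B' c) (simp add: algebra_simps)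
  also have "P (a + b + c) \<dots>"
    by (rule bar_fixed.plus[OF bar_fixed_times[OF S1_low bar_fixed_times[OF bar_fixed_dpow bar_fixed_dpow order_refl]]
        bar_fixed_times[OF bar_fixed_dpow bar_fixed_times[OF S2_low bar_fixed_dpow order_refl]]]) simp_all
  finally show ?thesis .
qed

lemma B_inner_0: "B i * Bm i 0 (int b) (int c) = qnum (int b + 1) \<odot> Bm i 0 (int (Suc b)) (int c)"
  by (simp only: Bmon_def mult.assoc dpow_0 mult_1_left B_Bd')

lemma B_outer: "B (tau i) * Bm i (int a) (int b) (int c) = qnum (int a + 1) \<odot> Bm i (int (Suc a)) (int b) (int c)"
  unfolding Bm_eq by (simp only: B_Bd')

text \<open>At the tie b = a + c monomials with different inner nodes share their leading term.
  Multiplying the case s by B i and then by \<open>B (tau i)\<close>, and resolving by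
  \<open>B_inner\<close>, links neighbouring values of c in the case s + 1; hence the double
  induction.\<close>

lemma balanced: "a + c = s \<Longrightarrow> P (2 * s - 1) (Bm i (int a) (int s) (int c) - Bm (tau i) (int c) (int s) (int a))"
proof (induction s arbitrary: a c)
  case 0
  then show ?case by (simp add: Bmon_def bar_fixed_0)
next
  case (Suc s)
  let ?j = "tau i" and ?S = "Suc s"
  from Suc.prems show ?case
  proof (induction c arbitrary: a)
    case 0
    then show ?case by (simp add: Bmon_def bar_fixed_0)
  next
    case (Suc c a')
    show ?case
    proof (cases a')
      case 0
      then show ?thesis using Suc.prems by (simp add: Bmon_def bar_fixed_0)
    next
      case (Suc a)
      have s: "s = Suc a + c" using Suc.prems Suc by simp
      define e1 where "e1 = Bm i (int (Suc a)) (int s) (int c) - Bm ?j (int c) (int s) (int (Suc a))"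
      have e1: "P (2 * s - 1) e1" unfolding e1_def using s by (intro \<open>\<And>a c. a + c = s \<Longrightarrow> _\<close>) simp
      define r1 where "r1 = B i * Bm i (int (Suc a)) (int s) (int c) -
         (qnum (int c + 1) \<odot> Bm i (int a) (int ?S) (int (Suc c))
         + qnum (int s - int a) \<odot> Bm i (int (Suc a)) (int ?S) (int c))"
      have r1: "P (a + s + c) r1" unfolding r1_def by (rule B_inner)
      \<comment> \<open>The first monomial violates b \<ge> a + c by one; up to shorter words it is
        the sum of the two admissible ones subtracted here.\<close>
      define f where "f = Bm ?j (int (Suc c)) (int s) (int (Suc a)) - Bm i (int a) (int ?S) (int (Suc c))
         - Bm i (int (Suc a)) (int ?S) (int c)"
      have sc: "int s - int a = int c + 1" using s by simp
      have "qnum (int c + 1) \<odot> f = r1 - B i * e1"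
        unfolding f_def e1_def r1_def sc using B_outer[of ?j c s "Suc a"]
        by (simp add: ring_distribs sm_distrib)
      moreover have "P (2 * s) (r1 - B i * e1)"
        using s by (intro bar_fixed_diff bar_fixed_mono[OF r1] bar_fixed_times[OF P_B[OF order_refl] e1]) auto
      ultimately have "P (2 * s) (qnum (int c + 1) \<odot> f)" by simp
      then have f: "P (2 * s) f" by (rule bar_fixed_unscale) simp_all
      define r2 where "r2 = B ?j * Bm ?j (int (Suc c)) (int s) (int (Suc a)) -
         (qnum (int (Suc a) + 1) \<odot> Bm ?j (int c) (int ?S) (int (Suc (Suc a)))
         + qnum (int s - int c) \<odot> Bm ?j (int (Suc c)) (int ?S) (int (Suc a)))"
      have r2: "P (c + s + Suc a) r2" unfolding r2_def by (rule B_inner)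
      \<comment> \<open>The wanted difference for the preceding value of c, known from the inner
        induction.\<close>
      define e3 where "e3 = Bm i (int (Suc (Suc a))) (int ?S) (int c) - Bm ?j (int c) (int ?S) (int (Suc (Suc a)))"
      have e3: "P (2 * ?S - 1) e3" unfolding e3_def using Suc.IH[of "Suc (Suc a)"] s by simp
      have sa: "int s - int c = int a + 1" using s by simp
      have "qnum (int a + 1) \<odot> (Bm i (int (Suc a)) (int ?S) (int (Suc c)) - Bm ?j (int (Suc c)) (int ?S) (int (Suc a)))
        = r2 - B ?j * f - qnum (int (Suc a) + 1) \<odot> e3"
        unfolding f_def r2_def e3_def sa using B_outer[of i a ?S "Suc c"] B_outer[of i "Suc a" ?S c]
        by (simp add: ring_distribs sm_distrib)
      moreover have "P (2 * ?S - 1) (r2 - B ?j * f - qnum (int (Suc a) + 1) \<odot> e3)"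
        using s by (intro bar_fixed_diff bar_fixed_mono[OF r2] bar_fixed_times[OF P_B[OF order_refl] f] bar_fixed_sm e3) auto
      ultimately have "P (2 * ?S - 1) (qnum (int a + 1) \<odot> (Bm i (int (Suc a)) (int ?S) (int (Suc c)) - Bm ?j (int (Suc c)) (int ?S) (int (Suc a))))"
        by simp
      then show ?thesis unfolding Suc by (rule bar_fixed_unscale) simp_all
    qed
  qed
qed

lemma kk_BB: "kk N1 * B b = qq powi (if b = N1 then - 3 else 3) \<odot> (B b * kk N1)"
  "kk N2 * B b = qq powi (if b = N1 then 3 else - 3) \<odot> (B b * kk N2)"
proof -
  have *: "kk i * B i = qq powi (- 3) \<odot> (B i * kk i)" "kk i * B (tau i) = qq powi 3 \<odot> (B (tau i) * kk i)" for i
  proof -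
    define t where "t = inverse qq"
    have pw: "qq powi (- 1) = t" "qq powi 1 = qq" "qq powi (- 2) = t * t" "qq powi 2 = qq * qq"
      "qq powi (- 3) = t * (t * t)" "qq powi 3 = qq * (qq * qq)"
      by (simp_all add: t_def power_int_minus power2_eq_square power3_eq_cube)
    have qt: "qq * t = 1" "t * qq = 1" "qq * (t * z) = z" "t * (qq * z) = z" for z
      by (simp_all add: t_def)
    note mv = KK_past_EE KK_past_FF KK_EE' KKinv_EE' KK_FF' KKinv_FF' cartan_simps minus_minus pw
    note kc = KKinv_KK_comm KKinv_past_KK KKinv_KKinv[of "tau i" i]
    show "kk i * B i = qq powi (- 3) \<odot> (B i * kk i)"
      unfolding BB_eq kk_def
      by (simp only: ring_distribs mult.assoc sm_simps sm_distrib mv kc mult_ac qt)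
    show "kk i * B (tau i) = qq powi 3 \<odot> (B (tau i) * kk i)"
      unfolding BB_eq kk_def tau_tau
      by (simp only: ring_distribs mult.assoc sm_simps sm_distrib mv kc mult_ac qt)
  qed
  show "kk N1 * B b = qq powi (if b = N1 then - 3 else 3) \<odot> (B b * kk N1)"
    "kk N2 * B b = qq powi (if b = N1 then 3 else - 3) \<odot> (B b * kk N2)"
    using *[of N1] *[of N2] by (cases b; simp)+
qed

text \<open>The exponents for \<open>kk N1\<close> and \<open>kk N2\<close> are opposite, so the two
  new coefficients are again bar conjugate.\<close>

lemma kap_B: "\<exists>c'. kap c * B b = B b * kap c'"
proof -
  have "kap c * B b = B b * kap (c * qq powi (if b = N1 then - 3 else 3))"
    unfolding kap_def by (simp add: ring_distribs kk_BB)
  then show ?thesis by blast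
qed

lemma kap_Bd: "\<exists>c'. kap c * Bd b k = Bd b k * kap c'"
proof -
  have "\<exists>c'. kap c * B b ^ k = B b ^ k * kap c'"
  proof (induction k arbitrary: c)
    case (Suc k)
    obtain c' where "kap c * B b = B b * kap c'" using kap_B by blast
    moreover obtain c'' where "kap c' * B b ^ k = B b ^ k * kap c''" using Suc by blast
    ultimately have "kap c * B b ^ Suc k = B b ^ Suc k * kap c''"
      by (metis mult.assoc power_Suc)
    then show ?case by blast
  qed auto
  then show ?thesis by (auto simp: dpow_nat)
qed

section \<open>Spanning of the bar-fixed ring by ordered monomials\<close>

definition Idx :: "nat \<Rightarrow> (nat \<times> nat \<times> nat) set" where
  "Idx d = {(p, r, c). p + r \<le> d \<and> c \<le> p \<and> c \<le> r}"

lemma finite_Idx: "finite (Idx d)"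
  by (rule finite_subset[of _ "{..d} \<times> {..d} \<times> {..d}"]) (auto simp: Idx_def)

lemma Idx_mono: "d \<le> e \<Longrightarrow> Idx d \<subseteq> Idx e"
  by (auto simp: Idx_def)

definition inner :: "nat \<times> nat \<times> nat \<Rightarrow> node" where
  "inner = (\<lambda>(p, r, c). if p \<le> r then N2 else N1)"

definition smin :: "nat \<times> nat \<times> nat \<Rightarrow> nat" where
  "smin = (\<lambda>(p, r, c). min p r)"

definition smax :: "nat \<times> nat \<times> nat \<Rightarrow> nat" where
  "smax = (\<lambda>(p, r, c). max p r)"

definition thd :: "nat \<times> nat \<times> nat \<Rightarrow> nat" where
  "thd = (\<lambda>(p, r, c). c)"

lemma mon_Idx:
  assumes "t \<in> Idx d"
  shows "mon G t = G (inner t) (int (smin t - thd t)) (int (smax t)) (int (thd t))"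
    "thd t \<le> smin t" "smin t \<le> smax t" "smin t + smax t \<le> d"
  using assms by (auto simp: Idx_def mon_def inner_def smin_def smax_def thd_def of_nat_diff)

lemma kap_mon:
  assumes "t \<in> Idx d"
  shows "\<exists>c'. kap c * mon Bm t = mon Bm t * kap c'"
proof -
  obtain c1 where 1: "kap c * Bd (tau (inner t)) (smin t - thd t) = Bd (tau (inner t)) (smin t - thd t) * kap c1" using kap_Bd by blast
  obtain c2 where 2: "kap c1 * Bd (inner t) (smax t) = Bd (inner t) (smax t) * kap c2" using kap_Bd by blast
  obtain c3 where 3: "kap c2 * Bd (tau (inner t)) (thd t) = Bd (tau (inner t)) (thd t) * kap c3" using kap_Bd by blast
  have "kap c * mon Bm t = mon Bm t * kap c3"
    unfolding mon_Idx(1)[OF assms] Bmon_def using 1 2 3 by (metis mult.assoc)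
  then show ?thesis by blast
qed

text \<open>The coefficients of degree 0 stand on the right, where they meet the vector to which the
  monomials are applied.\<close>

definition PR :: "nat \<Rightarrow> Uq \<Rightarrow> bool" where
  "PR d x \<longleftrightarrow> (\<exists>w. (\<forall>t. P 0 (w t)) \<and> x = (\<Sum>t\<in>Idx d. mon Bm t * w t))"

lemma PR_add: "PR d x \<Longrightarrow> PR d y \<Longrightarrow> PR d (x + y)"
proof -
  assume "PR d x" "PR d y"
  then obtain w w' where "\<forall>t. P 0 (w t)" "x = (\<Sum>t\<in>Idx d. mon Bm t * w t)"
    "\<forall>t. P 0 (w' t)" "y = (\<Sum>t\<in>Idx d. mon Bm t * w' t)" by (auto simp: PR_def)
  then show ?thesis
    unfolding PR_def
    by (intro exI[of _ "\<lambda>t. w t + w' t"]) (simp add: bar_fixed.plus sum.distrib ring_distribs)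
qed

lemma PR_0: "PR d 0"
  unfolding PR_def by (intro exI[of _ "\<lambda>t. 0"]) (simp add: bar_fixed_0)

lemma PR_sum: "(\<And>t. t \<in> I \<Longrightarrow> PR d (f t)) \<Longrightarrow> PR d (\<Sum>t\<in>I. f t)"
  by (induction I rule: infinite_finite_induct) (simp_all add: PR_0 PR_add)

lemma PR_mon: "t \<in> Idx d \<Longrightarrow> P 0 p \<Longrightarrow> PR d (mon Bm t * p)"
  unfolding PR_def
  by (intro exI[of _ "\<lambda>u. if u = t then p else 0"]) (simp add: bar_fixed_0 finite_Idx if_distrib sum.delta cong: if_cong)

lemma PR_mono: "PR d x \<Longrightarrow> d \<le> e \<Longrightarrow> PR e x"
proof -
  assume "PR d x" "d \<le> e"
  then obtain w where w: "\<forall>t. P 0 (w t)" "x = (\<Sum>t\<in>Idx d. mon Bm t * w t)" by (auto simp: PR_def)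
  show ?thesis unfolding w(2)
    using w(1) Idx_mono[OF \<open>d \<le> e\<close>] by (intro PR_sum PR_mon) auto
qed

lemma PR_left:
  assumes "PR e y" "\<And>t p. t \<in> Idx e \<Longrightarrow> P 0 p \<Longrightarrow> PR d (x * (mon Bm t * p))"
  shows "PR d (x * y)"
proof -
  obtain w where w: "\<forall>t. P 0 (w t)" "y = (\<Sum>t\<in>Idx e. mon Bm t * w t)"
    using assms(1) by (auto simp: PR_def)
  show ?thesis unfolding w(2) sum_distrib_left
    using w(1) by (intro PR_sum assms(2)) auto
qed

lemma PR_scal: "PR d x \<Longrightarrow> bar c = c \<Longrightarrow> PR d (scal c * x)"
proof (erule PR_left)
  fix t p assume "bar c = c" "t \<in> Idx d" "P 0 p"
  then show "PR d (scal c * (mon Bm t * p))"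
    using PR_mon[of t d "c \<odot> p"] bar_fixed_sm[of vs 0 p c] by (simp add: sm_def[symmetric])
qed

text \<open>\<open>mon\<close> resolves ties in favour of the inner node N2. A tie with inner node
  N1 is exchanged by \<open>balanced\<close>, at the price of a remainder of smaller degree.\<close>

lemma PR_Bm:
  assumes IH: "\<And>e x. e < d \<Longrightarrow> P e x \<Longrightarrow> PR e x"
    and "s \<le> b" "c \<le> s" "s + b \<le> d" "P 0 p"
  shows "PR d (Bm i (int (s - c)) (int b) (int c) * p)"
proof -
  consider "i = N2" | "i = N1" "s < b" | "i = N1" "s = b" "0 < s" | "i = N1" "s = 0" "b = 0"
    using assms(2) by (cases i; cases "s < b"; cases "s = 0") auto
  then show ?thesis
  proof cases
    case 1
    have "(s, b, c) \<in> Idx d" using assms by (simp add: Idx_def)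
    from PR_mon[OF this assms(5)] show ?thesis using 1 assms by (simp add: mon_def of_nat_diff)
  next
    case 2
    have "(b, s, c) \<in> Idx d" using assms by (simp add: Idx_def)
    from PR_mon[OF this assms(5)] show ?thesis using 2 assms by (simp add: mon_def of_nat_diff)
  next
    case 3
    let ?l = "Bm N1 (int (s - c)) (int s) (int c) - Bm N2 (int c) (int s) (int (s - c))"
    have "(s, s, s - c) \<in> Idx d" using assms 3 by (simp add: Idx_def)
    from PR_mon[OF this assms(5)] have 4: "PR d (Bm N2 (int c) (int s) (int (s - c)) * p)"
      using assms by (simp add: mon_def of_nat_diff)
    have "P (2 * s - 1) (?l * p)"
      using balanced[of "s - c" c s N1] assms by (intro bar_fixed_times[OF _ assms(5)]) auto
    then have "PR (2 * s - 1) (?l * p)"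
      by (rule IH[rotated]) (use 3 assms in simp)
    then have "PR d (?l * p)"
      by (rule PR_mono) (use 3 assms in simp)
    from PR_add[OF 4 this] show ?thesis using 3 by (simp add: ring_distribs)
  next
    case 4
    have "(0, 0, 0) \<in> Idx d" by (simp add: Idx_def)
    from PR_mon[OF this assms(5)] show ?thesis using 4 assms by (simp add: mon_def Bmon_def)
  qed
qed

lemma PR_B_inner:
  assumes IH: "\<And>e' x. e' \<le> e \<Longrightarrow> P e' x \<Longrightarrow> PR e' x"
    and "s \<le> b" "c \<le> s" "s + b \<le> e" "P 0 p"
  shows "PR (Suc e) (B i * (Bm i (int (s - c)) (int b) (int c) * p))"
proof -
  have R: "PR (Suc e) (Bm i (int (s - c')) (int (Suc b)) (int c') * (d \<odot> p))" if "c' \<le> s" "bar d = d" for c' d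
    using that assms by (intro PR_Bm bar_fixed_sm) auto
  show ?thesis
  proof (cases "s - c")
    case 0
    then have "c = s" using assms by simp
    then show ?thesis
      using R[of c "qnum (int b + 1)"] B_inner_0[of i b c] by (simp flip: mult.assoc)
  next
    case (Suc a)
    then have sa: "s - Suc c = a" "s - c = Suc a" and "Suc c \<le> s" by auto
    let ?M = "qnum (int c + 1) \<odot> Bm i (int a) (int (Suc b)) (int (Suc c))
      + qnum (int b - int a) \<odot> Bm i (int (Suc a)) (int (Suc b)) (int c)"
    let ?l = "B i * Bm i (int (Suc a)) (int b) (int c) - ?M"
    have "P (s + b - 1) (?l * p)"
      by (rule bar_fixed_times[OF B_inner assms(5)]) (use Suc in auto)
    then have "PR (Suc e) (?l * p)"
      using assms by (intro PR_mono[OF IH]) auto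
    moreover have "PR (Suc e) (?M * p)"
      using PR_add[OF R[of "Suc c" "qnum (int c + 1)"] R[of c "qnum (int b - int a)"]] \<open>Suc c \<le> s\<close>
      unfolding sa by (simp add: ring_distribs)
    ultimately have "PR (Suc e) (?l * p + ?M * p)" by (rule PR_add)
    moreover have "?l * p + ?M * p = B i * (Bm i (int (Suc a)) (int b) (int c) * p)"
      by (simp only: ring_distribs mult.assoc) simp
    ultimately show ?thesis unfolding sa by simp
  qed
qed

lemma PR_B:
  assumes IH: "\<And>e' x. e' \<le> e \<Longrightarrow> P e' x \<Longrightarrow> PR e' x"
    and t: "t \<in> Idx e" and p: "P 0 p"
  shows "PR (Suc e) (B x * (mon Bm t * p))"
proof -
  define i s b c where "i = inner t" and "s = smin t" and "b = smax t" and "c = thd t"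
  have *: "mon Bm t = Bm i (int (s - c)) (int b) (int c)" "c \<le> s" "s \<le> b" "s + b \<le> e"
    using mon_Idx[OF t] by (simp_all add: i_def s_def b_def c_def)
  consider "x = i" | "x = tau i" "s < b" | "x = tau i" "s = b" using *(3) by (metis node_cases le_neq_implies_less)
  then show ?thesis
  proof cases
    case 1
    show ?thesis unfolding *(1) 1 by (rule PR_B_inner) (use IH * p in auto)
  next
    case 2
    have "PR (Suc e) (Bm i (int (Suc s - c)) (int b) (int c) * (qnum (int (s - c) + 1) \<odot> p))"
      using 2 * p IH by (intro PR_Bm bar_fixed_sm) auto
    moreover have "B x * (mon Bm t * p) = Bm i (int (Suc s - c)) (int b) (int c) * (qnum (int (s - c) + 1) \<odot> p)"
      unfolding *(1) 2(1) mult.assoc[symmetric] B_outer using *(2) by (simp add: Suc_diff_le)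
    ultimately show ?thesis by simp
  next
    case 3
    \<comment> \<open>At a tie another factor of the outer node would violate b \<ge> a + c. After
      the exchange of nodes it belongs to the inner node, where \<open>PR_B_inner\<close>
      applies.\<close>
    let ?l = "Bm i (int (s - c)) (int s) (int c) - Bm (tau i) (int c) (int s) (int (s - c))"
    have l: "P (2 * s - 1) ?l" using balanced[of "s - c" c s i] * by simp
    have "PR (Suc e) (B x * (?l * p))"
    proof (cases "s = 0")
      case True
      then show ?thesis using * by (simp add: Bmon_def PR_0)
    next
      case False
      have "P (2 * s) (B x * (?l * p))"
        using False by (intro bar_fixed_times[OF P_B[OF order_refl] bar_fixed_times[OF l p order_refl]]) auto
      then show ?thesis using * 3 by (intro PR_mono[OF IH]) auto
    qed
    moreover have "PR (Suc e) (B x * (Bm (tau i) (int (s - (s - c))) (int s) (int (s - c)) * p))"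
      unfolding 3(1) by (rule PR_B_inner) (use IH * p 3 in auto)
    ultimately have "PR (Suc e) (B x * (?l * p) + B x * (Bm (tau i) (int c) (int s) (int (s - c)) * p))"
      using *(2) by (intro PR_add) auto
    then show ?thesis unfolding *(1) 3(2)[symmetric] by (simp add: ring_distribs)
  qed
qed

text \<open>Remainders are covered by the hypothesis for total degree below D, while the induction
  over the generation of x attaches its factors one at a time.\<close>

lemma PR_prod:
  assumes IH: "\<And>e' x. e' < D \<Longrightarrow> P e' x \<Longrightarrow> PR e' x"
  shows "P d x \<Longrightarrow> PR e y \<Longrightarrow> d + e \<le> D \<Longrightarrow> PR (d + e) (x * y)"
proof (induction arbitrary: e y rule: bar_fixed.induct)
  case (scal c d)
  then show ?case by (intro PR_mono[OF PR_scal]) auto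
next
  case (kap d c)
  have "PR e (kap c * y)"
  proof (rule PR_left[OF kap.prems(1)])
    fix t p assume tp: "t \<in> Idx e" "P 0 p"
    obtain c' where "kap c * mon Bm t = mon Bm t * kap c'" using kap_mon[OF tp(1)] by blast
    moreover have "P 0 (kap c' * p)" by (rule bar_fixed_times[OF bar_fixed.kap[of vs 0] tp(2)]) simp
    ultimately show "PR e (kap c * (mon Bm t * p))"
      using PR_mon[OF tp(1)] by (simp flip: mult.assoc) (simp add: mult.assoc)
  qed
  then show ?case by (rule PR_mono) simp
next
  case (BB d i)
  have "PR (Suc e) (B i * y)"
    by (rule PR_left[OF BB.prems(1)], rule PR_B) (use IH BB.prems in auto)
  then show ?case by (rule PR_mono) simp
next
  case (plus d x z)
  then show ?case by (simp add: ring_distribs PR_add)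
next
  case (times d x d' z)
  then have "PR (d + (d' + e)) (x * (z * y))" by simp
  then show ?case by (simp add: mult.assoc add.assoc)
qed

lemma PR_1: "PR 0 1"
proof -
  have "(0, 0, 0) \<in> Idx 0" by (simp add: Idx_def)
  from PR_mon[OF this bar_fixed_1] show ?thesis by (simp add: mon_def Bmon_def)
qed

theorem P_spanned: "P d x \<Longrightarrow> PR d x"
proof (induction d arbitrary: x rule: less_induct)
  case (less d)
  show ?case using PR_prod[OF less.IH less.prems PR_1] by simp
qed

text \<open>Meant for b > M i + c, where a power of B i exceeding M i appears on the right, next to
  the vector. The clause for c = 0 compensates for the truncated r + c - 1 at r = 0.\<close>

lemma high_power_reduction:
  "c \<le> r \<Longrightarrow> \<exists>p p'. P (2 * c) p \<and> P (r + c - 1) p' \<and> (c = 0 \<longrightarrow> p' = 0) \<and>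
     Bd i r * Bd (tau i) c = p * Bd i (r - c) + p'"
proof (induction c arbitrary: r)
  case 0
  then show ?case by (intro exI[of _ 1] exI[of _ 0]) (simp add: bar_fixed_1 bar_fixed_0)
next
  case (Suc c)
  then obtain r' where r: "r = Suc r'" "c \<le> r'" by (cases r) auto
  let ?j = "tau i"
  obtain p p' where p: "P (2 * c) p" "P (r' + c - 1) p'" "c = 0 \<longrightarrow> p' = 0"
    "Bd i r' * Bd ?j c = p * Bd i (r' - c) + p'" using Suc.IH[OF r(2)] by blast
  \<comment> \<open>Since B_i^(r'+1) is B_i B_i^(r') divided by [r'+1], this factor absorbs both
    terms of \<open>S2\<close> that begin on the left with single factors.\<close>
  define g where "g = B i * B ?j - (qnum (int r') / qnum (int r' + 1)) \<odot> (B ?j * B i)"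
  have g: "P 2 g"
    unfolding g_def by (intro bar_fixed_diff bar_fixed_sm bar_fixed_times[OF P_B[OF order_refl] P_B[OF order_refl]]) simp_all
  have Bd: "Bd k (Suc l) = inverse (qnum (int l + 1)) \<odot> (B k * Bd k l)" for k l
    by (simp add: B_Bd)
  have "Bd i r * B ?j = g * Bd i r' - S2 i r'"
    unfolding g_def S2_def r(1)
    by (simp add: ring_distribs mult.assoc B_Bd sm_distrib)
  then have "Bd i r * B ?j * Bd ?j c = (g * Bd i r' - S2 i r') * Bd ?j c" by simp
  also have "\<dots> = g * p * Bd i (r' - c) + (g * p' - S2 i r' * Bd ?j c)"
    by (simp add: ring_distribs mult.assoc p(4))
  finally have eq: "Bd i r * (B ?j * Bd ?j c) = g * p * Bd i (r' - c) + (g * p' - S2 i r' * Bd ?j c)"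
    by (simp add: mult.assoc)
  define u where "u = inverse (qnum (int c + 1))"
  have "Bd i r * Bd ?j (Suc c) = (u \<odot> (g * p)) * Bd i (r - Suc c) + u \<odot> (g * p' - S2 i r' * Bd ?j c)"
    unfolding Bd[of ?j c] u_def[symmetric] r(1) using eq[unfolded r(1)] by (simp add: sm_distrib)
  moreover have "P (2 * Suc c) (u \<odot> (g * p))"
    by (intro bar_fixed_sm bar_fixed_times[OF g p(1)]) (simp_all add: u_def)
  moreover have "P (r + Suc c - 1) (g * p')"
    using p(2,3) r by (cases "c = 0") (auto simp: bar_fixed_0 intro!: bar_fixed_times[OF g p(2)])
  then have "P (r + Suc c - 1) (u \<odot> (g * p' - S2 i r' * Bd ?j c))"
    using r by (intro bar_fixed_sm bar_fixed_diff bar_fixed_times[OF S2_low bar_fixed_dpow]) (simp_all add: u_def)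
  ultimately show ?case by blast
qed

end

section \<open>Spanning sets in modules of the iquantum group\<close>

text \<open>W0 is required to be stable only under bar-fixed elements of degree 0, not to be a
  subspace over Q(q), because on pairs the scalars act in a twisted way.\<close>

locale iqg_mod = iqg vs + uq_mod act
  for vs :: "node \<Rightarrow> int" and act :: "Uq \<Rightarrow> 'v :: ab_group_add \<Rightarrow> 'v" (infixr \<open>\<cdot>\<close> 68) +
  fixes W0 :: "'v set"
  assumes W0_0: "0 \<in> W0"
    and W0_add: "w \<in> W0 \<Longrightarrow> w' \<in> W0 \<Longrightarrow> w + w' \<in> W0"
    and W0_P: "P 0 p \<Longrightarrow> w \<in> W0 \<Longrightarrow> p \<cdot> w \<in> W0"
begin

definition VR :: "(nat \<times> nat \<times> nat \<Rightarrow> bool) \<Rightarrow> nat \<Rightarrow> 'v \<Rightarrow> bool" where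
  "VR A d v \<longleftrightarrow> (\<exists>f. (\<forall>t. f t \<in> W0) \<and> v = (\<Sum>t\<in>{t\<in>Idx d. A t}. mon Bm t \<cdot> f t))"

lemma finite_IdxA: "finite {t \<in> Idx d. A t}"
  using finite_Idx by (rule rev_finite_subset) auto

lemma VR_add: "VR A d v \<Longrightarrow> VR A d v' \<Longrightarrow> VR A d (v + v')"
proof -
  assume "VR A d v" "VR A d v'"
  then obtain f f' where f: "\<forall>t. f t \<in> W0" "v = (\<Sum>t\<in>{t\<in>Idx d. A t}. mon Bm t \<cdot> f t)"
    "\<forall>t. f' t \<in> W0" "v' = (\<Sum>t\<in>{t\<in>Idx d. A t}. mon Bm t \<cdot> f' t)" by (auto simp: VR_def)
  have "v + v' = (\<Sum>t\<in>{t\<in>Idx d. A t}. mon Bm t \<cdot> (f t + f' t))"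
    unfolding f(2,4) act_plus sum.distrib ..
  then show ?thesis unfolding VR_def using f(1,3) W0_add by (intro exI[of _ "\<lambda>t. f t + f' t"]) simp
qed

lemma VR_0: "VR A d 0"
  unfolding VR_def by (intro exI[of _ "\<lambda>t. 0"]) (simp add: W0_0)

lemma VR_sum: "(\<And>t. t \<in> I \<Longrightarrow> VR A d (f t)) \<Longrightarrow> VR A d (\<Sum>t\<in>I. f t)"
  by (induction I rule: infinite_finite_induct) (simp_all add: VR_0 VR_add)

lemma VR_mon:
  assumes "t \<in> Idx d" "A t" "w \<in> W0"
  shows "VR A d (mon Bm t \<cdot> w)"
proof -
  let ?f = "\<lambda>u. if u = t then w else 0"
  have "(\<Sum>u\<in>{t\<in>Idx d. A t}. mon Bm u \<cdot> ?f u) = (\<Sum>u\<in>{t\<in>Idx d. A t}. if u = t then mon Bm t \<cdot> w else 0)"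
    by (intro sum.cong) auto
  also have "\<dots> = mon Bm t \<cdot> w" using assms by (simp add: sum.delta finite_IdxA)
  finally show ?thesis unfolding VR_def using assms W0_0 by (intro exI[of _ ?f]) auto
qed

lemma VR_mono: "VR A d v \<Longrightarrow> d \<le> e \<Longrightarrow> VR A e v"
proof -
  assume "VR A d v" "d \<le> e"
  then obtain f where f: "\<forall>t. f t \<in> W0" "v = (\<Sum>t\<in>{t\<in>Idx d. A t}. mon Bm t \<cdot> f t)"
    by (auto simp: VR_def)
  show ?thesis unfolding f(2) using f(1) Idx_mono[OF \<open>d \<le> e\<close>] by (intro VR_sum VR_mon) auto
qed

lemma spanned: "P d x \<Longrightarrow> w \<in> W0 \<Longrightarrow> VR (\<lambda>_. True) d (x \<cdot> w)"
proof -
  assume "P d x" "w \<in> W0"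
  then obtain p where p: "\<forall>t. P 0 (p t)" "x = (\<Sum>t\<in>Idx d. mon Bm t * p t)"
    using P_spanned by (auto simp: PR_def)
  show ?thesis unfolding p(2) sum_act act_mult
    using p(1) \<open>w \<in> W0\<close> by (intro VR_sum VR_mon W0_P) auto
qed

text \<open>If c > M (tau i), the rightmost power is absorbed into W0; if b > M i + c,
  \<open>high_power_reduction\<close> exposes a power of B i that is absorbed. Either way the degree
  drops.\<close>

lemma spanned_allowed:
  assumes W0_M: "\<And>i r w. w \<in> W0 \<Longrightarrow> M i < r \<Longrightarrow> Bd i r \<cdot> w \<in> W0"
  shows "P d x \<Longrightarrow> w \<in> W0 \<Longrightarrow> VR (allowed M) d (x \<cdot> w)"
proof (induction d arbitrary: x w rule: less_induct)
  case (less d)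
  have mon: "VR (allowed M) d (mon Bm t \<cdot> w)" if t: "t \<in> Idx d" and w: "w \<in> W0" for t w
  proof (cases "allowed M t")
    case True
    then show ?thesis using t w by (intro VR_mon)
  next
    case False
    define i s b c where "i = inner t" and "s = smin t" and "b = smax t" and "c = thd t"
    let ?j = "tau i"
    have *: "mon Bm t = Bm i (int (s - c)) (int b) (int c)" "c \<le> s" "s \<le> b" "s + b \<le> d"
      using mon_Idx[OF t] by (simp_all add: i_def s_def b_def c_def)
    have "M ?j < c \<or> M i + c < b"
      using False t by (cases t)
        (auto simp: allowed_def Idx_def i_def b_def c_def inner_def smax_def thd_def split: if_splits)
    then consider "M ?j < c" | "M i + c < b" by blast
    then show ?thesis
    proof cases
      case 1
      have "VR (allowed M) (s - c + b) ((Bd ?j (s - c) * Bd i b) \<cdot> Bd ?j c \<cdot> w)"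
        using 1 * w by (intro less.IH bar_fixed.times bar_fixed_dpow W0_M) auto
      then have "VR (allowed M) d ((Bd ?j (s - c) * Bd i b) \<cdot> Bd ?j c \<cdot> w)"
        by (rule VR_mono) (use * in auto)
      then show ?thesis by (simp add: *(1) Bmon_def act_mult)
    next
      case 2
      then have "c \<le> b" by simp
      then obtain p p' where p: "P (2 * c) p" "P (b + c - 1) p'" "Bd i b * Bd ?j c = p * Bd i (b - c) + p'"
        using high_power_reduction by blast
      have eq: "mon Bm t \<cdot> w = (Bd ?j (s - c) * p) \<cdot> Bd i (b - c) \<cdot> w + (Bd ?j (s - c) * p') \<cdot> w"
        unfolding *(1) Bmon_def using p(3) by (simp add: mult.assoc ring_distribs act_add act_mult)
      have "VR (allowed M) (s - c + 2 * c) ((Bd ?j (s - c) * p) \<cdot> Bd i (b - c) \<cdot> w)"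
        using 2 * w by (intro less.IH bar_fixed.times bar_fixed_dpow W0_M p) auto
      then have 3: "VR (allowed M) d ((Bd ?j (s - c) * p) \<cdot> Bd i (b - c) \<cdot> w)"
        by (rule VR_mono) (use * 2 in auto)
      have "VR (allowed M) (s - c + (b + c - 1)) ((Bd ?j (s - c) * p') \<cdot> w)"
        using 2 * w by (intro less.IH bar_fixed.times bar_fixed_dpow p) auto
      then have "VR (allowed M) d ((Bd ?j (s - c) * p') \<cdot> w)"
        by (rule VR_mono) (use * 2 in auto)
      with 3 show ?thesis unfolding eq by (rule VR_add)
    qed
  qed
  obtain p where p: "\<forall>t. P 0 (p t)" "x = (\<Sum>t\<in>Idx d. mon Bm t * p t)"
    using P_spanned[OF less.prems(1)] by (auto simp: PR_def)
  show ?case unfolding p(2) sum_act act_mult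
    using p(1) less.prems(2) by (intro VR_sum mon W0_P) auto
qed

end

section \<open>The graph of the bar involution\<close>

inductive bar_graph :: "(node \<Rightarrow> int) \<Rightarrow> Uq \<Rightarrow> Uq \<Rightarrow> bool" for vs where
  scal: "bar_graph vs (scal c) (scal (bar c))"
| BB: "bar_graph vs (BB vs i) (BB vs i)"
| kk: "bar_graph vs (kk i) (kk (tau i))"
| plus: "bar_graph vs u y \<Longrightarrow> bar_graph vs u' y' \<Longrightarrow> bar_graph vs (u + u') (y + y')"
| times: "bar_graph vs u y \<Longrightarrow> bar_graph vs u' y' \<Longrightarrow> bar_graph vs (u * u') (y * y')"

lemma bar_graph_sym: "bar_graph vs u y \<Longrightarrow> bar_graph vs y u"
proof (induction rule: bar_graph.induct)
  case (scal c)
  show ?case using bar_graph.scal[of vs "bar c"] by simp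
next
  case (kk i)
  show ?case using bar_graph.kk[of vs "tau i"] by simp
qed (auto intro: bar_graph.intros)

lemma bar_graph_Ui: "bar_graph vs u y \<Longrightarrow> u \<in> Ui vs"
  by (induction rule: bar_graph.induct) (auto intro: Ui.intros)

lemma Ui_bar_graph: "u \<in> Ui vs \<Longrightarrow> \<exists>y. bar_graph vs u y"
  by (induction rule: Ui.induct) (blast intro: bar_graph.intros)+

lemma bar_graph_sm: "bar_graph vs u y \<Longrightarrow> bar_graph vs (c \<odot> u) (bar c \<odot> y)"
  unfolding sm_def by (intro bar_graph.intros)

lemma bar_graph_minus: "bar_graph vs u y \<Longrightarrow> bar_graph vs (- u) (- y)"
  using bar_graph_sm[of vs u y "- 1"] by simp

lemma bar_graph_diff: "bar_graph vs u y \<Longrightarrow> bar_graph vs u' y' \<Longrightarrow> bar_graph vs (u - u') (y - y')"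
  using bar_graph.plus[of vs u y "- u'" "- y'"] bar_graph_minus by simp

lemma bar_graph_0: "bar_graph vs 0 0" and bar_graph_1: "bar_graph vs 1 1"
  using bar_graph.scal[of vs 0] bar_graph.scal[of vs 1] by (simp_all add: scal_0 scal_1)

lemma bar_graph_sum: "(\<And>t. t \<in> I \<Longrightarrow> bar_graph vs (f t) (g t)) \<Longrightarrow> bar_graph vs (\<Sum>t\<in>I. f t) (\<Sum>t\<in>I. g t)"
  by (induction I rule: infinite_finite_induct) (simp_all add: bar_graph_0 bar_graph.plus)

lemma bar_graph_dpow: "bar_graph vs (dpow (BB vs i) r) (dpow (BB vs i) r)"
proof (cases "r < 0")
  case False
  then obtain k where r: "r = int k" by (metis nonneg_int_cases not_less)
  have "bar_graph vs (BB vs i ^ k) (BB vs i ^ k)" by (induction k) (auto intro: bar_graph_1 bar_graph.intros)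
  from bar_graph_sm[OF this, of "inverse (qfact k)"] show ?thesis by (simp add: r dpow_nat)
qed (simp add: dpow_neg bar_graph_0)

lemma bar_graph_Bmon: "bar_graph vs (Bmon vs i a b c) (Bmon vs i a b c)"
  unfolding Bmon_def by (intro bar_graph.times bar_graph_dpow)

definition uu_act :: "Uq \<Rightarrow> Uq \<times> Uq \<Rightarrow> Uq \<times> Uq" where
  "uu_act x = (\<lambda>(u, v). (x * u, x * v))"

lemma uq_mod_uu_act: "uq_mod uu_act"
proof (rule uq_mod.intro)
  fix x y :: Uq and v w :: "Uq \<times> Uq"
  obtain a b where v: "v = (a, b)" by (cases v)
  obtain c d where w: "w = (c, d)" by (cases w)
  show "uu_act (x + y) v = uu_act x v + uu_act y v"
    unfolding v by (simp add: uu_act_def ring_distribs)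
  show "uu_act x (v + w) = uu_act x v + uu_act x w"
    unfolding v w by (simp add: uu_act_def ring_distribs)
  show "uu_act (x * y) v = uu_act x (uu_act y v)"
    unfolding v by (simp add: uu_act_def mult.assoc)
  show "uu_act 1 v = v"
    unfolding v by (simp add: uu_act_def)
qed

section \<open>Pairs with conjugate coefficients\<close>

context iqg begin

text \<open>The opposite exponents mean that moving the pair of Cartan elements past a monomial
  multiplies the two components by bar conjugate scalars.\<close>

lemma kk_mon:
  assumes "t \<in> Idx d"
  shows "\<exists>e. kk i * mon Bm t = qq powi e \<odot> (mon Bm t * kk i) \<and>
     kk (tau i) * mon Bm t = qq powi (- e) \<odot> (mon Bm t * kk (tau i))"
proof -
  define C where "C x \<longleftrightarrow> (\<exists>e. kk i * x = qq powi e \<odot> (x * kk i) \<and> kk (tau i) * x = qq powi (- e) \<odot> (x * kk (tau i)))" for x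
  have 1: "C 1" unfolding C_def by (rule exI[of _ 0]) simp
  have mult: "C (x * y)" if C: "C x" "C y" for x y
  proof -
    obtain e e' where e: "kk i * x = qq powi e \<odot> (x * kk i)" "kk (tau i) * x = qq powi (- e) \<odot> (x * kk (tau i))"
      "kk i * y = qq powi e' \<odot> (y * kk i)" "kk (tau i) * y = qq powi (- e') \<odot> (y * kk (tau i))"
      using C unfolding C_def by blast
    have "kk i * (x * y) = (kk i * x) * y" by (simp only: mult.assoc)
    also have "\<dots> = qq powi (e + e') \<odot> (x * y * kk i)"
      unfolding e(1) by (simp add: mult.assoc e(3) power_int_add)
    finally have 2: "kk i * (x * y) = qq powi (e + e') \<odot> (x * y * kk i)" .
    have "kk (tau i) * (x * y) = (kk (tau i) * x) * y" by (simp only: mult.assoc)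
    also have "\<dots> = (qq powi (- e) * qq powi (- e')) \<odot> (x * y * kk (tau i))"
      unfolding e(2) by (simp add: mult.assoc e(4))
    also have "qq powi (- e) * qq powi (- e') = qq powi (- (e + e'))"
      by (simp flip: power_int_add)
    finally show ?thesis using 2 unfolding C_def by blast
  qed
  have B: "C (B b)" for b
    unfolding C_def using kk_BB[of b]
    by (cases i; cases b) (auto intro: exI[of _ 3] exI[of _ "-3"])
  have "C (B b ^ k)" for b k
    by (induction k) (auto intro: 1 B mult)
  moreover have "C (c \<odot> x)" if "C x" for c x
    using that unfolding C_def by (auto simp: mult.commute)
  ultimately have "C (Bd b k)" for b k by (simp add: dpow_nat)
  then have "C (mon Bm t)" unfolding mon_Idx(1)[OF assms] Bmon_def by (intro mult)
  then show ?thesis by (simp add: C_def)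
qed

lemma W0_P_pairs:
  assumes W0_0: "(0, 0) \<in> W0"
    and add: "\<And>u v u' v'. (u, v) \<in> W0 \<Longrightarrow> (u', v') \<in> W0 \<Longrightarrow> (u + u', v + v') \<in> W0"
    and sm: "\<And>u v c. (u, v) \<in> W0 \<Longrightarrow> (c \<odot> u, bar c \<odot> v) \<in> W0"
    and kk: "\<And>u v i. (u, v) \<in> W0 \<Longrightarrow> (kk i * u, kk (tau i) * v) \<in> W0"
  shows "iqg_mod vs uu_act W0"
proof -
  interpret UU: uq_mod uu_act by (rule uq_mod_uu_act)
  have "uu_act p w \<in> W0" if "P d p" "d = 0" "w \<in> W0" for p d w
    using that
  proof (induction arbitrary: w rule: bar_fixed.induct)
    case (scal c d)
    then show ?case using sm[of "fst w" "snd w" c] by (cases w) (simp add: uu_act_def sm_def)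
  next
    case (kap d c)
    obtain u v where w: "w = (u, v)" by (cases w)
    have uv: "(u, v) \<in> W0" using kap w by simp
    have "(c \<odot> (kk N1 * u) + bar c \<odot> (kk N2 * u), bar c \<odot> (kk N2 * v) + c \<odot> (kk N1 * v)) \<in> W0"
      using add[OF sm[OF kk[OF uv, of N1], of c] sm[OF kk[OF uv, of N2], of "bar c"]] by simp
    then show ?case by (simp add: w uu_act_def kap_def ring_distribs add.commute)
  next
    case (plus d x y)
    then show ?case using add[of "fst (uu_act x w)" "snd (uu_act x w)" "fst (uu_act y w)" "snd (uu_act y w)"]
      by (simp add: UU.act_add plus_prod_def)
  next
    case (times d x e y)
    then show ?case by (simp add: UU.act_mult)
  qed simp
  then show ?thesis
    using W0_0 add by unfold_locales (auto simp: zero_prod_def)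
qed

end

text \<open>W0 holds the coefficient pairs and A selects the monomials. It is used with pairs of
  Laurent polynomials in kk and all monomials, and with pairs acting on the vacuum by conjugate
  scalars and the allowed monomials.\<close>

locale iqg_pairs = iqg_mod vs uu_act W0 for vs W0 +
  fixes A :: "nat \<times> nat \<times> nat \<Rightarrow> bool"
  assumes one: "(1, 1) \<in> W0"
    and W0_sm: "(u, v) \<in> W0 \<Longrightarrow> (c \<odot> u, bar c \<odot> v) \<in> W0"
    and W0_kk: "(u, v) \<in> W0 \<Longrightarrow> (kk i * u, kk (tau i) * v) \<in> W0"
    and span: "P d x \<Longrightarrow> w \<in> W0 \<Longrightarrow> VR A d (uu_act x w)"
begin

lemma VR_pair:
  assumes "VR A d v" "\<And>t w. t \<in> Idx d \<Longrightarrow> A t \<Longrightarrow> w \<in> W0 \<Longrightarrow> VR A e (h (uu_act (mon Bm t) w))"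
    and h: "\<And>v v'. h (v + v') = h v + h v'" "h 0 = 0"
  shows "VR A e (h v)"
proof -
  obtain f where f: "\<forall>t. f t \<in> W0" "v = (\<Sum>t\<in>{t\<in>Idx d. A t}. uu_act (mon Bm t) (f t))"
    using assms(1) by (auto simp: VR_def)
  have hs: "h (\<Sum>t\<in>I. g t) = (\<Sum>t\<in>I. h (g t))" for I g
    by (induction I rule: infinite_finite_induct) (simp_all add: h)
  show ?thesis unfolding f(2) hs using f(1) by (auto intro!: VR_sum assms(2))
qed

lemma P_mon:
  assumes "t \<in> Idx d"
  shows "P d (mon Bm t)"
  using bar_fixed_mono[OF bar_fixed_Bmon[of vs "smin t - thd t" "smax t" "thd t" "inner t"]] mon_Idx[OF assms] by simp

lemma bar_graph_spanned_step:
  "bar_graph vs u y \<Longrightarrow> VR A d v \<Longrightarrow> \<exists>e. VR A e (u * fst v, y * snd v)"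
proof (induction arbitrary: d v rule: bar_graph.induct)
  case (scal c)
  have "VR A d ((\<lambda>v. (scal c * fst v, scal (bar c) * snd v)) v)"
  proof (rule VR_pair[OF scal])
    fix t w assume t: "t \<in> Idx d" "A t" "w \<in> W0"
    obtain a b where w: "w = (a, b)" by (cases w)
    have "VR A d (uu_act (mon Bm t) (c \<odot> a, bar c \<odot> b))"
      using t W0_sm w by (intro VR_mon) auto
    then show "VR A d (scal c * fst (uu_act (mon Bm t) w), scal (bar c) * snd (uu_act (mon Bm t) w))"
      by (simp add: w uu_act_def) (simp add: sm_def)
  qed (simp_all add: ring_distribs zero_prod_def)
  then show ?case by blast
next
  case (BB i)
  have "VR A (Suc d) ((\<lambda>v. (B i * fst v, B i * snd v)) v)"
  proof (rule VR_pair[OF BB])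
    fix t w assume t: "t \<in> Idx d" "A t" "w \<in> W0"
    have "VR A (Suc d) (uu_act (B i * mon Bm t) w)"
      by (rule span[OF bar_fixed_times[OF P_B[OF order_refl] P_mon[OF t(1)]] t(3)]) simp
    then show "VR A (Suc d) (B i * fst (uu_act (mon Bm t) w), B i * snd (uu_act (mon Bm t) w))"
      by (cases w) (simp add: uu_act_def mult.assoc)
  qed (simp_all add: ring_distribs zero_prod_def)
  then show ?case by blast
next
  case (kk i)
  have "VR A d ((\<lambda>v. (kk i * fst v, kk (tau i) * snd v)) v)"
  proof (rule VR_pair[OF kk])
    fix t w assume t: "t \<in> Idx d" "A t" "w \<in> W0"
    obtain a b where w: "w = (a, b)" by (cases w)
    obtain e where e: "kk i * mon Bm t = qq powi e \<odot> (mon Bm t * kk i)"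
      "kk (tau i) * mon Bm t = qq powi (- e) \<odot> (mon Bm t * kk (tau i))"
      using kk_mon[OF t(1)] by blast
    have "(qq powi e \<odot> (kk i * a), bar (qq powi e) \<odot> (kk (tau i) * b)) \<in> W0"
      using t w by (intro W0_sm W0_kk) simp
    then have "VR A d (uu_act (mon Bm t) (qq powi e \<odot> (kk i * a), bar (qq powi e) \<odot> (kk (tau i) * b)))"
      using t by (intro VR_mon)
    moreover have "(kk i * (mon Bm t * a), kk (tau i) * (mon Bm t * b)) =
        uu_act (mon Bm t) (qq powi e \<odot> (kk i * a), bar (qq powi e) \<odot> (kk (tau i) * b))"
      by (simp only: mult.assoc[symmetric] e) (simp add: uu_act_def mult.assoc)
    ultimately show "VR A d (kk i * fst (uu_act (mon Bm t) w), kk (tau i) * snd (uu_act (mon Bm t) w))"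
      by (simp add: w uu_act_def)
  qed (simp_all add: ring_distribs zero_prod_def)
  then show ?case by blast
next
  case (plus u y u' y')
  obtain e e' where "VR A e (u * fst v, y * snd v)" "VR A e' (u' * fst v, y' * snd v)"
    using plus by blast
  then have "VR A (max e e') (u * fst v, y * snd v)" "VR A (max e e') (u' * fst v, y' * snd v)"
    by (auto elim: VR_mono)
  from VR_add[OF this] show ?case by (auto simp: ring_distribs)
next
  case (times u y u' y')
  then obtain e where "VR A e (u' * fst v, y' * snd v)" by blast
  from times.IH(1)[OF this] show ?case by (simp add: mult.assoc)
qed

lemma bar_graph_spanned:
  assumes "bar_graph vs u y"
  shows "\<exists>d. VR A d (u, y)"
proof -
  have "VR A 0 (uu_act 1 (1, 1))" by (rule span[OF bar_fixed_1 one])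
  from bar_graph_spanned_step[OF assms this] show ?thesis by simp
qed

end

section \<open>The bar involution on simple modules\<close>

context hw_mod begin

lemma BB_singular:
  assumes "EE (tau i) \<cdot> w = 0" "wtv h w"
  shows "BB vs i \<cdot> w = FF i \<cdot> w"
  using assms by (simp add: BB_eq act_add act_mult wtv_KKinv)

text \<open>\<open>EE (tau i)\<close> commutes with \<open>FF i\<close> and kills
  \<open>\<eta>\<close>, so the second summand of \<open>BB vs i\<close> never contributes.\<close>

lemma dpow_BB_eta: "dpow (BB vs i) (int r) \<cdot> \<eta> = dpow (FF i) (int r) \<cdot> \<eta>"
proof -
  have "(BB vs i ^ k) \<cdot> \<eta> = (FF i ^ k) \<cdot> \<eta>" for k
  proof (induction k)
    case (Suc k)
    have F: "(FF i ^ k) \<cdot> \<eta> = qfact k \<star> (dpow (FF i) (int k) \<cdot> \<eta>)"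
      by (simp add: dpow_nat)
    have "EE (tau i) \<cdot> dpow (FF i) (int k) \<cdot> \<eta> = 0"
      by (simp add: EE_dpow_FF_other EE_eta)
    then have "BB vs i \<cdot> (FF i ^ k) \<cdot> \<eta> = FF i \<cdot> (FF i ^ k) \<cdot> \<eta>"
      unfolding F by (intro BB_singular[OF _ wtv_sc[OF wtv_dpow_FF[OF wtv_eta]]]) simp
    then show ?case using Suc by (simp add: act_mult)
  qed simp
  then show ?thesis by (simp add: dpow_nat)
qed

lemma kk_eta: "kk i \<cdot> \<eta> = qq powi (int (M i) - int (M (tau i))) \<star> \<eta>"
proof -
  have "kk i \<cdot> \<eta> = (qq powi (- int (M (tau i))) * qq powi int (M i)) \<star> \<eta>"
    by (simp only: kk_def act_mult wtv_KK[OF wtv_eta] wtv_KKinv[OF wtv_eta] act_sc V.scale_scale mult.commute)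
  then show ?thesis
    by (simp only: power_int_add[OF disjI1[OF qq_nonzero], symmetric] uminus_add_conv_diff)
qed

end

context iqg begin

lemma uact_sum_mon_pair:
  assumes "(u, y) = (\<Sum>t\<in>I. uu_act (mon Bm t) (f t))"
  shows "u = (\<Sum>t\<in>I. mon Bm t * fst (f t))" "y = (\<Sum>t\<in>I. mon Bm t * snd (f t))"
  using arg_cong[OF assms, of fst] arg_cong[OF assms, of snd]
  by (simp_all add: fst_sum snd_sum uu_act_def split_beta)

text \<open>Both expansions have the same monomials and conjugate coefficients; as these monomials
  are independent, the first vector determines the second.\<close>

lemma bar_graph_expand:
  assumes "bar_graph vs u y"
  shows "\<exists>d c. uact u (vacuum m n) = (\<Sum>t\<in>{t\<in>Idx d. allowed (hw m n) t}. L.sc (c t) (uact (mon Bm t) (vacuum m n))) \<and>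
    uact y (vacuum m n) = (\<Sum>t\<in>{t\<in>Idx d. allowed (hw m n) t}. L.sc (bar (c t)) (uact (mon Bm t) (vacuum m n)))"
proof -
  interpret v: hw_mod uact "vacuum m n" "hw m n" by (rule hw_vacuum)
  let ?v = "vacuum m n"
  define W0 where "W0 = {(u, y). \<exists>c. uact u ?v = L.sc c ?v \<and> uact y ?v = L.sc (bar c) ?v}"
  have W0I: "(u, y) \<in> W0" if "uact u ?v = L.sc c ?v" "uact y ?v = L.sc (bar c) ?v" for u y c
    using that by (auto simp: W0_def)
  have sm: "(c \<odot> u, bar c \<odot> y) \<in> W0" if uy: "(u, y) \<in> W0" for u y c
  proof -
    obtain d where "uact u ?v = L.sc d ?v" "uact y ?v = L.sc (bar d) ?v" using uy by (auto simp: W0_def)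
    then show ?thesis by (intro W0I[of _ "c * d"]) simp_all
  qed
  have kk: "(kk i * u, kk (tau i) * y) \<in> W0" if uy: "(u, y) \<in> W0" for u y i
  proof -
    obtain d where "uact u ?v = L.sc d ?v" "uact y ?v = L.sc (bar d) ?v" using uy by (auto simp: W0_def)
    then show ?thesis
      by (intro W0I[of _ "d * qq powi (int (hw m n i) - int (hw m n (tau i)))"]) (simp_all add: L.act_mult v.kk_eta)
  qed
  interpret iqg_mod vs uu_act W0
  proof (rule W0_P_pairs)
    show "(0, 0) \<in> W0" by (rule W0I[of _ 0]) simp_all
    fix u y u' y' assume "(u, y) \<in> W0" "(u', y') \<in> W0"
    then obtain c c' where "uact u ?v = L.sc c ?v" "uact y ?v = L.sc (bar c) ?v"
      "uact u' ?v = L.sc c' ?v" "uact y' ?v = L.sc (bar c') ?v" by (auto simp: W0_def)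
    then show "(u + u', y + y') \<in> W0" by (intro W0I[of _ "c + c'"]) (simp_all add: L.act_add L.sc_distrib)
  qed (fact sm kk)+
  \<comment> \<open>The powers beyond the highest weight kill the vacuum, so the condition defining
    W0 holds with scalar 0.\<close>
  have kill: "uu_act (Bd i r) w \<in> W0" if wr: "w \<in> W0" "hw m n i < r" for i r w
  proof -
    obtain u y c where w: "w = (u, y)" "uact u ?v = L.sc c ?v" "uact y ?v = L.sc (bar c) ?v"
      using wr by (auto simp: W0_def)
    have "uact (Bd i r) ?v = 0" using FF_vacuum[OF wr(2)] by (simp add: v.dpow_BB_eta)
    then show ?thesis unfolding w(1) uu_act_def prod.case
      by (intro W0I[of _ 0]) (simp_all add: L.act_mult w)
  qed
  interpret iqg_pairs vs W0 "allowed (hw m n)"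
  proof
    show "(1, 1) \<in> W0" by (rule W0I[of _ 1]) simp_all
    show "VR (allowed (hw m n)) d (uu_act x w)" if "P d x" "w \<in> W0" for d x w
      by (rule spanned_allowed[OF kill that])
  qed (fact sm kk)+
  obtain d where "VR (allowed (hw m n)) d (u, y)" using bar_graph_spanned[OF assms] by blast
  then obtain f where f: "\<And>t. f t \<in> W0" "(u, y) = (\<Sum>t\<in>{t\<in>Idx d. allowed (hw m n) t}. uu_act (mon Bm t) (f t))"
    by (auto simp: VR_def)
  have "\<exists>c. uact (fst (f t)) ?v = L.sc c ?v \<and> uact (snd (f t)) ?v = L.sc (bar c) ?v" for t
    using f(1)[of t] by (auto simp: W0_def split_beta)
  then obtain c where c: "\<And>t. uact (fst (f t)) ?v = L.sc (c t) ?v" "\<And>t. uact (snd (f t)) ?v = L.sc (bar (c t)) ?v"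
    by metis
  show ?thesis
    unfolding uact_sum_mon_pair(1)[OF f(2)] uact_sum_mon_pair(2)[OF f(2)]
    by (intro exI[of _ d] exI[of _ c]) (simp add: L.sum_act L.act_mult c)
qed

lemma bar_graph_vacuum:
  assumes "bar_graph vs u y" "uact u (vacuum m n) = 0"
  shows "uact y (vacuum m n) = 0"
proof -
  interpret v: hw_mod uact "vacuum m n" "hw m n" by (rule hw_vacuum)
  obtain d c where dc: "uact u (vacuum m n) = (\<Sum>t\<in>{t\<in>Idx d. allowed (hw m n) t}. L.sc (c t) (uact (mon Bm t) (vacuum m n)))"
    "uact y (vacuum m n) = (\<Sum>t\<in>{t\<in>Idx d. allowed (hw m n) t}. L.sc (bar (c t)) (uact (mon Bm t) (vacuum m n)))"
    using bar_graph_expand[OF assms(1)] by blast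
  have fin: "finite {t\<in>Idx d. allowed (hw m n) t}" using finite_Idx by (rule rev_finite_subset) auto
  have "c t = 0" if "t \<in> {t\<in>Idx d. allowed (hw m n) t}" for t
    by (rule v.mon_Bmon_independent[OF fin dc(1)[symmetric, unfolded assms(2)] _ that]) simp
  then show ?thesis unfolding dc(2) by (intro sum.neutral) auto
qed

lemma bar_graph_uact: "bar_graph vs u y \<Longrightarrow> bar_graph vs u' y' \<Longrightarrow> uact u (vacuum m n) = uact u' (vacuum m n) \<Longrightarrow>
    uact y (vacuum m n) = uact y' (vacuum m n)"
  using bar_graph_vacuum[OF bar_graph_diff[of vs u y u' y'], of m n] by (simp add: L.act_diff)

end

subsection \<open>Powers of the Cartan part\<close>

lemma kk_inverse: "kk i * kk (tau i) = 1" "kk i * (kk (tau i) * z) = z"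
proof -
  have "KK i * (KKinv (tau i) * (KK (tau i) * KKinv i)) = 1"
    by (simp add: KK_cancel KK_KKinv)
  then show 1: "kk i * kk (tau i) = 1" by (simp add: kk_def mult.assoc)
  show "kk i * (kk (tau i) * z) = z" using arg_cong[OF 1, of "\<lambda>x. x * z"] by (simp add: mult.assoc)
qed

definition kz :: "int \<Rightarrow> Uq" where
  "kz l = (if 0 \<le> l then kk N1 ^ nat l else kk N2 ^ nat (- l))"

lemma kk_kz: "kk N1 * kz l = kz (l + 1)" "kk N2 * kz l = kz (l - 1)"
proof -
  have c: "kk N1 * kk N2 = 1" "kk N1 * (kk N2 * z) = z" "kk N2 * (kk N1 * z) = z" for z
    using kk_inverse[of N1] kk_inverse[of N2] by simp_all
  show "kk N1 * kz l = kz (l + 1)"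
  proof (cases "0 \<le> l")
    case True
    then have "nat (l + 1) = Suc (nat l)" by simp
    then show ?thesis using True by (simp add: kz_def)
  next
    case False
    then have "nat (- l) = Suc (nat (- (l + 1)))" by simp
    then show ?thesis using False by (cases "l = - 1") (auto simp: kz_def c)
  qed
  show "kk N2 * kz l = kz (l - 1)"
  proof (cases "l \<le> 0")
    case True
    then have "nat (- (l - 1)) = Suc (nat (- l))" by simp
    then show ?thesis using True by (cases "l = 0") (auto simp: kz_def)
  next
    case False
    then have "nat l = Suc (nat (l - 1))" by simp
    then show ?thesis using False by (auto simp: kz_def c)
  qed
qed

text \<open>A Vandermonde argument: subtracting q^k times the relation at \<zeta> from the one at
  \<zeta> + 1 eliminates the index k.\<close>

lemma laurent_vanishing:
  fixes x :: "int \<Rightarrow> Qq"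
  assumes "finite S" "\<And>\<zeta>. (\<Sum>l\<in>S. x l * qq powi (l * \<zeta>)) = 0" "l \<in> S"
  shows "x l = 0"
  using assms
proof (induction S arbitrary: x l rule: finite_induct)
  case (insert k S)
  have "(\<Sum>l\<in>S. (x l * (qq powi l - qq powi k)) * qq powi (l * \<zeta>)) = 0" for \<zeta>
  proof -
    have "(\<Sum>l\<in>insert k S. (x l * (qq powi l - qq powi k)) * qq powi (l * \<zeta>)) =
        (\<Sum>l\<in>insert k S. x l * qq powi (l * (\<zeta> + 1))) - qq powi k * (\<Sum>l\<in>insert k S. x l * qq powi (l * \<zeta>))"
      unfolding sum_distrib_left sum_subtractf[symmetric]
      by (intro sum.cong HOL.refl) (simp add: ring_distribs power_int_add)
    then show ?thesis using insert.hyps insert.prems(1) by simp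
  qed
  from insert.IH[OF this] have *: "x l = 0" if "l \<in> S" for l
    using that insert.hyps by auto
  then have "(\<Sum>l\<in>insert k S. x l * qq powi (l * 0)) = x k" using insert.hyps by simp
  then have "x k = 0" using insert.prems(1)[of 0] by simp
  then show ?case using * insert.prems(2) by auto
qed simp

section \<open>Existence and uniqueness of the bar involutions\<close>

lemma sum_support:
  assumes "finite T" "S \<subseteq> T" "\<And>l. l \<notin> S \<Longrightarrow> x l = 0"
  shows "(\<Sum>l\<in>S. x l \<odot> g l) = (\<Sum>l\<in>T. x l \<odot> g l)"
  using assms by (intro sum.mono_neutral_left) auto

context iqg begin

definition laurent_pairs :: "(Uq \<times> Uq) set" where
  "laurent_pairs = {(\<Sum>l\<in>S. x l \<odot> kz l, \<Sum>l\<in>S. bar (x l) \<odot> kz (- l)) | x S.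
     finite S \<and> (\<forall>l. l \<notin> S \<longrightarrow> x l = 0)}"

lemma laurent_pairsI:
  "finite S \<Longrightarrow> (\<And>l. l \<notin> S \<Longrightarrow> x l = 0) \<Longrightarrow> u = (\<Sum>l\<in>S. x l \<odot> kz l) \<Longrightarrow>
    y = (\<Sum>l\<in>S. bar (x l) \<odot> kz (- l)) \<Longrightarrow> (u, y) \<in> laurent_pairs"
  unfolding laurent_pairs_def by blast

lemma laurent_pairsE:
  assumes "(u, y) \<in> laurent_pairs"
  obtains S x where "finite S" "\<And>l. l \<notin> S \<Longrightarrow> x l = 0" "u = (\<Sum>l\<in>S. x l \<odot> kz l)"
    "y = (\<Sum>l\<in>S. bar (x l) \<odot> kz (- l))"
  using assms unfolding laurent_pairs_def by blast

lemma laurent_pairs_sm: "(u, y) \<in> laurent_pairs \<Longrightarrow> (c \<odot> u, bar c \<odot> y) \<in> laurent_pairs"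
proof (erule laurent_pairsE)
  fix S x
  assume *: "finite S" "\<And>l. l \<notin> S \<Longrightarrow> x l = 0" "u = (\<Sum>l\<in>S. x l \<odot> kz l)"
    "y = (\<Sum>l\<in>S. bar (x l) \<odot> kz (- l))"
  have "d \<odot> (\<Sum>l\<in>S. f l) = (\<Sum>l\<in>S. d \<odot> f l)" for d f
    by (simp add: sm_def sum_distrib_left)
  then show ?thesis using * by (intro laurent_pairsI[of S "\<lambda>l. c * x l"]) simp_all
qed

lemma laurent_pairs_kk: "(u, y) \<in> laurent_pairs \<Longrightarrow> (kk i * u, kk (tau i) * y) \<in> laurent_pairs"
proof (erule laurent_pairsE)
  fix S x
  assume *: "finite S" "\<And>l. l \<notin> S \<Longrightarrow> x l = 0" "u = (\<Sum>l\<in>S. x l \<odot> kz l)"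
    "y = (\<Sum>l\<in>S. bar (x l) \<odot> kz (- l))"
  show ?thesis
  proof (cases i)
    case N1
    have "l \<notin> (\<lambda>l. l + 1) ` S \<Longrightarrow> x (l - 1) = 0" for l
      using *(2)[of "l - 1"] by (force simp: image_iff)
    then show ?thesis using *(1) unfolding N1 *(3,4)
      by (intro laurent_pairsI[of "(\<lambda>l. l + 1) ` S" "\<lambda>l. x (l - 1)"])
        (simp_all add: sum.reindex inj_on_def sum_distrib_left kk_kz)
  next
    case N2
    have "l \<notin> (\<lambda>l. l - 1) ` S \<Longrightarrow> x (l + 1) = 0" for l
      using *(2)[of "l + 1"] by (force simp: image_iff)
    then show ?thesis using *(1) unfolding N2 *(3,4)
      by (intro laurent_pairsI[of "(\<lambda>l. l - 1) ` S" "\<lambda>l. x (l + 1)"])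
        (simp_all add: sum.reindex inj_on_def sum_distrib_left kk_kz)
  qed
qed

lemma laurent_pairs_add:
  assumes "(u, y) \<in> laurent_pairs" "(u', y') \<in> laurent_pairs"
  shows "(u + u', y + y') \<in> laurent_pairs"
proof -
  obtain S x where 1: "finite S" "\<And>l. l \<notin> S \<Longrightarrow> x l = 0" "u = (\<Sum>l\<in>S. x l \<odot> kz l)"
    "y = (\<Sum>l\<in>S. bar (x l) \<odot> kz (- l))" using assms(1) by (rule laurent_pairsE) blast
  obtain S' x' where 2: "finite S'" "\<And>l. l \<notin> S' \<Longrightarrow> x' l = 0" "u' = (\<Sum>l\<in>S'. x' l \<odot> kz l)"
    "y' = (\<Sum>l\<in>S'. bar (x' l) \<odot> kz (- l))" using assms(2) by (rule laurent_pairsE) blast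
  let ?T = "S \<union> S'"
  have T: "finite ?T" "S \<subseteq> ?T" "S' \<subseteq> ?T" using 1 2 by auto
  have "u = (\<Sum>l\<in>?T. x l \<odot> kz l)" "u' = (\<Sum>l\<in>?T. x' l \<odot> kz l)"
    "y = (\<Sum>l\<in>?T. bar (x l) \<odot> kz (- l))" "y' = (\<Sum>l\<in>?T. bar (x' l) \<odot> kz (- l))"
    unfolding 1(3,4) 2(3,4) by (rule sum_support; use T 1 2 in simp)+
  then show ?thesis using T 1 2
    by (intro laurent_pairsI[of ?T "\<lambda>l. x l + x' l"]) (simp_all add: sm_distrib sum.distrib)
qed

lemma bar_graph_laurent:
  assumes "bar_graph vs u y"
  shows "\<exists>d S x. finite S \<and> u = (\<Sum>t\<in>Idx d. mon Bm t * (\<Sum>l\<in>S. x t l \<odot> kz l)) \<and>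
    y = (\<Sum>t\<in>Idx d. mon Bm t * (\<Sum>l\<in>S. bar (x t l) \<odot> kz (- l)))"
proof -
  interpret iqg_mod vs uu_act laurent_pairs
  proof (rule W0_P_pairs)
    show "(0, 0) \<in> laurent_pairs" by (rule laurent_pairsI[of "{}" "\<lambda>_. 0"]) simp_all
  qed (fact laurent_pairs_sm laurent_pairs_kk laurent_pairs_add)+
  interpret iqg_pairs vs laurent_pairs "\<lambda>_. True"
  proof
    show "(1, 1) \<in> laurent_pairs"
      by (rule laurent_pairsI[of "{0}" "\<lambda>l. if l = 0 then 1 else 0"]) (simp_all add: kz_def)
  qed (fact laurent_pairs_sm laurent_pairs_kk spanned)+
  obtain d where "VR (\<lambda>_. True) d (u, y)" using bar_graph_spanned[OF assms] by blast
  then obtain f where f: "\<And>t. f t \<in> laurent_pairs" "(u, y) = (\<Sum>t\<in>Idx d. uu_act (mon Bm t) (f t))"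
    by (auto simp: VR_def)
  have "\<exists>S x. finite S \<and> (\<forall>l. l \<notin> S \<longrightarrow> x l = 0) \<and> fst (f t) = (\<Sum>l\<in>S. x l \<odot> kz l) \<and>
    snd (f t) = (\<Sum>l\<in>S. bar (x l) \<odot> kz (- l))" for t
    using f(1)[of t] by (cases "f t") (auto elim!: laurent_pairsE)
  then obtain S x where Sx: "\<And>t. finite (S t)" "\<And>t l. l \<notin> S t \<Longrightarrow> x t l = 0"
    "\<And>t. fst (f t) = (\<Sum>l\<in>S t. x t l \<odot> kz l)" "\<And>t. snd (f t) = (\<Sum>l\<in>S t. bar (x t l) \<odot> kz (- l))"
    by metis
  define T where "T = (\<Union>t\<in>Idx d. S t)"
  have T: "finite T" using Sx(1) finite_Idx by (simp add: T_def)
  have "fst (f t) = (\<Sum>l\<in>T. x t l \<odot> kz l)" "snd (f t) = (\<Sum>l\<in>T. bar (x t l) \<odot> kz (- l))" if "t \<in> Idx d" for t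
  proof -
    have ST: "S t \<subseteq> T" using that by (auto simp: T_def)
    show "fst (f t) = (\<Sum>l\<in>T. x t l \<odot> kz l)"
      unfolding Sx(3) by (rule sum_support[OF T ST]) (rule Sx(2))
    show "snd (f t) = (\<Sum>l\<in>T. bar (x t l) \<odot> kz (- l))"
      unfolding Sx(4) by (rule sum_support[OF T ST], drule Sx(2), simp only: bar_0)
  qed
  then show ?thesis
    using uact_sum_mon_pair[OF f(2)] T
    by (intro exI[of _ d] exI[of _ T] exI[of _ x]) (auto intro!: sum.cong)
qed

lemma uact_kz: "uact (kz l) (vacuum m n) = L.sc (qq powi (l * (int m - int n))) (vacuum m n)"
proof -
  interpret v: hw_mod uact "vacuum m n" "hw m n" by (rule hw_vacuum)
  have *: "uact (kk i ^ k) (vacuum m n) = L.sc (qq powi (int k * (int (hw m n i) - int (hw m n (tau i))))) (vacuum m n)" for i k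
  proof (induction k)
    case (Suc k)
    then show ?case
      by (simp only: power_Suc L.act_mult L.act_sc v.kk_eta L.V.scale_scale power_int_add[OF disjI1[OF qq_nonzero], symmetric])
        (simp add: algebra_simps)
  qed simp
  show ?thesis
    using *[where i = N1 and k = "nat l"] *[where i = N2 and k = "nat (- l)"] by (auto simp: kz_def algebra_simps)
qed

text \<open>For m and n at least d every index of \<open>Idx d\<close> is allowed, so the
  independence on the vacuum covers all monomials; \<open>kz l\<close> acts there by a power of
  q.\<close>

lemma laurent_coefficients_vanish:
  assumes "finite S" "d \<le> m" "d \<le> n"
    and "uact (\<Sum>t\<in>Idx d. mon Bm t * (\<Sum>l\<in>S. x t l \<odot> kz l)) (vacuum m n) = 0" "t \<in> Idx d"
  shows "(\<Sum>l\<in>S. x t l * qq powi (l * (int m - int n))) = 0"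
proof -
  interpret v: hw_mod uact "vacuum m n" "hw m n" by (rule hw_vacuum)
  have "uact (\<Sum>t\<in>Idx d. mon Bm t * (\<Sum>l\<in>S. x t l \<odot> kz l)) (vacuum m n) =
     (\<Sum>t\<in>Idx d. L.sc (\<Sum>l\<in>S. x t l * qq powi (l * (int m - int n))) (uact (mon Bm t) (vacuum m n)))"
    unfolding L.sum_act L.act_mult
    by (intro sum.cong HOL.refl) (simp add: L.sum_act uact_kz L.V.scale_sum_left L.act_sum)
  then have 0: "(\<Sum>t\<in>Idx d. L.sc (\<Sum>l\<in>S. x t l * qq powi (l * (int m - int n))) (uact (mon Bm t) (vacuum m n))) = 0"
    using assms(4) by simp
  show ?thesis
    by (rule v.mon_Bmon_independent[OF finite_Idx 0 _ assms(5)])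
       (use assms(2,3) in \<open>auto simp: Idx_def allowed_def\<close>)
qed

lemma bar_graph_zero:
  assumes "bar_graph vs 0 y"
  shows "y = 0"
proof -
  obtain d S x where dSx: "finite S" "0 = (\<Sum>t\<in>Idx d. mon Bm t * (\<Sum>l\<in>S. x t l \<odot> kz l))"
    "y = (\<Sum>t\<in>Idx d. mon Bm t * (\<Sum>l\<in>S. bar (x t l) \<odot> kz (- l)))"
    using bar_graph_laurent[OF assms] by (elim exE conjE) (rule that)
  have "x t l = 0" if t: "t \<in> Idx d" and l: "l \<in> S" for t l
  proof (rule laurent_vanishing[OF dSx(1) _ l])
    fix \<zeta> :: int
    \<comment> \<open>These highest weights are at least d and have the arbitrary difference
      \<zeta>.\<close>
    have "(\<Sum>l\<in>S. x t l * qq powi (l * (int (d + nat \<zeta>) - int (d + nat (- \<zeta>))))) = 0"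
      by (rule laurent_coefficients_vanish[OF dSx(1) _ _ _ t]) (simp_all add: dSx(2)[symmetric])
    then show "(\<Sum>l\<in>S. x t l * qq powi (l * \<zeta>)) = 0" by (cases "0 \<le> \<zeta>") simp_all
  qed
  then show ?thesis unfolding dSx(3) by simp
qed

lemma bar_graph_fun: "bar_graph vs u y \<Longrightarrow> bar_graph vs u y' \<Longrightarrow> y = y'"
  using bar_graph_zero[of "y - y'"] bar_graph_diff[of vs u y u y'] by simp

section \<open>The left ideal defining the modified iquantum group\<close>

lemma dot_ideal_iff: "x \<in> dot_ideal vs \<zeta> \<longleftrightarrow> (\<exists>u u'. u \<in> Ui vs \<and> u' \<in> Ui vs \<and>
    x = u * (kk N1 - scal (qq powi \<zeta>)) + u' * (kk N2 - scal (qq powi (- \<zeta>))))"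
proof
  assume "x \<in> dot_ideal vs \<zeta>"
  then obtain u where "x = (\<Sum>i\<in>{N1, N2}. u i * (kk i - scal (qq powi ipair i \<zeta>)))" "\<forall>i. u i \<in> Ui vs"
    by (auto simp: dot_ideal_def)
  then show "\<exists>u u'. u \<in> Ui vs \<and> u' \<in> Ui vs \<and>
    x = u * (kk N1 - scal (qq powi \<zeta>)) + u' * (kk N2 - scal (qq powi (- \<zeta>)))"
    by (intro exI[of _ "u N1"] exI[of _ "u N2"]) simp
next
  assume "\<exists>u u'. u \<in> Ui vs \<and> u' \<in> Ui vs \<and>
    x = u * (kk N1 - scal (qq powi \<zeta>)) + u' * (kk N2 - scal (qq powi (- \<zeta>)))"
  then obtain u u' where "u \<in> Ui vs" "u' \<in> Ui vs"
    "x = u * (kk N1 - scal (qq powi \<zeta>)) + u' * (kk N2 - scal (qq powi (- \<zeta>)))" by blast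
  then show "x \<in> dot_ideal vs \<zeta>"
    unfolding dot_ideal_def by (intro CollectI exI[of _ "case_node u u'"]) (auto split: node.split)
qed

lemma dot_ideal_add: "x \<in> dot_ideal vs \<zeta> \<Longrightarrow> y \<in> dot_ideal vs \<zeta> \<Longrightarrow> x + y \<in> dot_ideal vs \<zeta>"
proof -
  assume "x \<in> dot_ideal vs \<zeta>" "y \<in> dot_ideal vs \<zeta>"
  then obtain u u' w w' where *: "u \<in> Ui vs" "u' \<in> Ui vs" "w \<in> Ui vs" "w' \<in> Ui vs"
    "x = u * (kk N1 - scal (qq powi \<zeta>)) + u' * (kk N2 - scal (qq powi (- \<zeta>)))"
    "y = w * (kk N1 - scal (qq powi \<zeta>)) + w' * (kk N2 - scal (qq powi (- \<zeta>)))"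
    unfolding dot_ideal_iff by blast
  have "x + y = (u + w) * (kk N1 - scal (qq powi \<zeta>)) + (u' + w') * (kk N2 - scal (qq powi (- \<zeta>)))"
    unfolding *(5,6) by (simp only: ring_distribs) simp
  then show ?thesis unfolding dot_ideal_iff using * Ui.plus by blast
qed

lemma dot_ideal_mult: "x \<in> dot_ideal vs \<zeta> \<Longrightarrow> y \<in> Ui vs \<Longrightarrow> y * x \<in> dot_ideal vs \<zeta>"
proof -
  assume "x \<in> dot_ideal vs \<zeta>" "y \<in> Ui vs"
  then obtain u u' where *: "u \<in> Ui vs" "u' \<in> Ui vs" "y \<in> Ui vs"
    "x = u * (kk N1 - scal (qq powi \<zeta>)) + u' * (kk N2 - scal (qq powi (- \<zeta>)))"
    unfolding dot_ideal_iff by blast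
  have "y * x = (y * u) * (kk N1 - scal (qq powi \<zeta>)) + (y * u') * (kk N2 - scal (qq powi (- \<zeta>)))"
    unfolding *(4) by (simp only: ring_distribs mult.assoc)
  then show ?thesis unfolding dot_ideal_iff using * Ui.times by blast
qed

lemma dot_ideal_0: "0 \<in> dot_ideal vs \<zeta>"
  unfolding dot_ideal_iff using Ui.scal[of 0 vs] by (intro exI[of _ 0]) (simp add: scal_0)

lemma dot_ideal_sum: "(\<And>k. k \<in> I \<Longrightarrow> f k \<in> dot_ideal vs \<zeta>) \<Longrightarrow> (\<Sum>k\<in>I. f k) \<in> dot_ideal vs \<zeta>"
  by (induction I rule: infinite_finite_induct) (simp_all add: dot_ideal_0 dot_ideal_add)

lemma kk_dot_ideal: "kk N1 - scal (qq powi \<zeta>) \<in> dot_ideal vs \<zeta>" "kk N2 - scal (qq powi (- \<zeta>)) \<in> dot_ideal vs \<zeta>"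
proof -
  have "0 \<in> Ui vs" "1 \<in> Ui vs" using Ui.scal[of 0 vs] Ui.scal[of 1 vs] by (simp_all add: scal_0 scal_1)
  then show "kk N1 - scal (qq powi \<zeta>) \<in> dot_ideal vs \<zeta>" "kk N2 - scal (qq powi (- \<zeta>)) \<in> dot_ideal vs \<zeta>"
    unfolding dot_ideal_iff by (intro exI[of _ 1] exI[of _ 0], simp) (intro exI[of _ 0] exI[of _ 1], simp add: \<open>0 \<in> Ui vs\<close> \<open>1 \<in> Ui vs\<close>)
qed

lemma kz_dot_ideal: "kz l - scal (qq powi (l * \<zeta>)) \<in> dot_ideal vs \<zeta>"
proof -
  have step: "kk i * x - scal (c * d) \<in> dot_ideal vs \<zeta>"
    if "x - scal d \<in> dot_ideal vs \<zeta>" "kk i - scal c \<in> dot_ideal vs \<zeta>" for i x c d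
  proof -
    have "kk i * (x - scal d) + scal d * (kk i - scal c) \<in> dot_ideal vs \<zeta>"
      using that by (intro dot_ideal_add dot_ideal_mult Ui.intros)
    moreover have "kk i * (x - scal d) + scal d * (kk i - scal c) = kk i * x - scal (c * d)"
      by (simp add: ring_distribs scal_comm[of d "kk i"] mult.commute[of c d] scal_mult)
    ultimately show ?thesis by simp
  qed
  have 1: "kk N1 ^ k - scal (qq powi (int k * \<zeta>)) \<in> dot_ideal vs \<zeta>" for k
  proof (induction k)
    case (Suc k)
    from step[OF this kk_dot_ideal(1)] show ?case by (simp add: ring_distribs power_int_add)
  qed (simp add: scal_1 dot_ideal_0)
  have 2: "kk N2 ^ k - scal (qq powi (- int k * \<zeta>)) \<in> dot_ideal vs \<zeta>" for k
  proof (induction k)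
    case (Suc k)
    have "- int (Suc k) * \<zeta> = - \<zeta> + - int k * \<zeta>" by (simp add: algebra_simps)
    then have "qq powi (- \<zeta>) * qq powi (- int k * \<zeta>) = qq powi (- int (Suc k) * \<zeta>)"
      by (simp only: power_int_add[OF disjI1[OF qq_nonzero], symmetric])
    then show ?case using step[OF Suc kk_dot_ideal(2)] by simp
  qed (simp add: scal_1 dot_ideal_0)
  show ?thesis using 1[of "nat l"] 2[of "nat (- l)"] by (auto simp: kz_def)
qed

text \<open>This yields uniqueness of the inverse limit. Modulo \<open>dot_ideal\<close> a Laurent
  polynomial in kk equals its value at q^\<zeta>, and a single sufficiently large module shows that
  all these values vanish.\<close>

lemma dot_ideal_from_modules:
  assumes "u \<in> Ui vs" "\<And>m n. N \<le> m \<Longrightarrow> N \<le> n \<Longrightarrow> int m - int n = \<zeta> \<Longrightarrow> uact u (vacuum m n) = 0"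
  shows "u \<in> dot_ideal vs \<zeta>"
proof -
  obtain y where "bar_graph vs u y" using Ui_bar_graph[OF assms(1)] by blast
  from bar_graph_laurent[OF this] obtain d S x where dSx: "finite S" "u = (\<Sum>t\<in>Idx d. mon Bm t * (\<Sum>l\<in>S. x t l \<odot> kz l))"
    by (elim exE conjE) (rule that)
  have 0: "(\<Sum>l\<in>S. x t l * qq powi (l * \<zeta>)) = 0" if t: "t \<in> Idx d" for t
  proof -
    define m n where "m = d + N + nat \<zeta>" and "n = d + N + nat (- \<zeta>)"
    have mn: "int m - int n = \<zeta>" by (simp add: m_def n_def)
    have "uact u (vacuum m n) = 0" by (rule assms(2)) (simp_all add: mn, simp_all add: m_def n_def)
    then have "(\<Sum>l\<in>S. x t l * qq powi (l * (int m - int n))) = 0"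
      by (intro laurent_coefficients_vanish[OF dSx(1) _ _ _ t]) (simp_all add: dSx(2) m_def n_def)
    then show ?thesis by (simp add: mn)
  qed
  show ?thesis
    unfolding dSx(2)
  proof (rule dot_ideal_sum, rule dot_ideal_mult)
    fix t assume t: "t \<in> Idx d"
    show "mon Bm t \<in> Ui vs" unfolding mon_Idx(1)[OF t] by (rule bar_graph_Ui[OF bar_graph_Bmon])
    have "(\<Sum>l\<in>S. x t l \<odot> kz l) = (\<Sum>l\<in>S. x t l \<odot> kz l) - (\<Sum>l\<in>S. x t l * qq powi (l * \<zeta>)) \<odot> 1"
      by (simp add: 0[OF t])
    also have "\<dots> = (\<Sum>l\<in>S. x t l \<odot> (kz l - scal (qq powi (l * \<zeta>))))"
      by (simp add: sm_distrib sum_subtractf scal_eq_sm) (simp add: Uqv.scale_sum_left)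
    also have "\<dots> \<in> dot_ideal vs \<zeta>"
      unfolding sm_def by (intro dot_ideal_sum dot_ideal_mult kz_dot_ideal Ui.scal)
    finally show "(\<Sum>l\<in>S. x t l \<odot> kz l) \<in> dot_ideal vs \<zeta>" .
  qed
qed

lemma dot_ideal_vacuum:
  assumes "x \<in> dot_ideal vs (int m - int n)"
  shows "uact x (vacuum m n) = 0"
proof -
  interpret v: hw_mod uact "vacuum m n" "hw m n" by (rule hw_vacuum)
  obtain u u' where "x = u * (kk N1 - scal (qq powi (int m - int n))) + u' * (kk N2 - scal (qq powi (- (int m - int n))))"
    using assms unfolding dot_ideal_iff by blast
  then show ?thesis using v.kk_eta[of N1] v.kk_eta[of N2] by (simp add: L.act_add L.act_mult L.act_diff)
qed

subsection \<open>The involution of the iquantum group\<close>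

lemma bar_automorphism_bar_graph:
  assumes "bar_automorphism vs f"
  shows "bar_graph vs u y \<Longrightarrow> f u = y"
proof -
  have f: "f 1 = 1" "\<And>x y. x \<in> Ui vs \<Longrightarrow> y \<in> Ui vs \<Longrightarrow> f (x + y) = f x + f y"
    "\<And>x y. x \<in> Ui vs \<Longrightarrow> y \<in> Ui vs \<Longrightarrow> f (x * y) = f x * f y"
    "\<And>r x. x \<in> Ui vs \<Longrightarrow> f (scal (of_rat r) * x) = scal (of_rat r) * f x"
    "f (scal qq) = scal (inverse qq)" "\<And>i. f (BB vs i) = BB vs i" "\<And>i. f (kk i) = kk (tau i)"
    using assms unfolding bar_automorphism_def kk_def by auto
  have one: "1 \<in> Ui vs" using Ui.scal[of 1] by (simp add: scal_1)
  have rat: "f (scal (of_rat r)) = scal (of_rat r)" for r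
    using f(4)[OF one, of r] f(1) by simp
  have poly: "f (scal (ev qq p)) = scal (ev (inverse qq) p)" for p
  proof (induction p)
    case 0
    then show ?case using rat[of 0] by simp
  next
    case (pCons a p)
    then show ?case
      by (simp add: scal_add scal_mult f(2,3,5) rat Ui.intros)
  qed
  \<comment> \<open>Additivity, multiplicativity and the value at q determine f on polynomials;
    multiplying by the denominator extends this to fractions.\<close>
  have scal: "f (scal c) = scal (bar c)" for c
  proof -
    obtain a b where c: "c = Fract a b" "b \<noteq> 0" by (cases c) auto
    then have cab: "c * ev qq b = ev qq a" by (simp add: ev_qq eq_fract)
    have nz: "ev (inverse qq) b \<noteq> 0" using c(2) by (simp flip: evi_def)
    have "f (scal c) * scal (ev (inverse qq) b) = f (scal (c * ev qq b))"
      by (simp only: scal_mult f(3)[OF Ui.scal Ui.scal] poly)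
    also have "\<dots> = scal (bar (c * ev qq b))"
      unfolding cab poly bar_ev by simp
    also have "\<dots> = scal (bar c) * scal (ev (inverse qq) b)"
      by (simp add: bar_ev scal_mult)
    finally have "f (scal c) * scal (ev (inverse qq) b) * scal (inverse (ev (inverse qq) b)) =
      scal (bar c) * scal (ev (inverse qq) b) * scal (inverse (ev (inverse qq) b))" by (simp only:)
    then show ?thesis using nz by (simp add: mult.assoc scal_1 flip: scal_mult)
  qed
  show "bar_graph vs u y \<Longrightarrow> f u = y"
    by (induction rule: bar_graph.induct) (simp_all add: scal f bar_graph_Ui)
qed

lemma psi_bar_graph:
  assumes "bar_graph vs u y"
  shows "psi vs u = y"
proof -
  define g where "g = restrict (\<lambda>u. THE y. bar_graph vs u y) (Ui vs)"
  have g: "g u = y" if "bar_graph vs u y" for u y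
    using that bar_graph_fun bar_graph_Ui[OF that] unfolding g_def by (simp add: the_equality)
  have "bar_automorphism vs g"
    unfolding bar_automorphism_def
  proof (intro conjI ballI allI)
    show "bij_betw g (Ui vs) (Ui vs)"
    proof (rule bij_betw_imageI)
      show "inj_on g (Ui vs)"
        by (rule inj_onI) (metis bar_graph_fun bar_graph_sym Ui_bar_graph g)
      show "g ` Ui vs = Ui vs"
        by (auto simp: image_iff) (metis bar_graph_Ui bar_graph_sym Ui_bar_graph g)+
    qed
    show "g 1 = 1" by (rule g[OF bar_graph_1])
    show "g (scal qq) = scal (inverse qq)" using g[OF bar_graph.scal[of vs qq]] by simp
    show "g (BB vs i) = BB vs i" for i by (rule g[OF bar_graph.BB])
    show "g (kk i) = KK (tau i) * KKinv i" for i using g[OF bar_graph.kk[of vs i]] by (simp add: kk_def)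
    show "g (scal (of_rat r) * x) = scal (of_rat r) * g x" if x: "x \<in> Ui vs" for r x
    proof -
      obtain y where "bar_graph vs x y" using Ui_bar_graph x by blast
      then show ?thesis using g[OF bar_graph.times[OF bar_graph.scal[of vs "of_rat r"]]] g by simp
    qed
    fix x y assume "x \<in> Ui vs" "y \<in> Ui vs"
    then obtain x' y' where "bar_graph vs x x'" "bar_graph vs y y'" using Ui_bar_graph by blast
    then show "g (x + y) = g x + g y" "g (x * y) = g x * g y"
      using g bar_graph.plus bar_graph.times by metis+
  qed
  moreover have "g \<in> extensional (Ui vs)" by (simp add: g_def)
  moreover have "f = g" if "f \<in> extensional (Ui vs) \<and> bar_automorphism vs f" for f
  proof
    fix u
    show "f u = g u"
    proof (cases "u \<in> Ui vs")
      case True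
      then obtain y where "bar_graph vs u y" using Ui_bar_graph by blast
      then show ?thesis using g bar_automorphism_bar_graph that by metis
    next
      case False
      then show ?thesis using that by (simp add: g_def extensional_def)
    qed
  qed
  ultimately have "psi vs = g" unfolding psi_def by (intro the_equality) blast+
  then show ?thesis using g[OF assms] by simp
qed

end

subsection \<open>The involution of the simple modules\<close>

context hw_mod begin

text \<open>F_i w is B_i w minus (B_i - F_i) w, and the correction stays in \<open>Fl e\<close>.
  Thus the iquantum group alone generates the module, and the bar involution does not lengthen
  words.\<close>

lemma Fl_bar_graph:
  "v \<in> Fl e \<Longrightarrow> \<exists>u y. bar_graph vs u y \<and> u \<cdot> \<eta> = v \<and> y \<cdot> \<eta> \<in> Fl e"
proof (induction e arbitrary: v)
  case 0
  then show ?case using bar_graph_0 by (intro exI[of _ 0]) simp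
next
  case (Suc e)
  obtain c y z where v: "v = c \<star> \<eta> + FF N1 \<cdot> y + FF N2 \<cdot> z" "y \<in> Fl e" "z \<in> Fl e"
    using Suc.prems(1) by (rule Fl_SucE)
  have F: "\<exists>u u'. bar_graph vs u u' \<and> u \<cdot> \<eta> = FF i \<cdot> w \<and> u' \<cdot> \<eta> \<in> Fl (Suc e)" if "w \<in> Fl e" for i w
  proof -
    obtain u u' where u: "bar_graph vs u u'" "u \<cdot> \<eta> = w" "u' \<cdot> \<eta> \<in> Fl e" using Suc.IH \<open>w \<in> Fl e\<close> by blast
    have "(BB vs i - FF i) \<cdot> w \<in> Fl e" using \<open>w \<in> Fl e\<close> by (rule BB_diff_FF)
    then obtain r r' where r: "bar_graph vs r r'" "r \<cdot> \<eta> = (BB vs i - FF i) \<cdot> w" "r' \<cdot> \<eta> \<in> Fl e" using Suc.IH by blast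
    have "BB vs i \<cdot> x \<in> Fl (Suc e)" if "x \<in> Fl e" for x
      using Fl_add[OF Fl_mono[OF BB_diff_FF[OF that, of vs i], of "Suc e"] Fl_FF[OF that, of i]] by (simp add: act_diff)
    then have "(BB vs i * u' - r') \<cdot> \<eta> \<in> Fl (Suc e)"
      using Fl_mono[OF r(3), of "Suc e"] u(3) by (simp only: act_diff act_mult Fl_diff)
    moreover have "(BB vs i * u - r) \<cdot> \<eta> = FF i \<cdot> w"
      by (simp add: act_diff act_mult u(2) r(2))
    ultimately show ?thesis using bar_graph_diff[OF bar_graph.times[OF bar_graph.BB u(1)] r(1)] by blast
  qed
  obtain u u' where u: "bar_graph vs u u'" "u \<cdot> \<eta> = FF N1 \<cdot> y" "u' \<cdot> \<eta> \<in> Fl (Suc e)" using F[OF v(2)] by blast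
  obtain r r' where r: "bar_graph vs r r'" "r \<cdot> \<eta> = FF N2 \<cdot> z" "r' \<cdot> \<eta> \<in> Fl (Suc e)" using F[OF v(3)] by blast
  have "bar_graph vs (scal c + u + r) (scal (bar c) + u' + r')" by (intro bar_graph.plus bar_graph.scal u r)
  moreover have "(scal c + u + r) \<cdot> \<eta> = v" by (simp add: act_add u r v(1))
  moreover have "(scal (bar c) + u' + r') \<cdot> \<eta> \<in> Fl (Suc e)"
    unfolding act_add scal_act by (intro Fl_add Fl_sc Fl_eta u r)
  ultimately show ?case by blast
qed

end

context iqg begin

lemma Lmod_Ui:
  assumes "X \<in> Lmod m n"
  shows "\<exists>u\<in>Ui vs. X = act m n u (eta m n)"
proof -
  interpret v: hw_mod uact "vacuum m n" "hw m n" by (rule hw_vacuum)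
  obtain x where x: "X = act m n x (eta m n)" using assms by (auto simp: Lmod_def quot_def act_eta_eq)
  obtain e where "uact x (vacuum m n) \<in> v.Fl e" using v.Fl_cyclic by blast
  then obtain u y where "bar_graph vs u y" "uact u (vacuum m n) = uact x (vacuum m n)"
    using v.Fl_bar_graph[of _ e vs] by blast
  then show ?thesis using x bar_graph_Ui by (metis act_eta_eq_iff)
qed

lemma psiL_eq:
  assumes "bar_graph vs u y"
  shows "psiL vs m n (act m n u (eta m n)) = act m n y (eta m n)"
proof -
  define R where "R u = act m n u (eta m n)" for u
  \<comment> \<open>The representative u is arbitrary; \<open>bar_graph_uact\<close> makes the value
    independent of it.\<close>
  define f where "f = restrict (\<lambda>X. R (psi vs (SOME u. u \<in> Ui vs \<and> X = R u))) (Lmod m n)"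
  have RL: "R u \<in> Lmod m n" for u by (simp add: R_def act_eta_eq Lmod_def quot_def)
  have f: "f (R u) = R (psi vs u)" if "u \<in> Ui vs" for u
  proof -
    define w where "w = (SOME w. w \<in> Ui vs \<and> R u = R w)"
    have w: "w \<in> Ui vs \<and> R u = R w" unfolding w_def by (rule someI[of _ u]) (use \<open>u \<in> Ui vs\<close> in simp)
    obtain y z where "bar_graph vs u y" "bar_graph vs w z" using Ui_bar_graph \<open>u \<in> Ui vs\<close> w by blast
    moreover from this w have "R y = R z" unfolding R_def act_eta_eq_iff using bar_graph_uact by blast
    ultimately show ?thesis using RL by (simp add: f_def w_def[symmetric] psi_bar_graph)
  qed
  have "psiL vs m n = f"
    unfolding psiL_def
  proof (rule the_equality)
    show "f \<in> extensional (Lmod m n) \<and> (\<forall>u\<in>Ui vs. f (act m n u (eta m n)) = act m n (psi vs u) (eta m n))"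
      using f by (simp add: R_def f_def)
    fix g assume g: "g \<in> extensional (Lmod m n) \<and> (\<forall>u\<in>Ui vs. g (act m n u (eta m n)) = act m n (psi vs u) (eta m n))"
    show "g = f"
    proof
      fix X
      show "g X = f X"
      proof (cases "X \<in> Lmod m n")
        case True
        then obtain u where "u \<in> Ui vs" "X = R u" using Lmod_Ui unfolding R_def by blast
        then show ?thesis using g f by (simp add: R_def)
      next
        case False
        then show ?thesis using g by (simp add: f_def extensional_def)
      qed
    qed
  qed
  then show ?thesis using f[OF bar_graph_Ui[OF assms]] psi_bar_graph[OF assms] by (simp add: R_def)
qed

end

section \<open>Expansion of the monomials\<close>

text \<open>The number y(y - 1)/2, the power of q that arises when the y-th power of E_(tau i)
  K_i^-1 is reordered.\<close>

primrec tri :: "nat \<Rightarrow> int" where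
  "tri 0 = 0"
| "tri (Suc y) = tri y + int y"

lemma tri_le: "tri y \<le> int y * int y - int y"
  by (induction y) (simp_all add: algebra_simps)

context uq_mod begin

lemma wtv_dpow_EE:
  assumes "wtv h v"
  shows "wtv (\<lambda>i. h i + int k * cartan i j) (dpow (EE j) (int k) \<cdot> v)"
proof -
  have "wtv (\<lambda>i. h i + int k * cartan i j) ((EE j ^ k) \<cdot> v)" for k
  proof (induction k)
    case (Suc k)
    from wtv_EE[OF Suc, of j] show ?case by (simp add: act_mult algebra_simps)
  qed (use assms in simp)
  then show ?thesis by (simp add: dpow_nat wtv_sc)
qed

text \<open>The two summands of \<open>BB vs i\<close> commute up to \<open>q\<^sup>2\<close>, so that the powers of \<open>BB vs i\<close> are given by
  the quantum binomial theorem.\<close>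

lemma dpow_BB_wtv:
  assumes "wtv h v"
  shows "dpow (BB vs i) (int b) \<cdot> v =
    (\<Sum>y\<le>b. qq powi (int y * (int b - int y) + vs i * int y - h i * int y + tri y) \<star>
       (dpow (FF i) (int b - int y) \<cdot> dpow (EE (tau i)) (int y) \<cdot> v))"
proof (induction b)
  case 0
  show ?case by simp
next
  case (Suc b)
  \<comment> \<open>In this exponent y(b - y) belongs to the quantum binomial theorem, vs i y to the
    coefficient of E in B i, - h i y to the y factors K_i^-1 acting on v, and tri y to their
    reordering past E.\<close>
  define e where "e b y = int y * (int b - int y) + vs i * int y - h i * int y + tri y" for b y
  define u where "u b y = dpow (FF i) (int b - int y) \<cdot> dpow (EE (tau i)) (int y) \<cdot> v" for b y
  have IH: "dpow (BB vs i) (int b) \<cdot> v = (\<Sum>y\<le>b. qq powi e b y \<star> u b y)"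
    using Suc by (simp only: e_def u_def)
  have BBu: "BB vs i \<cdot> u b y = qnum (int b + 1 - int y) \<star> u (Suc b) y +
      (qq powi (vs i - h i + int y + 2 * (int b - int y)) * qnum (int y + 1)) \<star> u (Suc b) (Suc y)" for y
  proof -
    have "wtv (\<lambda>k. h k + int y * cartan k (tau i) - (int b - int y) * cartan k i) (u b y)"
      unfolding u_def by (intro wtv_dpow_FF wtv_dpow_EE assms)
    from wtv_KKinv[OF this, of i] have "KKinv i \<cdot> u b y = qq powi (- h i + int y + 2 * (int b - int y)) \<star> u b y"
      by (simp add: algebra_simps)
    moreover have "EE (tau i) \<cdot> u b y = qnum (int y + 1) \<star> u (Suc b) (Suc y)"
    proof -
      have "EE (tau i) \<cdot> dpow (EE (tau i)) (int y) \<cdot> v = qnum (int y + 1) \<star> (dpow (EE (tau i)) (int y + 1) \<cdot> v)"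
        by (simp add: mult_dpow flip: act_mult)
      then show ?thesis unfolding u_def by (simp add: EE_dpow_FF_other add.commute)
    qed
    moreover have "FF i \<cdot> u b y = qnum (int b + 1 - int y) \<star> u (Suc b) y"
    proof -
      have "FF i \<cdot> dpow (FF i) (int b - int y) \<cdot> w = qnum (int b + 1 - int y) \<star> (dpow (FF i) (int b + 1 - int y) \<cdot> w)" for w
        using mult_dpow[of "FF i" "int b - int y"] by (simp add: algebra_simps flip: act_mult)
      then show ?thesis unfolding u_def by (simp add: add.commute)
    qed
    moreover have "qq powi (vs i) * qq powi (- h i + int y + 2 * (int b - int y)) = qq powi (vs i - h i + int y + 2 * (int b - int y))"
      by (simp only: power_int_add[OF disjI1[OF qq_nonzero], symmetric]) (simp add: algebra_simps)
    ultimately show ?thesis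
      by (simp only: BB_eq act_add act_mult sm_act act_sc V.scale_scale mult.assoc[symmetric])
  qed
  have coeff0: "qq powi e b 0 * qnum (int b + 1) = qnum (int b + 1) * qq powi e (Suc b) 0"
    by (simp add: e_def)
  \<comment> \<open>A form of the quantum Pascal rule: the term of index y + 1 is reached from index
    y + 1 through F and from index y through E.\<close>
  have coeff: "qq powi e b (Suc y) * qnum (int b - int y) +
      qq powi e b y * (qq powi (vs i - h i + int y + 2 * (int b - int y)) * qnum (int y + 1)) =
      qnum (int b + 1) * qq powi e (Suc b) (Suc y)" for y
  proof -
    let ?E = "e b (Suc y)"
    have 1: "qq powi e b y * qq powi (vs i - h i + int y + 2 * (int b - int y)) = qq powi ?E * qq powi (int b + 1)"
      by (simp only: power_int_add[OF disjI1[OF qq_nonzero], symmetric]) (simp add: e_def algebra_simps)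
    have 2: "qq powi e (Suc b) (Suc y) = qq powi ?E * qq powi (int y + 1)"
      by (simp only: power_int_add[OF disjI1[OF qq_nonzero], symmetric]) (simp add: e_def algebra_simps)
    have "qnum (int b + 1) = qq powi (int b - int y) * qnum (int y + 1) + qq powi (- (int y + 1)) * qnum (int b - int y)"
      using qnum_add_right[of "int y + 1" "int b - int y"] by (simp add: algebra_simps)
    then have "qnum (int b + 1) * qq powi (int y + 1) =
      (qq powi (int b - int y) * qq powi (int y + 1)) * qnum (int y + 1) + (qq powi (- (int y + 1)) * qq powi (int y + 1)) * qnum (int b - int y)"
      by (simp only: ring_distribs mult_ac)
    also have "qq powi (int b - int y) * qq powi (int y + 1) = qq powi (int b + 1)"
      by (simp only: power_int_add[OF disjI1[OF qq_nonzero], symmetric]) simp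
    also have "qq powi (- (int y + 1)) * qq powi (int y + 1) = 1"
      by (simp only: power_int_add[OF disjI1[OF qq_nonzero], symmetric]) simp
    finally have 3: "qnum (int b + 1) * qq powi (int y + 1) = qq powi (int b + 1) * qnum (int y + 1) + qnum (int b - int y)"
      by simp
    have "qnum (int b + 1) * qq powi e (Suc b) (Suc y) = qq powi ?E * (qnum (int b + 1) * qq powi (int y + 1))"
      unfolding 2 by (simp only: mult_ac)
    also have "\<dots> = qq powi ?E * qnum (int b - int y) + (qq powi ?E * qq powi (int b + 1)) * qnum (int y + 1)"
      unfolding 3 by (simp only: ring_distribs mult_ac add_ac)
    finally show ?thesis unfolding 1[symmetric] by (simp only: mult_ac)
  qed
  have "qnum (int b + 1) \<star> (dpow (BB vs i) (int (Suc b)) \<cdot> v) = BB vs i \<cdot> dpow (BB vs i) (int b) \<cdot> v"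
    by (simp add: mult_dpow add.commute flip: act_mult)
  also have "\<dots> = (\<Sum>y\<le>b. qq powi e b y \<star> (BB vs i \<cdot> u b y))"
    unfolding IH act_sum act_sc ..
  also have "\<dots> = (\<Sum>y\<le>b. (qq powi e b y * qnum (int b + 1 - int y)) \<star> u (Suc b) y) +
     (\<Sum>y\<le>b. (qq powi e b y * (qq powi (vs i - h i + int y + 2 * (int b - int y)) * qnum (int y + 1))) \<star> u (Suc b) (Suc y))"
    unfolding BBu sum.distrib[symmetric] by (simp only: sc_distrib V.scale_scale)
  also have "(\<Sum>y\<le>b. (qq powi e b y * qnum (int b + 1 - int y)) \<star> u (Suc b) y) =
     (\<Sum>y\<le>Suc b. (qq powi e b y * qnum (int b + 1 - int y)) \<star> u (Suc b) y)"
    by simp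
  also have "\<dots> = (qq powi e b 0 * qnum (int b + 1)) \<star> u (Suc b) 0 +
     (\<Sum>y\<le>b. (qq powi e b (Suc y) * qnum (int b - int y)) \<star> u (Suc b) (Suc y))"
    unfolding sum.atMost_Suc_shift by simp
  also have "\<dots> + (\<Sum>y\<le>b. (qq powi e b y * (qq powi (vs i - h i + int y + 2 * (int b - int y)) * qnum (int y + 1))) \<star> u (Suc b) (Suc y)) =
     (qnum (int b + 1) * qq powi e (Suc b) 0) \<star> u (Suc b) 0 +
     (\<Sum>y\<le>b. (qnum (int b + 1) * qq powi e (Suc b) (Suc y)) \<star> u (Suc b) (Suc y))"
    unfolding coeff[symmetric] coeff0 by (simp only: sc_distrib sum.distrib add.assoc)
  also have "\<dots> = qnum (int b + 1) \<star> (\<Sum>y\<le>Suc b. qq powi e (Suc b) y \<star> u (Suc b) y)"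
    unfolding sum.atMost_Suc_shift by (simp only: sc_distrib V.scale_sum_right V.scale_scale)
  finally show ?case unfolding e_def u_def by simp
qed

text \<open>The product of the k ladder coefficients, divided by [k]!, is the binomial coefficient
  of A + k over k.\<close>

lemma dpow_EE_string:
  assumes "\<And>k. EE j \<cdot> w k = qnum (A + int k + 1) \<star> w (Suc k)"
  shows "dpow (EE j) (int k) \<cdot> w 0 = qbin A k \<star> w k"
proof (induction k)
  case (Suc k)
  have "qnum (int k + 1) \<star> (dpow (EE j) (int (Suc k)) \<cdot> w 0) = EE j \<cdot> dpow (EE j) (int k) \<cdot> w 0"
    by (simp add: mult_dpow add.commute flip: act_mult)
  also have "\<dots> = (qbin A k * qnum (A + int k + 1)) \<star> w (Suc k)"
    by (simp add: Suc assms)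
  also have "qbin A k * qnum (A + int k + 1) = qnum (int k + 1) * qbin A (Suc k)"
    by (simp add: qbin_Suc)
  finally have "qnum (int k + 1) \<star> (dpow (EE j) (int (Suc k)) \<cdot> w 0) = qnum (int k + 1) \<star> (qbin A (Suc k) \<star> w (Suc k))"
    by simp
  moreover have "qnum (int k + 1) \<noteq> 0" by simp
  ultimately show ?case by (simp only: V.scale_cancel_left simp_thms)
qed simp

end

section \<open>The coefficients of the expansion and their degree in q\<close>

context hw_mod begin

text \<open>The contribution of the inner power with y factors E: the exponent of
  \<open>dpow_BB_wtv\<close> at the weight M i + c of F_(tau i)^(c) \<eta>, times the binomial from
  E_(tau i)^(y) acting there. \<open>coef2\<close> is its analogue for the outer power, where the
  weight depends on y.\<close>

definition coef1 :: "(node \<Rightarrow> int) \<Rightarrow> node \<Rightarrow> nat \<Rightarrow> nat \<Rightarrow> nat \<Rightarrow> Qq" where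
  "coef1 vs i b c y = qq powi (int y * (int b - int y) + vs i * int y - (int (M i) + int c) * int y + tri y)
     * qbin (int (M (tau i)) - int c) y"

definition coef2 :: "(node \<Rightarrow> int) \<Rightarrow> node \<Rightarrow> nat \<Rightarrow> nat \<Rightarrow> nat \<Rightarrow> nat \<Rightarrow> nat \<Rightarrow> Qq" where
  "coef2 vs i a b c x y = qq powi (int x * (int a - int x) + vs (tau i) * int x
     - (int (M (tau i)) - 2 * int c + int b + int y) * int x + tri x) * qbin (int (M i) + int c - int b) x"

lemma Bmon_expansion:
  "Bmon vs i (int a) (int b) (int c) \<cdot> \<eta> = (\<Sum>y\<le>b. \<Sum>x\<le>a. (coef1 vs i b c y * coef2 vs i a b c x y) \<star>
     T i (int a - int x) (int b - int x - int y) (int c - int y))"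
proof -
  let ?j = "tau i"
  have E1: "dpow (EE ?j) (int y) \<cdot> dpow (FF ?j) (int c) \<cdot> \<eta> = qbin (int (M ?j) - int c) y \<star> (dpow (FF ?j) (int c - int y) \<cdot> \<eta>)" for y
    using dpow_EE_string[where j = ?j and w = "\<lambda>k. dpow (FF ?j) (int c - int k) \<cdot> \<eta>" and A = "int (M ?j) - int c" and k = y]
    by (simp add: EE_dpow_FF_eta algebra_simps)
  have E2: "dpow (EE i) (int x) \<cdot> T i 0 b' c' = qbin (int (M i) + c' - b') x \<star> T i 0 (b' - int x) c'" for x b' c'
    using dpow_EE_string[where j = i and w = "\<lambda>k. T i 0 (b' - int k) c'" and A = "int (M i) + c' - b'" and k = x]
    by (simp add: EE_inner algebra_simps)
  have "wtv (\<lambda>k. int (M k) - int c * cartan k ?j) (dpow (FF ?j) (int c) \<cdot> \<eta>)"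
    by (intro wtv_dpow_FF wtv_eta)
  from dpow_BB_wtv[OF this, of vs i b] have 1: "dpow (BB vs i) (int b) \<cdot> dpow (BB vs ?j) (int c) \<cdot> \<eta> =
     (\<Sum>y\<le>b. coef1 vs i b c y \<star> T i 0 (int b - int y) (int c - int y))"
    unfolding dpow_BB_eta by (simp add: E1 coef1_def T_eq)
  have "dpow (BB vs ?j) (int a) \<cdot> T i 0 (int b - int y) (int c - int y) =
     (\<Sum>x\<le>a. coef2 vs i a b c x y \<star> T i (int a - int x) (int b - int x - int y) (int c - int y))" for y
  proof -
    let ?b = "int b - int y" and ?c = "int c - int y"
    have F: "dpow (FF ?j) r \<cdot> T i 0 b' c' = T i r b' c'" for r b' c' by (simp add: T_eq)
    have *: "int (M ?j) - ?c * 2 + ?b = int (M ?j) - 2 * int c + int b + int y"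
      "int (M i) + ?c - ?b = int (M i) + int c - int b" "?b - int x = int b - int x - int y" for x
      by simp_all
    have "wtv (\<lambda>k. int (M k) - (0 + ?c) * cartan k ?j - ?b * cartan k i) (T i 0 ?b ?c)"
      by (rule wtv_T)
    from dpow_BB_wtv[OF this, of vs ?j a] show ?thesis
      unfolding tau_tau E2 act_sc F by (simp add: coef2_def * algebra_simps del: diff_diff_eq)
  qed
  then have "dpow (BB vs ?j) (int a) \<cdot> dpow (BB vs i) (int b) \<cdot> dpow (BB vs ?j) (int c) \<cdot> \<eta> =
     (\<Sum>y\<le>b. \<Sum>x\<le>a. (coef1 vs i b c y * coef2 vs i a b c x y) \<star> T i (int a - int x) (int b - int x - int y) (int c - int y))"
    unfolding 1 act_sum act_sc by (simp add: V.scale_sum_right)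
  then show ?thesis by (simp add: Bmon_def act_mult)
qed

text \<open>The exponents add up to y times the left side of the first hypothesis plus tri y - y^2,
  and the latter is at most - y by \<open>tri_le\<close>.\<close>

lemma coef1_qlat:
  assumes "int (M (tau i)) - int (M i) + int b - 2 * int c + vs i \<le> 0" "c \<le> M (tau i)"
  shows "coef1 vs i b c y \<in> qlat (- int y)"
proof -
  let ?e = "int y * (int b - int y) + vs i * int y - (int (M i) + int c) * int y + tri y"
  have "qbin (int (M (tau i)) - int c) y \<in> qlat ((int (M (tau i)) - int c) * int y)"
    using qbin_qlat[of "M (tau i) - c" y] assms(2) by (simp add: of_nat_diff)
  then have "coef1 vs i b c y \<in> qlat (?e + (int (M (tau i)) - int c) * int y)"
    unfolding coef1_def by (intro qlat_mult qq_powi_qlat) simp_all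
  moreover have "?e + (int (M (tau i)) - int c) * int y =
      int y * (int (M (tau i)) - int (M i) + int b - 2 * int c + vs i) + (tri y - int y * int y)"
    by (simp add: algebra_simps)
  moreover have "int y * (int (M (tau i)) - int (M i) + int b - 2 * int c + vs i) \<le> 0"
    using assms(1) by (simp add: mult_nonneg_nonpos)
  ultimately show ?thesis using tri_le[of y] by (auto elim!: qlat_mono)
qed

text \<open>As for \<open>coef1_qlat\<close>, with the second hypothesis; the dependence of the
  weight on y contributes a further - x y, which lowers the degree.\<close>

lemma coef2_qlat:
  assumes "int (M i) - int (M (tau i)) + int a - 2 * int b + 3 * int c + vs (tau i) \<le> 0" "b \<le> M i"
  shows "coef2 vs i a b c x y \<in> qlat (- int x)"
proof -
  let ?e = "int x * (int a - int x) + vs (tau i) * int x - (int (M (tau i)) - 2 * int c + int b + int y) * int x + tri x"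
  have "qbin (int (M i) + int c - int b) x \<in> qlat ((int (M i) + int c - int b) * int x)"
    using qbin_qlat[of "M i + c - b" x] assms(2) by (simp add: of_nat_diff)
  then have "coef2 vs i a b c x y \<in> qlat (?e + (int (M i) + int c - int b) * int x)"
    unfolding coef2_def by (intro qlat_mult qq_powi_qlat) simp_all
  moreover have "?e + (int (M i) + int c - int b) * int x =
      int x * (int (M i) - int (M (tau i)) + int a - 2 * int b + 3 * int c + vs (tau i)) - int x * int y + (tri x - int x * int x)"
    by (simp add: algebra_simps)
  moreover have "int x * (int (M i) - int (M (tau i)) + int a - 2 * int b + 3 * int c + vs (tau i)) \<le> 0"
    using assms(1) by (simp add: mult_nonneg_nonpos)
  moreover have "0 \<le> int x * int y" by simp
  ultimately show ?thesis using tri_le[of x] by (elim qlat_mono) linarith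
qed

lemma coef_00: "coef1 vs i b c 0 = 1" "coef2 vs i a b c 0 y = 1"
  by (simp_all add: coef1_def coef2_def)

text \<open>The part of highest degree of such a combination is congruent to the same combination of the
  bar-fixed monomials \<open>Bmon\<close>, so its coefficients are bar-fixed and hence vanish.\<close>

lemma bar_fixed_lattice_combination:
  assumes fixed: "\<And>u y. bar_graph vs u y \<Longrightarrow> u \<cdot> \<eta> = 0 \<Longrightarrow> y \<cdot> \<eta> = 0"
    and D: "bar_graph vs D D'" "D' \<cdot> \<eta> = D \<cdot> \<eta>"
    and sum: "D \<cdot> \<eta> = (\<Sum>(x, y)\<in>{..a} \<times> {..c}. g (x, y) \<star> T i (int a - int x) (int b - int x - int y) (int c - int y))"
    and g: "\<And>p. g p \<in> qinv_lattice"
    and abc: "a + c < b" "\<And>k. a + b + c \<le> M k"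
  shows "x \<le> a \<Longrightarrow> y \<le> c \<Longrightarrow> g (x, y) = 0"
proof (induction "x + y" arbitrary: x y rule: less_induct)
  case less
  define d where "d = x + y"
  define R where "R = {..a} \<times> {..c}"
  define Rd where "Rd = {p \<in> R. fst p + snd p = d}"
  \<comment> \<open>The index (x, y) shortens the word by 2 (x + y), so this is the word length of
    the layer x + y = d.\<close>
  define e where "e = a + b + c - 2 * d"
  define F where "F = (\<lambda>(x, y). T i (int a - int x) (int b - int x - int y) (int c - int y))"
  define Bp where "Bp = (\<lambda>(x, y). Bmon vs i (int a - int x) (int b - int x - int y) (int c - int y))"
  have fin: "finite R" "finite Rd" by (simp_all add: R_def Rd_def)
  have len: "close (a + b + c - 2 * (fst p + snd p)) (Bp p \<cdot> \<eta>) (F p)" if p: "p \<in> R" for p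
  proof -
    obtain x y where xy: "p = (x, y)" "x \<le> a" "y \<le> c" using p by (auto simp: R_def)
    have 1: "(a - x) + (b - x - y) + (c - y) = a + b + c - 2 * (x + y)" using xy abc by simp
    have 2: "int (a - x) = int a - int x" "int (b - x - y) = int b - int x - int y" "int (c - y) = int c - int y"
      using xy abc by simp_all
    show ?thesis
      using close_Bmon[of "a - x" "b - x - y" "c - y" vs i, unfolded 1 2]
      by (simp only: xy F_def Bp_def prod.case fst_conv snd_conv)
  qed
  have low: "F p \<in> Fl e" if p: "p \<in> R" "d < fst p + snd p" for p
  proof -
    have "F p \<in> Fl (Suc (a + b + c - 2 * (fst p + snd p)))" using len[OF p(1)] by (simp only: close_def)
    then show ?thesis by (rule Fl_mono) (use p abc in \<open>auto simp: R_def e_def\<close>)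
  qed
  have top: "Bp p \<cdot> \<eta> - F p \<in> Fl e" if p: "p \<in> Rd" for p
  proof -
    have "p \<in> R" "fst p + snd p = d" using p by (simp_all add: Rd_def)
    then show ?thesis using len[of p] by (simp only: close_def e_def)
  qed
  define X where "X = (\<Sum>p\<in>Rd. g p \<odot> Bp p)"
  define X' where "X' = (\<Sum>p\<in>Rd. bar (g p) \<odot> Bp p)"
  have X: "bar_graph vs X X'" unfolding X_def X'_def Bp_def by (intro bar_graph_sum bar_graph_sm) (auto intro: bar_graph_Bmon)
  have X_eta: "X \<cdot> \<eta> = (\<Sum>p\<in>Rd. g p \<star> (Bp p \<cdot> \<eta>))" "X' \<cdot> \<eta> = (\<Sum>p\<in>Rd. bar (g p) \<star> (Bp p \<cdot> \<eta>))"
    by (simp_all add: X_def X'_def sum_act)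
  have DX: "(D - X) \<cdot> \<eta> \<in> Fl e"
  proof -
    have "D \<cdot> \<eta> = (\<Sum>p\<in>R. g p \<star> F p)" unfolding sum R_def by (intro sum.cong) (auto simp: F_def)
    also have "\<dots> = (\<Sum>p\<in>R - Rd. g p \<star> F p) + (\<Sum>p\<in>Rd. g p \<star> F p)"
      using fin by (intro sum.subset_diff) (auto simp: Rd_def)
    finally have "(D - X) \<cdot> \<eta> = (\<Sum>p\<in>R - Rd. g p \<star> F p) - (\<Sum>p\<in>Rd. g p \<star> (Bp p \<cdot> \<eta> - F p))"
      by (simp add: act_diff X_eta sc_distrib sum_subtractf)
    moreover have "g p \<star> F p \<in> Fl e" if p: "p \<in> R - Rd" for p
    proof (cases "fst p + snd p < d")
      case True
      then have "g p = 0" using less.hyps[of "fst p" "snd p"] p by (auto simp: d_def R_def)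
      then show ?thesis by (simp add: Fl_0)
    next
      case False
      then show ?thesis using p by (intro Fl_sc low) (auto simp: Rd_def)
    qed
    ultimately show ?thesis by (simp only: Fl_diff Fl_sum Fl_sc top)
  qed
  \<comment> \<open>The remainder D - X consists of words shorter than e, and so does its bar image.
    As D \<eta> is fixed, X \<eta> and its bar image agree up to shorter words.\<close>
  obtain u y' where uy: "bar_graph vs u y'" "u \<cdot> \<eta> = (D - X) \<cdot> \<eta>" "y' \<cdot> \<eta> \<in> Fl e" using Fl_bar_graph[OF DX, of vs] by blast
  have "(D' - X' - y') \<cdot> \<eta> = 0"
    by (rule fixed[OF bar_graph_diff[OF bar_graph_diff[OF D(1) X] uy(1)]]) (simp add: act_diff uy(2))
  then have "(D' - X') \<cdot> \<eta> \<in> Fl e" using uy(3) by (simp add: act_diff)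
  from Fl_diff[OF this DX] have XX: "X \<cdot> \<eta> - X' \<cdot> \<eta> \<in> Fl e" using D(2) by (simp add: act_diff)
  have "(\<Sum>p\<in>Rd. (g p - bar (g p)) \<star> F p) = (X \<cdot> \<eta> - X' \<cdot> \<eta>) - (\<Sum>p\<in>Rd. (g p - bar (g p)) \<star> (Bp p \<cdot> \<eta> - F p))"
    unfolding X_eta sum_subtractf[symmetric] by (intro sum.cong) (simp_all add: sc_distrib)
  also have "\<dots> \<in> Fl e" by (intro Fl_diff XX Fl_sum Fl_sc top)
  finally have FF: "(\<Sum>p\<in>Rd. (g p - bar (g p)) \<star> F p) \<in> Fl e" .
  \<comment> \<open>These are the labels in the convention of \<open>mon\<close>. Because a + c < b,
    the inner node i has strictly larger multiplicity and no tie occurs.\<close>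
  define t where "t = (\<lambda>(x, y). if i = N2 then (a + c - (x + y), b - (x + y), c - y) else (b - (x + y), a + c - (x + y), c - y))"
  have inj: "inj_on t Rd"
    by (auto simp: inj_on_def t_def Rd_def R_def split: if_splits)
  have t: "mon Fmon (t p) \<cdot> \<eta> = F p \<and> allowed M (t p) \<and> mdeg (t p) = e" if p: "p \<in> Rd" for p
  proof -
    obtain x y where xy: "p = (x, y)" "x \<le> a" "y \<le> c" "x + y = d" using p by (auto simp: Rd_def R_def)
    have "int (a + c - d) - int (c - y) = int a - int x" "int (b - d) = int b - int x - int y" "int (c - y) = int c - int y"
      using xy abc by (simp_all add: of_nat_diff)
    then have F: "F p = T i (int (a + c - d) - int (c - y)) (int (b - d)) (int (c - y))"
      by (simp only: F_def xy(1) prod.case)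
    have lt: "a + c - d < b - d" "c - y \<le> a + c - d" "(a + c - d) + (b - d) = e"
      using xy abc by (simp_all add: e_def)
    have M: "c - y \<le> M k" "b - d \<le> M k + (c - y)" for k using abc(2)[of k] by simp_all
    have tp: "t p = (if i = N2 then (a + c - d, b - d, c - y) else (b - d, a + c - d, c - y))"
      using xy by (simp add: t_def)
    show ?thesis
      unfolding F tp using lt M by (cases i) (simp_all add: mon_def allowed_def mdeg_def)
  qed
  define h where "h s = (let p = the_inv_into Rd t s in g p - bar (g p))" for s
  have h: "h (t p) = g p - bar (g p)" if "p \<in> Rd" for p
    by (simp add: h_def the_inv_into_f_f[OF inj that])
  have "(\<Sum>s\<in>t ` Rd. h s \<star> (mon Fmon s \<cdot> \<eta>)) = (\<Sum>p\<in>Rd. (g p - bar (g p)) \<star> F p)"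
    unfolding sum.reindex[OF inj] o_def by (intro sum.cong HOL.refl) (simp add: h t)
  with FF have S: "(\<Sum>s\<in>t ` Rd. h s \<star> (mon Fmon s \<cdot> \<eta>)) \<in> Fl e" by simp
  have xy: "(x, y) \<in> Rd" using less.prems by (simp add: Rd_def R_def d_def)
  have "h (t (x, y)) = 0"
    by (rule mon_Fmon_independent_degree[OF _ S]) (use fin t xy in auto)
  then have "bar (g (x, y)) = g (x, y)" using h[OF xy] by simp
  then show ?case using bar_fixed_qinv_lattice g by blast
qed

end

section \<open>The icanonical basis\<close>

definition cmon :: "node \<Rightarrow> nat \<Rightarrow> nat \<Rightarrow> nat \<Rightarrow> nat \<times> nat \<Rightarrow> Uq" where
  "cmon i a b c = (\<lambda>(x, y). Fmon i (int a - int x) (int b - int x - int y) (int c - int y))"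

lemma cmon_outside: "p \<notin> {..a} \<times> {..c} \<Longrightarrow> cmon i a b c p = 0"
  by (cases p) (auto simp: cmon_def Fmon_def dpow_neg)

text \<open>Outside this box some divided power has a negative exponent and the term is 0. Two
  members of the coset can then be compared over one index set.\<close>

lemma icb_coset_normal:
  "v \<in> icb_coset m n i a b c \<longleftrightarrow> (\<exists>g. (\<forall>p. g p \<in> qinv_lattice) \<and> g (0, 0) = 0 \<and>
     v = act m n (Fmon i (int a) (int b) (int c) + (\<Sum>p\<in>{..a} \<times> {..c}. g p \<odot> cmon i a b c p)) (eta m n))"
proof -
  have lat0: "0 \<in> qinv_lattice" unfolding qinv_lattice_eq by (rule qlat_0)
  have cm: "(\<Sum>(x, y)\<in>S. scal (h (x, y)) * Fmon i (int a - int x) (int b - int x - int y) (int c - int y)) =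
      (\<Sum>p\<in>S. h p \<odot> cmon i a b c p)" for S h
    by (intro sum.cong) (auto simp: cmon_def sm_def)
  show ?thesis
  proof
    assume "v \<in> icb_coset m n i a b c"
    then obtain S h where S: "finite S" "(0, 0) \<notin> S" "\<forall>p\<in>S. h p \<in> qinv_lattice"
      "v = act m n (Fmon i (int a) (int b) (int c) + (\<Sum>p\<in>S. h p \<odot> cmon i a b c p)) (eta m n)"
      unfolding icb_coset_def cm by blast
    define g where "g p = (if p \<in> S then h p else 0)" for p
    have "(\<Sum>p\<in>S. h p \<odot> cmon i a b c p) = (\<Sum>p\<in>S \<inter> {..a} \<times> {..c}. g p \<odot> cmon i a b c p)"
      using S(1) cmon_outside[of _ a c i b] by (intro sum.mono_neutral_cong_right) (auto simp: g_def)
    also have "\<dots> = (\<Sum>p\<in>{..a} \<times> {..c}. g p \<odot> cmon i a b c p)"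
      by (intro sum.mono_neutral_left) (auto simp: g_def)
    finally show "\<exists>g. (\<forall>p. g p \<in> qinv_lattice) \<and> g (0, 0) = 0 \<and>
     v = act m n (Fmon i (int a) (int b) (int c) + (\<Sum>p\<in>{..a} \<times> {..c}. g p \<odot> cmon i a b c p)) (eta m n)"
      using S(2-4) lat0 by (intro exI[of _ g]) (simp add: g_def)
  next
    assume "\<exists>g. (\<forall>p. g p \<in> qinv_lattice) \<and> g (0, 0) = 0 \<and>
     v = act m n (Fmon i (int a) (int b) (int c) + (\<Sum>p\<in>{..a} \<times> {..c}. g p \<odot> cmon i a b c p)) (eta m n)"
    then obtain g where g: "\<forall>p. g p \<in> qinv_lattice" "g (0, 0) = 0"
      "v = act m n (Fmon i (int a) (int b) (int c) + (\<Sum>p\<in>{..a} \<times> {..c}. g p \<odot> cmon i a b c p)) (eta m n)" by blast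
    define S where "S = {..a} \<times> {..c} - {(0, 0)}"
    have "(\<Sum>p\<in>{..a} \<times> {..c}. g p \<odot> cmon i a b c p) = (\<Sum>p\<in>S. g p \<odot> cmon i a b c p)"
      using g(2) by (intro sum.mono_neutral_right) (auto simp: S_def)
    then have "v = act m n (Fmon i (int a) (int b) (int c) + (\<Sum>p\<in>S. g p \<odot> cmon i a b c p)) (eta m n)"
      using g(3) by simp
    moreover have "finite S" "(0, 0) \<notin> S" by (simp_all add: S_def)
    ultimately show "v \<in> icb_coset m n i a b c"
      unfolding icb_coset_def cm using g(1) by blast
  qed
qed

context iqg begin

text \<open>The bounds on m and n make the upper indices of the quantum binomials nonnegative and
  all labels of the occurring monomials allowed.\<close>

context
  fixes i :: node and a b c m n :: nat
  assumes hyp1: "int (hw m n (tau i)) - int (hw m n i) + int b - 2 * int c + vs i \<le> 0"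
    and hyp2: "int (hw m n i) - int (hw m n (tau i)) + int a - 2 * int b + 3 * int c + vs (tau i) \<le> 0"
    and large: "a + b + c \<le> m" "a + b + c \<le> n"
begin

lemma large_hw: "a + b + c \<le> hw m n k"
  using large by (cases k) simp_all

lemma gap: "a + c < b"
proof -
  have "vs i + vs (tau i) = 1" using vs_sum by (cases i) simp_all
  then show ?thesis using hyp1 hyp2 by simp
qed

lemma Bmon_in_coset: "act m n (Bm i (int a) (int b) (int c)) (eta m n) \<in> icb_coset m n i a b c"
proof -
  interpret v: hw_mod uact "vacuum m n" "hw m n" by (rule hw_vacuum)
  define h where "h = (\<lambda>(x, y). v.coef1 vs i b c y * v.coef2 vs i a b c x y)"
  define g where "g p = (if p = (0, 0) then 0 else h p)" for p
  have h00: "h (0, 0) = 1" by (simp add: h_def v.coef_00)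
  have "h (x, y) \<in> qinv_lattice" if "(x, y) \<noteq> (0, 0)" for x y
  proof -
    have "h (x, y) \<in> qlat (- int y + - int x)"
      unfolding h_def prod.case using large_hw[of i] large_hw[of "tau i"]
      by (intro qlat_mult v.coef1_qlat v.coef2_qlat hyp1 hyp2) auto
    then show ?thesis unfolding qinv_lattice_eq by (rule qlat_mono) (use that in auto)
  qed
  then have lat: "g p \<in> qinv_lattice" for p
    by (cases p) (auto simp: g_def qinv_lattice_eq qlat_0)
  let ?c = "cmon i a b c"
  have "uact (Bm i (int a) (int b) (int c)) (vacuum m n) =
     (\<Sum>p\<in>{..a} \<times> {..b}. L.sc (h p) (uact (?c p) (vacuum m n)))"
    unfolding v.Bmon_expansion by (subst sum.swap) (simp add: sum.cartesian_product h_def cmon_def split_beta)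
  \<comment> \<open>Terms with y > c contain a negative divided power and vanish; b > c ensures that
    the smaller box is contained in the larger.\<close>
  also have "\<dots> = (\<Sum>p\<in>{..a} \<times> {..c}. L.sc (h p) (uact (?c p) (vacuum m n)))"
    using gap cmon_outside[of _ a c i b] by (intro sum.mono_neutral_right) auto
  also have "\<dots> = L.sc (h (0, 0)) (uact (?c (0, 0)) (vacuum m n)) +
      (\<Sum>p\<in>{..a} \<times> {..c} - {(0, 0)}. L.sc (h p) (uact (?c p) (vacuum m n)))"
    by (rule sum.remove) auto
  also have "(\<Sum>p\<in>{..a} \<times> {..c} - {(0, 0)}. L.sc (h p) (uact (?c p) (vacuum m n))) =
      (\<Sum>p\<in>{..a} \<times> {..c}. L.sc (g p) (uact (?c p) (vacuum m n)))"
    by (rule sum.mono_neutral_cong_left) (auto simp: g_def)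
  finally have "uact (Bm i (int a) (int b) (int c)) (vacuum m n) =
      uact (Fmon i (int a) (int b) (int c) + (\<Sum>p\<in>{..a} \<times> {..c}. g p \<odot> ?c p)) (vacuum m n)"
    unfolding h00 by (simp add: L.act_add L.sum_act cmon_def)
  then show ?thesis
    unfolding icb_coset_normal act_eta_eq_iff using lat by (intro exI[of _ g]) (simp add: g_def)
qed

text \<open>Two candidates share the leading coefficient 1, so their difference is bar-fixed with
  all coefficients in q^-1 Z[q^-1], and \<open>bar_fixed_lattice_combination\<close> makes these
  vanish.\<close>

lemma icbL_eq: "icbL vs m n i a b c = act m n (Bm i (int a) (int b) (int c)) (eta m n)"
  unfolding icbL_def
proof (rule the_equality)
  let ?B = "Bm i (int a) (int b) (int c)"
  show "act m n ?B (eta m n) \<in> icb_coset m n i a b c \<and> psiL vs m n (act m n ?B (eta m n)) = act m n ?B (eta m n)"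
    using Bmon_in_coset psiL_eq[OF bar_graph_Bmon] by blast
  fix v assume v: "v \<in> icb_coset m n i a b c \<and> psiL vs m n v = v"
  interpret v: hw_mod uact "vacuum m n" "hw m n" by (rule hw_vacuum)
  let ?v = "vacuum m n" and ?c = "cmon i a b c" and ?R = "{..a} \<times> {..c}"
  obtain g where g: "\<And>p. g p \<in> qinv_lattice"
    "v = act m n (Fmon i (int a) (int b) (int c) + (\<Sum>p\<in>?R. g p \<odot> ?c p)) (eta m n)"
    using v unfolding icb_coset_normal by blast
  obtain g0 where g0: "\<And>p. g0 p \<in> qinv_lattice"
    "act m n ?B (eta m n) = act m n (Fmon i (int a) (int b) (int c) + (\<Sum>p\<in>?R. g0 p \<odot> ?c p)) (eta m n)"
    using Bmon_in_coset unfolding icb_coset_normal by blast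
  have "v \<in> Lmod m n" unfolding g(2) act_eta_eq Lmod_def quot_def by blast
  then obtain u where u: "u \<in> Ui vs" "v = act m n u (eta m n)" using Lmod_Ui by blast
  obtain u' where u': "bar_graph vs u u'" using Ui_bar_graph[OF u(1)] by blast
  have "act m n u' (eta m n) = act m n u (eta m n)" using v psiL_eq[OF u'] u(2) by simp
  then have fixed: "uact u' ?v = uact u ?v" unfolding act_eta_eq_iff .
  have uv: "uact u ?v = uact (Fmon i (int a) (int b) (int c) + (\<Sum>p\<in>?R. g p \<odot> ?c p)) ?v"
    using u(2) g(2) act_eta_eq_iff by metis
  have Bv: "uact ?B ?v = uact (Fmon i (int a) (int b) (int c) + (\<Sum>p\<in>?R. g0 p \<odot> ?c p)) ?v"
    using g0(2) act_eta_eq_iff by metis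
  have D: "uact (u - ?B) ?v = (\<Sum>(x, y)\<in>?R. L.sc (g (x, y) - g0 (x, y))
      (uact (Fmon i (int a - int x) (int b - int x - int y) (int c - int y)) ?v))"
    by (simp add: L.act_diff uv Bv L.act_add L.sum_act cmon_def split_beta L.sc_distrib sum_subtractf)
  have 0: "g (x, y) - g0 (x, y) = 0" if xy: "x \<le> a" "y \<le> c" for x y
  proof (rule v.bar_fixed_lattice_combination[where D = "u - ?B" and D' = "u' - ?B" and vs = vs and i = i
        and a = a and b = b and c = c and g = "\<lambda>p. g p - g0 p"])
    show "bar_graph vs (u - ?B) (u' - ?B)" by (rule bar_graph_diff[OF u' bar_graph_Bmon])
    show "uact (u' - ?B) ?v = uact (u - ?B) ?v" by (simp add: L.act_diff fixed)
    show "g p - g0 p \<in> qinv_lattice" for p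
      using g(1) g0(1) unfolding qinv_lattice_eq by (intro qlat_diff)
  qed (use bar_graph_vacuum D gap large_hw xy in auto)
  have "uact (u - ?B) ?v = 0"
    unfolding D by (intro sum.neutral) (auto simp: 0)
  then show "v = act m n ?B (eta m n)"
    unfolding u(2) act_eta_eq_iff by (simp add: L.act_diff)
qed

end

section \<open>Passage to the modified iquantum group\<close>

lemma cls_dot_ideal_eq:
  assumes "x - y \<in> dot_ideal vs \<zeta>"
  shows "dot vs \<zeta> x = dot vs \<zeta> y"
proof -
  have neg: "y - x \<in> dot_ideal vs \<zeta>"
    using dot_ideal_mult[OF assms Ui.scal[of "- 1"]] by (simp flip: sm_def)
  have "z - x \<in> dot_ideal vs \<zeta> \<longleftrightarrow> z - y \<in> dot_ideal vs \<zeta>" for z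
  proof
    assume "z - x \<in> dot_ideal vs \<zeta>"
    from dot_ideal_add[OF this assms] show "z - y \<in> dot_ideal vs \<zeta>" by simp
  next
    assume "z - y \<in> dot_ideal vs \<zeta>"
    from dot_ideal_add[OF this neg] show "z - x \<in> dot_ideal vs \<zeta>" by simp
  qed
  then show ?thesis by (simp add: dot_def cls_def)
qed

lemma dot_act_eta_dot:
  assumes "int m - int n = \<zeta>"
  shows "dot_act_eta m n (dot vs \<zeta> x) = act m n x (eta m n)"
proof -
  have "act m n z (eta m n) = act m n x (eta m n)" if "z \<in> dot vs \<zeta> x" for z
  proof -
    have "z - x \<in> dot_ideal vs (int m - int n)" using that assms by (simp add: dot_def cls_def)
    from dot_ideal_vacuum[OF this] show ?thesis
      unfolding act_eta_eq_iff by (simp add: L.act_diff)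
  qed
  then have "dot_act_eta m n (dot vs \<zeta> x) = (\<Union>z\<in>dot vs \<zeta> x. act m n x (eta m n))"
    unfolding dot_act_eta_def by (rule SUP_cong[OF HOL.refl])
  moreover have "x \<in> dot vs \<zeta> x" by (simp add: dot_def cls_def dot_ideal_0)
  then have "dot vs \<zeta> x \<noteq> {}" by blast
  ultimately show ?thesis by simp
qed

lemma icb_eq:
  assumes hyp1: "(- 1) ^ node_num i * \<zeta> + int b - 2 * int c + vs i \<le> 0"
    and hyp2: "(- 1) ^ node_num (tau i) * \<zeta> + int a - 2 * int b + 3 * int c + vs (tau i) \<le> 0"
  shows "icb vs \<zeta> i a b c = dot vs \<zeta> (Bm i (int a) (int b) (int c))"
  unfolding icb_def
proof (rule the_equality)
  let ?B = "Bm i (int a) (int b) (int c)"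
  have icbL: "icbL vs m n i a b c = act m n ?B (eta m n)"
    if mn: "a + b + c \<le> m" "a + b + c \<le> n" "int m - int n = \<zeta>" for m n
  proof (rule icbL_eq)
    have "(- 1) ^ node_num i * \<zeta> = int (hw m n (tau i)) - int (hw m n i)"
      "(- 1) ^ node_num (tau i) * \<zeta> = int (hw m n i) - int (hw m n (tau i))"
      using mn(3) by (cases i; simp)+
    then show "int (hw m n (tau i)) - int (hw m n i) + int b - 2 * int c + vs i \<le> 0"
      "int (hw m n i) - int (hw m n (tau i)) + int a - 2 * int b + 3 * int c + vs (tau i) \<le> 0"
      using hyp1 hyp2 by simp_all
  qed (use mn in simp_all)
  have "?B \<in> Ui vs" by (rule bar_graph_Ui[OF bar_graph_Bmon])
  then have "dot vs \<zeta> ?B \<in> Udot vs \<zeta>" by (simp add: Udot_def)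
  then show "dot vs \<zeta> ?B \<in> Udot vs \<zeta> \<and>
    (\<exists>N. \<forall>m\<ge>N. \<forall>n\<ge>N. int m - int n = \<zeta> \<longrightarrow> dot_act_eta m n (dot vs \<zeta> ?B) = icbL vs m n i a b c)"
    using icbL dot_act_eta_dot by (intro conjI exI[of _ "a + b + c"]) auto
  fix X assume X: "X \<in> Udot vs \<zeta> \<and>
    (\<exists>N. \<forall>m\<ge>N. \<forall>n\<ge>N. int m - int n = \<zeta> \<longrightarrow> dot_act_eta m n X = icbL vs m n i a b c)"
  then obtain x where x: "x \<in> Ui vs" "X = dot vs \<zeta> x" by (auto simp: Udot_def)
  obtain N where N: "\<And>m n. N \<le> m \<Longrightarrow> N \<le> n \<Longrightarrow> int m - int n = \<zeta> \<Longrightarrow> dot_act_eta m n X = icbL vs m n i a b c"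
    using X by blast
  \<comment> \<open>Both elements act alike on the highest weight vectors of all sufficiently large
    modules, which determines the class.\<close>
  have "x - ?B \<in> dot_ideal vs \<zeta>"
  proof (rule dot_ideal_from_modules[where N = "N + a + b + c"])
    show "x - ?B \<in> Ui vs"
      using Ui_bar_graph[OF x(1)] bar_graph_Ui[OF bar_graph_diff[OF _ bar_graph_Bmon]] by blast
    fix m n assume mn: "N + a + b + c \<le> m" "N + a + b + c \<le> n" "int m - int n = \<zeta>"
    have "act m n x (eta m n) = act m n ?B (eta m n)"
      using N[of m n] icbL[of m n] dot_act_eta_dot[OF mn(3), of x] mn x(2) by simp
    then show "uact (x - ?B) (vacuum m n) = 0"
      unfolding act_eta_eq_iff by (simp add: L.act_diff)
  qed
  then show "X = dot vs \<zeta> ?B" unfolding x(2) by (rule cls_dot_ideal_eq)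
qed

end

text \<open>Large modules serve to identify \<open>icb\<close> with the class of the monomial; once
  this is known, the action can be evaluated in every L(m,n) with m - n = \<zeta>, however small,
  and this is (2).\<close>

theorem proposition2:
  fixes \<zeta> :: int and i :: node and a b c :: nat and vs :: "node \<Rightarrow> int"
  assumes "(vs N1, vs N2) \<in> {(1, 0), (0, 1)}"
  shows
    "((- 1) ^ node_num i * \<zeta> + int b - 2 * int c + vs i \<le> 0 \<longrightarrow>
      (- 1) ^ node_num (tau i) * \<zeta> + int a - 2 * int b + 3 * int c + vs (tau i) \<le> 0 \<longrightarrow>
      b \<ge> a + c \<longrightarrow>
      dot vs \<zeta> (Bmon vs i a b c) = icb vs \<zeta> i a b c)
     \<and>
     (\<forall>m n :: nat. int m - int n = \<zeta> \<longrightarrow>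
      (- 1) ^ node_num i * (int m - int n) + int b - 2 * int c + vs i \<le> 0 \<longrightarrow>
      (- 1) ^ node_num (tau i) * (int m - int n) + int a - 2 * int b + 3 * int c + vs (tau i) \<le> 0 \<longrightarrow>
      dot_act_eta m n (icb vs \<zeta> i a b c) = act m n (Bmon vs i a b c) (eta m n))"
proof -
  interpret iqg vs by unfold_locales (use assms in auto)
  show ?thesis using icb_eq[of i \<zeta> b c a] dot_act_eta_dot by auto
qed

end
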